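(* Let $(M,\Pi)\stackrel{\phi}{\to}(B,\pi)$ be an NCI system of rank $r$ with compact fibers, and let $V$ be an open subset of $B$. Suppose that we have on $V$ an action foliation $\mathfrak A$ and on $\phi^{-1}(V)$ an angle foliation $\mathfrak G$, with transverse foliation $\mathfrak T_{\mathfrak G}$ on $V$. Then: (1) $\mathfrak T_{\mathfrak G}$ is transverse to $\mathfrak A$. (2) The tangent space to $\mathfrak T_{\mathfrak G}$ is generated by (local) Poisson vector fields of $(B,\pi)$ which preserve $\mathfrak A$.
   Context: All manifolds and objects are smooth and real. For a Poisson manifold $(M,\Pi)$ write $\{f,g\}=\Pi(df,dg)$; the Hamiltonian vector field $X_h$ is given by $X_h(g)=\{g,h\}$, and $\Pi^\sharp:T^*M\to TM$ is the induced bundle map, with $\Pi^\sharp(dh)=-X_h$. A (local) first integral of a foliation is a (locally defined) function constant on its leaves. An abstract NCI system of rank $r$ on $(M,\Pi)$ is an $r$-dimensional foliation $\mathfrak F$ of $M$ whose tangent bundle is spanned by Hamiltonian vector fields of local first integrals: each $m\in M$ has a neighborhood on which there are first integrals $f_1,\dots,f_r$ of $\mathfrak F$ such that $X_{f_1},\dots,X_{f_r}$ span $T\mathfrak F$ at every point. An NCI system $(M,\Pi)\stackrel{\phi}{\to}(B,\pi)$ of rank $r$ is such an abstract NCI system whose leaf space $B$ is a smooth Hausdorff manifold; $\phi:M\to B$ is the quotient map, a surjective submersion whose fibers are the (connected) leaves of $\mathfrak F$, and $\pi$ is the unique Poisson structure on $B$ making $\phi$ a Poisson map. It has compact fibers if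 all fibers of $\phi$ are compact. Action lattice sheaf. The action bundle $E\to B$ is the rank $r$ vector bundle with fiber $E_b=\operatorname{Ker}(\pi_b^\sharp)/\{\xi\in T_b^*B\mid \Pi_m^\sharp(\phi^*\xi)=0\}$ ($m\in\phi^{-1}(b)$ arbitrary); its sheaf of sections is $\operatorname{Ker}\pi^\sharp/\operatorname{Ker}(\Pi^\sharp\circ\phi^* )$, and $[\omega]$ is the class of a 1-form $\omega$ with $\pi^\sharp\omega=0$. For $\alpha\in E_b$ the action vector field on $\phi^{-1}(b)$ is $X_\alpha(m)=\Pi_m^\sharp(\phi^*\alpha)$; for a section $e$ of $E$ over $V$, $X_e$ is the vector field on $\phi^{-1}(V)$ restricting to $X_{e(b)}$ on each $\phi^{-1}(b)$. $L_b:=\{\alpha\in E_b\mid \text{the time 1 flow of }X_\alpha\text{ is the identity}\}$ is a lattice in $E_b$; these form a bundle $L\to B$ with fiber $\mathbb Z^r$, and $\mathcal L_B$ is its sheaf of local sections. A trivialization of $\mathcal L_B$ on an open set $W$ is an $r$-tuple of sections over $W$ whose values at each $b\in W$ form a $\mathbb Z$-basis of $L_b$. Local action variables on $W$ are functions $p_1,\dots,p_r$ on $W$ (Casimirs of $\pi$) such that $[dp_1],\dots,[dp_r]$ is a trivialization of $\mathcal L_B$ on $W$. An action foliation on $V$ is a foliation $\mathfrak A$ of $V$ defined in a neighborhood of every point by local action variables ($T\mathfrak A=\bigcap_i\ker dp_i$). A foliation $\mathfrak G$ of $\phi^{-1}(V)$ is an angle foliation if (1) it is transverse to the fibers of $\phi$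 (complementary: $T_mM=T_m\mathfrak G\oplus\ker d_m\phi$); (2) it is invariant under the flows of the action vector fields $X_\ell$ of local sections $\ell$ of $\mathcal L_B$ over open subsets of $V$; (3) it is coisotropic, i.e. $\Pi^\sharp((T\mathfrak G)^\circ)\subset T\mathfrak G$. The $r$-dimensional distribution $m\mapsto\Pi_m^\sharp((T_m\mathfrak G)^\circ)$ on $\phi^{-1}(V)$ projects under $d\phi$ to a well-defined integrable rank $r$ distribution on $V$; $\mathfrak T_{\mathfrak G}$ is the foliation of $V$ tangent to it. (Equivalently: locally $\mathfrak G$ is defined by $\mathbb R/\mathbb Z$-valued functions $\theta_1,\dots,\theta_r$ with $\{\theta_i,\theta_j\}=0$ and $X_{e_i}(\theta_j)=\delta_{i,j}$ for a local trivialization $(e_i)$ of $\mathcal L_B$, and $T\mathfrak T_{\mathfrak G}$ is spanned by $\phi_*X_{\theta_1},\dots,\phi_*X_{\theta_r}$.) Two foliations of $V$ are transverse if their tangent spaces are complementary at each point. *)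

theory Defs
  imports "HOL-Analysis.Analysis"
begin

section \<open>Smooth manifolds\<close>

text \<open>For open \<open>S\<close>: \<open>f\<close> is \<open>k\<close> times continuously differentiable.\<close>

primrec Ck_on :: "nat \<Rightarrow> ('a::real_normed_vector \<Rightarrow> 'b::real_normed_vector) \<Rightarrow> 'a set \<Rightarrow> bool" where
  "Ck_on 0 f S \<longleftrightarrow> continuous_on S f"
| "Ck_on (Suc k) f S \<longleftrightarrow>
     f differentiable_on S \<and> (\<forall>v. Ck_on k (\<lambda>x. frechet_derivative f (at x) v) S)"

definition smooth_on :: "('a::real_normed_vector \<Rightarrow> 'b::real_normed_vector) \<Rightarrow> 'a set \<Rightarrow> bool" where
  "smooth_on f S \<longleftrightarrow> (\<forall>k. Ck_on k f S)"

text \<open>A manifold is a whole type \<open>'m\<close> (with its topology) together with an atlas of charts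
  \<open>(D, c)\<close>, where \<open>c\<close> matters only on its domain \<open>D\<close>. The atlas need not be maximal.\<close>

type_synonym ('m, 'e) atlas = "('m set \<times> ('m \<Rightarrow> 'e)) set"

definition smooth_manifold ::
    "('m::{t2_space, second_countable_topology}, 'e::euclidean_space) atlas \<Rightarrow> bool" where
  "smooth_manifold A \<longleftrightarrow>
     (\<Union>(D, c)\<in>A. D) = UNIV \<and>
     (\<forall>(D, c)\<in>A. open D \<and> open (c ` D) \<and> homeomorphism D (c ` D) c (inv_into D c)) \<and>
     (\<forall>(D, c)\<in>A. \<forall>(D', c')\<in>A. smooth_on (c' \<circ> inv_into D c) (c ` (D \<inter> D')))"

definition smooth_fun_on ::
    "('m::topological_space, 'e::euclidean_space) atlas \<Rightarrow> 'm set
      \<Rightarrow> ('m \<Rightarrow> 'v::real_normed_vector) \<Rightarrow> bool" where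
  "smooth_fun_on A U f \<longleftrightarrow> (\<forall>(D, c)\<in>A. smooth_on (f \<circ> inv_into D c) (c ` (U \<inter> D)))"

definition smooth_map_on ::
    "('m::topological_space, 'e::euclidean_space) atlas
      \<Rightarrow> ('n::topological_space, 'f::euclidean_space) atlas \<Rightarrow> 'm set \<Rightarrow> ('m \<Rightarrow> 'n) \<Rightarrow> bool" where
  "smooth_map_on A A' U \<phi> \<longleftrightarrow>
     continuous_on U \<phi> \<and>
     (\<forall>(D, c)\<in>A. \<forall>(D', c')\<in>A'.
        smooth_on (c' \<circ> \<phi> \<circ> inv_into D c) (c ` (U \<inter> D \<inter> \<phi> -` D')))"

text \<open>The tangent space at \<open>m\<close> is identified with the model space \<open>'e\<close> through a chart at \<open>m\<close>
  chosen once and for all; the cotangent space is then \<open>'e \<Rightarrow>\<^sub>L real\<close>. As the chosen chart may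
  jump from point to point, smoothness of vector fields and forms is \<^emph>\<open>not\<close> smoothness as
  \<open>'e\<close>-valued functions; it is tested on smooth functions below.\<close>

definition chart_at :: "('m, 'e) atlas \<Rightarrow> 'm \<Rightarrow> 'm set \<times> ('m \<Rightarrow> 'e)" where
  "chart_at A m = (SOME C. C \<in> A \<and> m \<in> fst C)"

definition coord :: "('m, 'e) atlas \<Rightarrow> 'm \<Rightarrow> 'm \<Rightarrow> 'e" where
  "coord A m = snd (chart_at A m)"

definition uncoord :: "('m, 'e) atlas \<Rightarrow> 'm \<Rightarrow> 'e \<Rightarrow> 'm" where
  "uncoord A m = inv_into (fst (chart_at A m)) (coord A m)"

definition differential ::
    "('m, 'e::euclidean_space) atlas \<Rightarrow> ('m \<Rightarrow> 'v::real_normed_vector) \<Rightarrow> 'm \<Rightarrow> ('e \<Rightarrow>\<^sub>L 'v)" where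
  "differential A f m = Blinfun (frechet_derivative (f \<circ> uncoord A m) (at (coord A m m)))"

definition tangent_map ::
    "('m, 'e::euclidean_space) atlas \<Rightarrow> ('n, 'f::euclidean_space) atlas \<Rightarrow> ('m \<Rightarrow> 'n) \<Rightarrow> 'm
      \<Rightarrow> ('e \<Rightarrow>\<^sub>L 'f)" where
  "tangent_map A A' \<phi> m = differential A (coord A' (\<phi> m) \<circ> \<phi>) m"

definition pullback ::
    "('m, 'e::euclidean_space) atlas \<Rightarrow> ('n, 'f::euclidean_space) atlas \<Rightarrow> ('m \<Rightarrow> 'n) \<Rightarrow> 'm
      \<Rightarrow> ('f \<Rightarrow>\<^sub>L real) \<Rightarrow> ('e \<Rightarrow>\<^sub>L real)" where
  "pullback A A' \<phi> m \<xi> = \<xi> o\<^sub>L tangent_map A A' \<phi> m"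

definition smooth_vector_field ::
    "('m::topological_space, 'e::euclidean_space) atlas \<Rightarrow> 'm set \<Rightarrow> ('m \<Rightarrow> 'e) \<Rightarrow> bool" where
  "smooth_vector_field A U X \<longleftrightarrow>
     (\<forall>W f. open W \<and> W \<subseteq> U \<and> smooth_fun_on A W (f :: 'm \<Rightarrow> real) \<longrightarrow>
        smooth_fun_on A W (\<lambda>m. differential A f m (X m)))"

definition smooth_one_form ::
    "('m::topological_space, 'e::euclidean_space) atlas \<Rightarrow> 'm set \<Rightarrow> ('m \<Rightarrow> 'e \<Rightarrow>\<^sub>L real) \<Rightarrow> bool" where
  "smooth_one_form A U \<omega> \<longleftrightarrow>
     (\<forall>W X. open W \<and> W \<subseteq> U \<and> smooth_vector_field A W X \<longrightarrow>
        smooth_fun_on A W (\<lambda>m. \<omega> m (X m)))"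

text \<open>\<open>[X, Y](c) = X(Y(c)) - Y(X(c))\<close> for the vector-valued coordinate function \<open>c\<close> of the chosen
  chart at \<open>m\<close>; since \<open>d\<^sub>mc\<close> is the identity of \<open>'e\<close>, the value at \<open>m\<close> is \<open>[X, Y]\<^sub>m\<close>.\<close>

definition lie_bracket ::
    "('m, 'e::euclidean_space) atlas \<Rightarrow> ('m \<Rightarrow> 'e) \<Rightarrow> ('m \<Rightarrow> 'e) \<Rightarrow> 'm \<Rightarrow> 'e" where
  "lie_bracket A X Y m =
     differential A (\<lambda>q. differential A (coord A m) q (Y q)) m (X m)
     - differential A (\<lambda>q. differential A (coord A m) q (X q)) m (Y m)"

text \<open>Integral curves defined for all times and contained in \<open>S\<close>.\<close>

definition integral_curve ::
    "('m::topological_space, 'e::euclidean_space) atlas \<Rightarrow> 'm set \<Rightarrow> ('m \<Rightarrow> 'e) \<Rightarrow> (real \<Rightarrow> 'm)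
      \<Rightarrow> bool" where
  "integral_curve A S X \<gamma> \<longleftrightarrow>
     range \<gamma> \<subseteq> S \<and> continuous_on UNIV \<gamma> \<and>
     (\<forall>t. ((coord A (\<gamma> t) \<circ> \<gamma>) has_vector_derivative X (\<gamma> t)) (at t))"

text \<open>The product atlas on \<open>\<real> \<times> M\<close>.\<close>

definition cylinder_atlas :: "('m, 'e) atlas \<Rightarrow> (real \<times> 'm, real \<times> 'e) atlas" where
  "cylinder_atlas A = (\<lambda>(D, c). (UNIV \<times> D, \<lambda>(t, m). (t, c m))) ` A"

text \<open>\<open>\<Phi>\<close> is the (complete) flow of \<open>X\<close> on the open set \<open>U\<close>.\<close>

definition is_flow ::
    "('m::topological_space, 'e::euclidean_space) atlas \<Rightarrow> 'm set \<Rightarrow> ('m \<Rightarrow> 'e)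
      \<Rightarrow> (real \<Rightarrow> 'm \<Rightarrow> 'm) \<Rightarrow> bool" where
  "is_flow A U X \<Phi> \<longleftrightarrow>
     smooth_map_on (cylinder_atlas A) A (UNIV \<times> U) (\<lambda>(t, m). \<Phi> t m) \<and>
     (\<forall>m\<in>U. \<Phi> 0 m = m \<and> integral_curve A U X (\<lambda>t. \<Phi> t m))"


section \<open>Foliations\<close>

text \<open>A foliation of an open set \<open>U\<close> is represented by its tangent distribution \<open>m \<mapsto> T\<^sub>mF\<close>, which
  is locally the kernel of the differential of a submersion to \<open>\<real>\<^sup>n\<^sup>-\<^sup>k\<close> with components \<open>f\<^sub>i\<close> (they
  form a submersion because their common kernel has dimension \<open>k\<close>). Values outside \<open>U\<close> are
  irrelevant. The leaves are the maximal connected integral manifolds.\<close>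

definition foliation ::
    "('m::topological_space, 'e::euclidean_space) atlas \<Rightarrow> nat \<Rightarrow> 'm set \<Rightarrow> ('m \<Rightarrow> 'e set) \<Rightarrow> bool" where
  "foliation A k U F \<longleftrightarrow>
     open U \<and> k \<le> DIM('e) \<and>
     (\<forall>m\<in>U. \<exists>W (f :: nat \<Rightarrow> 'm \<Rightarrow> real).
        open W \<and> m \<in> W \<and> W \<subseteq> U \<and> (\<forall>i<DIM('e) - k. smooth_fun_on A W (f i)) \<and>
        (\<forall>q\<in>W. F q = {v. \<forall>i<DIM('e) - k. differential A (f i) q v = 0} \<and> dim (F q) = k))"

definition complementary :: "'e::real_vector set \<Rightarrow> 'e set \<Rightarrow> bool" where
  "complementary S T \<longleftrightarrow> S \<inter> T = {0} \<and> {x + y | x y. x \<in> S \<and> y \<in> T} = UNIV"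

definition first_integral ::
    "('m::topological_space, 'e::euclidean_space) atlas \<Rightarrow> ('m \<Rightarrow> 'e set) \<Rightarrow> 'm set \<Rightarrow> ('m \<Rightarrow> real)
      \<Rightarrow> bool" where
  "first_integral A F U f \<longleftrightarrow> smooth_fun_on A U f \<and> (\<forall>m\<in>U. \<forall>v\<in>F m. differential A f m v = 0)"

text \<open>Invariance under the flow of a vector field, which includes the existence of that flow.
  It is used only for action vector fields; these are complete because the fibers are compact.\<close>

definition flow_invariant ::
    "('m::topological_space, 'e::euclidean_space) atlas \<Rightarrow> 'm set \<Rightarrow> ('m \<Rightarrow> 'e) \<Rightarrow> ('m \<Rightarrow> 'e set)
      \<Rightarrow> bool" where
  "flow_invariant A U X F \<longleftrightarrow>
     (\<exists>\<Phi>. is_flow A U X \<Phi> \<and> (\<forall>t. \<forall>m\<in>U. tangent_map A A (\<Phi> t) m ` F m = F (\<Phi> t m)))"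

text \<open>A (possibly incomplete) vector field on \<open>U\<close> preserves a foliation if its brackets with local
  vector fields tangent to the foliation are again tangent to it.\<close>

definition preserves_foliation ::
    "('m::topological_space, 'e::euclidean_space) atlas \<Rightarrow> 'm set \<Rightarrow> ('m \<Rightarrow> 'e) \<Rightarrow> ('m \<Rightarrow> 'e set)
      \<Rightarrow> bool" where
  "preserves_foliation A U Y F \<longleftrightarrow>
     (\<forall>W Z. open W \<and> W \<subseteq> U \<and> smooth_vector_field A W Z \<and> (\<forall>m\<in>W. Z m \<in> F m) \<longrightarrow>
        (\<forall>m\<in>W. lie_bracket A Y Z m \<in> F m))"


section \<open>Poisson structures\<close>

text \<open>A Poisson structure is given as a bivector field, \<open>P m \<xi> \<eta> = \<Pi>\<^sub>m(\<xi>, \<eta>)\<close>.\<close>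

type_synonym ('m, 'e) bivector = "'m \<Rightarrow> ('e \<Rightarrow>\<^sub>L real) \<Rightarrow> ('e \<Rightarrow>\<^sub>L real) \<Rightarrow> real"

definition poisson_bracket ::
    "('m, 'e::euclidean_space) atlas \<Rightarrow> ('m, 'e) bivector \<Rightarrow> ('m \<Rightarrow> real) \<Rightarrow> ('m \<Rightarrow> real) \<Rightarrow> 'm
      \<Rightarrow> real" where
  "poisson_bracket A P f g m = P m (differential A f m) (differential A g m)"

definition poisson_structure ::
    "('m::topological_space, 'e::euclidean_space) atlas \<Rightarrow> ('m, 'e) bivector \<Rightarrow> bool" where
  "poisson_structure A P \<longleftrightarrow>
     (\<forall>m. bounded_bilinear (P m) \<and> (\<forall>\<xi> \<eta>. P m \<xi> \<eta> = - P m \<eta> \<xi>)) \<and>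
     (\<forall>U f g. open U \<and> smooth_fun_on A U f \<and> smooth_fun_on A U g \<longrightarrow>
        smooth_fun_on A U (poisson_bracket A P f g)) \<and>
     (\<forall>U f g h. open U \<and> smooth_fun_on A U f \<and> smooth_fun_on A U g \<and> smooth_fun_on A U h \<longrightarrow>
        (\<forall>m\<in>U. poisson_bracket A P f (poisson_bracket A P g h) m
             + poisson_bracket A P g (poisson_bracket A P h f) m
             + poisson_bracket A P h (poisson_bracket A P f g) m = 0))"

text \<open>\<open>\<eta>(\<Pi>\<^sup>\<sharp>\<xi>) = \<Pi>(\<xi>, \<eta>)\<close>. With \<open>X\<^sub>h = - \<Pi>\<^sup>\<sharp>(dh)\<close> this gives \<open>X\<^sub>h(g) = {g, h}\<close>.\<close>

definition sharp ::
    "('m, 'e::euclidean_space) bivector \<Rightarrow> 'm \<Rightarrow> ('e \<Rightarrow>\<^sub>L real) \<Rightarrow> 'e" where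
  "sharp P m \<xi> = (THE v. \<forall>\<eta>. blinfun_apply \<eta> v = P m \<xi> \<eta>)"

definition hamiltonian_field ::
    "('m, 'e::euclidean_space) atlas \<Rightarrow> ('m, 'e) bivector \<Rightarrow> ('m \<Rightarrow> real) \<Rightarrow> 'm \<Rightarrow> 'e" where
  "hamiltonian_field A P h m = - sharp P m (differential A h m)"

definition casimir_on ::
    "('m::topological_space, 'e::euclidean_space) atlas \<Rightarrow> ('m, 'e) bivector \<Rightarrow> 'm set \<Rightarrow> ('m \<Rightarrow> real)
      \<Rightarrow> bool" where
  "casimir_on A P U f \<longleftrightarrow> smooth_fun_on A U f \<and> (\<forall>m\<in>U. sharp P m (differential A f m) = 0)"

definition poisson_vector_field ::
    "('m::topological_space, 'e::euclidean_space) atlas \<Rightarrow> ('m, 'e) bivector \<Rightarrow> 'm set \<Rightarrow> ('m \<Rightarrow> 'e)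
      \<Rightarrow> bool" where
  "poisson_vector_field A P U Y \<longleftrightarrow>
     smooth_vector_field A U Y \<and>
     (\<forall>W f g. open W \<and> W \<subseteq> U \<and> smooth_fun_on A W f \<and> smooth_fun_on A W g \<longrightarrow>
        (\<forall>m\<in>W. differential A (poisson_bracket A P f g) m (Y m)
             = poisson_bracket A P (\<lambda>q. differential A f q (Y q)) g m
             + poisson_bracket A P f (\<lambda>q. differential A g q (Y q)) m))"

definition poisson_map ::
    "('m::topological_space, 'e::euclidean_space) atlas \<Rightarrow> ('m, 'e) bivector
      \<Rightarrow> ('n::topological_space, 'f::euclidean_space) atlas \<Rightarrow> ('n, 'f) bivector \<Rightarrow> ('m \<Rightarrow> 'n) \<Rightarrow> bool" where
  "poisson_map A P A' P' \<phi> \<longleftrightarrow>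
     (\<forall>m \<xi> \<eta>. P m (pullback A A' \<phi> m \<xi>) (pullback A A' \<phi> m \<eta>) = P' (\<phi> m) \<xi> \<eta>)"


section \<open>NCI systems\<close>

definition abstract_nci ::
    "('m::{t2_space, second_countable_topology}, 'e::euclidean_space) atlas \<Rightarrow> ('m, 'e) bivector
      \<Rightarrow> nat \<Rightarrow> ('m \<Rightarrow> 'e set) \<Rightarrow> bool" where
  "abstract_nci A P r F \<longleftrightarrow>
     smooth_manifold A \<and> poisson_structure A P \<and> foliation A r UNIV F \<and>
     (\<forall>m. \<exists>U f. open U \<and> m \<in> U \<and> (\<forall>i<r. first_integral A F U (f i)) \<and>
        (\<forall>q\<in>U. span ((\<lambda>i. hamiltonian_field A P (f i) q) ` {..<r}) = F q))"

definition vertical ::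
    "('m, 'e::euclidean_space) atlas \<Rightarrow> ('n, 'f::euclidean_space) atlas \<Rightarrow> ('m \<Rightarrow> 'n) \<Rightarrow> 'm \<Rightarrow> 'e set" where
  "vertical A A' \<phi> m = {v. tangent_map A A' \<phi> m v = 0}"

text \<open>The foliation of the NCI system is tangent to \<open>ker d\<phi>\<close>; as the fibers are connected, they are
  exactly its leaves, and the surjective submersion \<open>\<phi>\<close> is the quotient map.\<close>

definition nci_system ::
    "('m::{t2_space, second_countable_topology}, 'e::euclidean_space) atlas \<Rightarrow> ('m, 'e) bivector
      \<Rightarrow> ('n::{t2_space, second_countable_topology}, 'f::euclidean_space) atlas \<Rightarrow> ('n, 'f) bivector
      \<Rightarrow> ('m \<Rightarrow> 'n) \<Rightarrow> nat \<Rightarrow> bool" where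
  "nci_system A P A' P' \<phi> r \<longleftrightarrow>
     abstract_nci A P r (vertical A A' \<phi>) \<and>
     smooth_manifold A' \<and> poisson_structure A' P' \<and>
     smooth_map_on A A' UNIV \<phi> \<and> surj \<phi> \<and> (\<forall>m. surj (blinfun_apply (tangent_map A A' \<phi> m))) \<and>
     (\<forall>b. connected (\<phi> -` {b})) \<and>
     poisson_map A P A' P' \<phi>"

definition compact_fibers :: "('m::topological_space \<Rightarrow> 'n) \<Rightarrow> bool" where
  "compact_fibers \<phi> \<longleftrightarrow> (\<forall>b. compact (\<phi> -` {b}))"


section \<open>The action bundle and the action lattice\<close>

definition sharp_kernel ::
    "('n, 'f::euclidean_space) bivector \<Rightarrow> 'n \<Rightarrow> ('f \<Rightarrow>\<^sub>L real) set" where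
  "sharp_kernel P' b = {\<xi>. sharp P' b \<xi> = 0}"

text \<open>\<open>Ker (\<Pi>\<^sup>\<sharp> \<circ> \<phi>\<^sup>*)\<close> at \<open>b\<close>; the condition does not depend on the point of the fiber.\<close>

definition null_covectors ::
    "('m, 'e::euclidean_space) atlas \<Rightarrow> ('m, 'e) bivector \<Rightarrow> ('n, 'f::euclidean_space) atlas
      \<Rightarrow> ('m \<Rightarrow> 'n) \<Rightarrow> 'n \<Rightarrow> ('f \<Rightarrow>\<^sub>L real) set" where
  "null_covectors A P A' \<phi> b = {\<xi>. \<forall>m\<in>\<phi> -` {b}. sharp P m (pullback A A' \<phi> m \<xi>) = 0}"

text \<open>Elements of \<open>E\<^sub>b\<close> are cosets, i.e. sets of covectors at \<open>b\<close>.\<close>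

definition action_class ::
    "('m, 'e::euclidean_space) atlas \<Rightarrow> ('m, 'e) bivector \<Rightarrow> ('n, 'f::euclidean_space) atlas
      \<Rightarrow> ('n, 'f) bivector \<Rightarrow> ('m \<Rightarrow> 'n) \<Rightarrow> 'n \<Rightarrow> ('f \<Rightarrow>\<^sub>L real) \<Rightarrow> ('f \<Rightarrow>\<^sub>L real) set" where
  "action_class A P A' P' \<phi> b \<xi> =
     {\<eta> \<in> sharp_kernel P' b. \<eta> - \<xi> \<in> null_covectors A P A' \<phi> b}"

definition action_space ::
    "('m, 'e::euclidean_space) atlas \<Rightarrow> ('m, 'e) bivector \<Rightarrow> ('n, 'f::euclidean_space) atlas
      \<Rightarrow> ('n, 'f) bivector \<Rightarrow> ('m \<Rightarrow> 'n) \<Rightarrow> 'n \<Rightarrow> ('f \<Rightarrow>\<^sub>L real) set set" where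
  "action_space A P A' P' \<phi> b = action_class A P A' P' \<phi> b ` sharp_kernel P' b"

definition representative :: "'a set \<Rightarrow> 'a" where
  "representative \<alpha> = (SOME \<xi>. \<xi> \<in> \<alpha>)"

definition action_vector ::
    "('m, 'e::euclidean_space) atlas \<Rightarrow> ('m, 'e) bivector \<Rightarrow> ('n, 'f::euclidean_space) atlas
      \<Rightarrow> ('m \<Rightarrow> 'n) \<Rightarrow> ('f \<Rightarrow>\<^sub>L real) set \<Rightarrow> 'm \<Rightarrow> 'e" where
  "action_vector A P A' \<phi> \<alpha> m = sharp P m (pullback A A' \<phi> m (representative \<alpha>))"

definition action_field ::
    "('m, 'e::euclidean_space) atlas \<Rightarrow> ('m, 'e) bivector \<Rightarrow> ('n, 'f::euclidean_space) atlas
      \<Rightarrow> ('m \<Rightarrow> 'n) \<Rightarrow> ('n \<Rightarrow> ('f \<Rightarrow>\<^sub>L real) set) \<Rightarrow> 'm \<Rightarrow> 'e" where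
  "action_field A P A' \<phi> e m = action_vector A P A' \<phi> (e (\<phi> m)) m"

definition action_lattice ::
    "('m::topological_space, 'e::euclidean_space) atlas \<Rightarrow> ('m, 'e) bivector
      \<Rightarrow> ('n, 'f::euclidean_space) atlas \<Rightarrow> ('n, 'f) bivector \<Rightarrow> ('m \<Rightarrow> 'n) \<Rightarrow> 'n
      \<Rightarrow> ('f \<Rightarrow>\<^sub>L real) set set" where
  "action_lattice A P A' P' \<phi> b =
     {\<alpha> \<in> action_space A P A' P' \<phi> b. \<forall>m\<in>\<phi> -` {b}. \<exists>\<gamma>.
        integral_curve A (\<phi> -` {b}) (action_vector A P A' \<phi> \<alpha>) \<gamma> \<and> \<gamma> 0 = m \<and> \<gamma> 1 = m}"

text \<open>Sections of \<open>E\<close>, hence of \<open>L\<close>, are locally classes of smooth 1-forms \<open>\<omega>\<close> with \<open>\<pi>\<^sup>\<sharp>\<omega> = 0\<close>.\<close>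

definition lattice_section ::
    "('m::topological_space, 'e::euclidean_space) atlas \<Rightarrow> ('m, 'e) bivector
      \<Rightarrow> ('n::topological_space, 'f::euclidean_space) atlas \<Rightarrow> ('n, 'f) bivector \<Rightarrow> ('m \<Rightarrow> 'n)
      \<Rightarrow> 'n set \<Rightarrow> ('n \<Rightarrow> ('f \<Rightarrow>\<^sub>L real) set) \<Rightarrow> bool" where
  "lattice_section A P A' P' \<phi> U e \<longleftrightarrow>
     (\<forall>b\<in>U. e b \<in> action_lattice A P A' P' \<phi> b \<and>
        (\<exists>W \<omega>. open W \<and> b \<in> W \<and> W \<subseteq> U \<and> smooth_one_form A' W \<omega> \<and>
           (\<forall>q\<in>W. \<omega> q \<in> sharp_kernel P' q \<and> e q = action_class A P A' P' \<phi> q (\<omega> q))))"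

text \<open>Integer combinations of cosets are formed through representatives.\<close>

definition integer_basis ::
    "('m::topological_space, 'e::euclidean_space) atlas \<Rightarrow> ('m, 'e) bivector
      \<Rightarrow> ('n, 'f::euclidean_space) atlas \<Rightarrow> ('n, 'f) bivector \<Rightarrow> ('m \<Rightarrow> 'n) \<Rightarrow> nat \<Rightarrow> 'n
      \<Rightarrow> (nat \<Rightarrow> ('f \<Rightarrow>\<^sub>L real) set) \<Rightarrow> bool" where
  "integer_basis A P A' P' \<phi> r b \<alpha> \<longleftrightarrow>
     (\<forall>i<r. \<alpha> i \<in> action_lattice A P A' P' \<phi> b) \<and>
     (\<forall>\<beta>\<in>action_lattice A P A' P' \<phi> b. \<exists>!k :: nat \<Rightarrow> int. (\<forall>i\<ge>r. k i = 0) \<and>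
        \<beta> = action_class A P A' P' \<phi> b (\<Sum>i<r. of_int (k i) *\<^sub>R representative (\<alpha> i)))"

definition lattice_trivialization ::
    "('m::topological_space, 'e::euclidean_space) atlas \<Rightarrow> ('m, 'e) bivector
      \<Rightarrow> ('n::topological_space, 'f::euclidean_space) atlas \<Rightarrow> ('n, 'f) bivector \<Rightarrow> ('m \<Rightarrow> 'n)
      \<Rightarrow> nat \<Rightarrow> 'n set \<Rightarrow> (nat \<Rightarrow> 'n \<Rightarrow> ('f \<Rightarrow>\<^sub>L real) set) \<Rightarrow> bool" where
  "lattice_trivialization A P A' P' \<phi> r W e \<longleftrightarrow>
     (\<forall>i<r. lattice_section A P A' P' \<phi> W (e i)) \<and>
     (\<forall>b\<in>W. integer_basis A P A' P' \<phi> r b (\<lambda>i. e i b))"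

definition action_variables ::
    "('m::topological_space, 'e::euclidean_space) atlas \<Rightarrow> ('m, 'e) bivector
      \<Rightarrow> ('n::topological_space, 'f::euclidean_space) atlas \<Rightarrow> ('n, 'f) bivector \<Rightarrow> ('m \<Rightarrow> 'n)
      \<Rightarrow> nat \<Rightarrow> 'n set \<Rightarrow> (nat \<Rightarrow> 'n \<Rightarrow> real) \<Rightarrow> bool" where
  "action_variables A P A' P' \<phi> r W p \<longleftrightarrow>
     (\<forall>i<r. casimir_on A' P' W (p i)) \<and>
     lattice_trivialization A P A' P' \<phi> r W (\<lambda>i b. action_class A P A' P' \<phi> b (differential A' (p i) b))"


section \<open>Action, angle and transverse foliations\<close>

definition action_foliation ::
    "('m::topological_space, 'e::euclidean_space) atlas \<Rightarrow> ('m, 'e) bivector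
      \<Rightarrow> ('n::topological_space, 'f::euclidean_space) atlas \<Rightarrow> ('n, 'f) bivector \<Rightarrow> ('m \<Rightarrow> 'n)
      \<Rightarrow> nat \<Rightarrow> 'n set \<Rightarrow> ('n \<Rightarrow> 'f set) \<Rightarrow> bool" where
  "action_foliation A P A' P' \<phi> r V F \<longleftrightarrow>
     foliation A' (DIM('f) - r) V F \<and>
     (\<forall>b\<in>V. \<exists>W p. open W \<and> b \<in> W \<and> W \<subseteq> V \<and> action_variables A P A' P' \<phi> r W p \<and>
        (\<forall>q\<in>W. F q = {v. \<forall>i<r. differential A' (p i) q v = 0}))"

definition annihilator :: "'e::real_normed_vector set \<Rightarrow> ('e \<Rightarrow>\<^sub>L real) set" where
  "annihilator S = {\<xi>. \<forall>v\<in>S. blinfun_apply \<xi> v = 0}"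

definition angle_foliation ::
    "('m::topological_space, 'e::euclidean_space) atlas \<Rightarrow> ('m, 'e) bivector
      \<Rightarrow> ('n::topological_space, 'f::euclidean_space) atlas \<Rightarrow> ('n, 'f) bivector \<Rightarrow> ('m \<Rightarrow> 'n)
      \<Rightarrow> nat \<Rightarrow> 'n set \<Rightarrow> ('m \<Rightarrow> 'e set) \<Rightarrow> bool" where
  "angle_foliation A P A' P' \<phi> r V G \<longleftrightarrow>
     foliation A (DIM('e) - r) (\<phi> -` V) G \<and>
     (\<forall>m\<in>\<phi> -` V. complementary (G m) (vertical A A' \<phi> m)) \<and>
     (\<forall>U e. open U \<and> U \<subseteq> V \<and> lattice_section A P A' P' \<phi> U e \<longrightarrow>
        flow_invariant A (\<phi> -` U) (action_field A P A' \<phi> e) G) \<and>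
     (\<forall>m\<in>\<phi> -` V. sharp P m ` annihilator (G m) \<subseteq> G m)"

text \<open>\<open>T\<close> is the foliation \<open>T\<^sub>G\<close> of \<open>V\<close>, tangent to the projection of \<open>\<Pi>\<^sup>\<sharp>((TG)\<^sup>\<circ>)\<close>.\<close>

definition transverse_foliation ::
    "('m::topological_space, 'e::euclidean_space) atlas \<Rightarrow> ('m, 'e) bivector
      \<Rightarrow> ('n::topological_space, 'f::euclidean_space) atlas \<Rightarrow> ('m \<Rightarrow> 'n)
      \<Rightarrow> nat \<Rightarrow> 'n set \<Rightarrow> ('m \<Rightarrow> 'e set) \<Rightarrow> ('n \<Rightarrow> 'f set) \<Rightarrow> bool" where
  "transverse_foliation A P A' \<phi> r V G T \<longleftrightarrow>
     foliation A' r V T \<and>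
     (\<forall>m\<in>\<phi> -` V. T (\<phi> m) = tangent_map A A' \<phi> m ` (sharp P m ` annihilator (G m)))"

end

(* Along a fiber of phi, a Hamiltonian vector field of a pulled back function commutes with the
   Hamiltonian vector fields of local first integrals, which span the tangent spaces of the fiber, so
   by Gronwall it vanishes on the whole connected fiber as soon as it vanishes at one point. If the
   vector fields X_i = Pi#(phi^* dp_i) of action variables were linearly dependent, Dirichlet
   approximation would give integers k_i, not all zero, such that sum_i k_i X_i is on that fiber a
   combination of the X_i with arbitrarily small coefficients. Its orbits have period 1, because the
   X_i commute and have 1-periodic flows, but a field with small Lipschitz constant has no such
   orbits; so it vanishes, which contradicts the uniqueness of integer coordinates in the lattice.
   Hence the X_i span the tangent spaces of the fibers. A covector that annihilates G and pairs
   trivially with all X_i is zero, so the transverse foliation T meets the action foliation trivially.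

   The fields Y_i tangent to T with Y_i(p_j) = delta_ij preserve the action foliation. If a function g
   near m is constant along G, then {g, u o phi} = sum_i {g, p_i o phi} (Y_i u) o phi, and C = {g, p_i o phi}
   is again constant along G by invariance. Apply this to the Jacobi identity for g, u o phi, v o phi:
   the terms with derivatives of C cancel, since {{g, p_i o phi}, p_l o phi} is symmetric in i and l,
   and what remains says that each Y_i is a derivation of the Poisson bracket. *)

theory Submission
  imports Defs
begin

section \<open>Calculus of smooth functions on open sets\<close>

text \<open>Two obstacles shape the proof. An integer basis only has unique integer coordinates,
  which says nothing about real relations, and discreteness is not part of the definition of the
  lattice. A real relation is therefore scaled so that one coefficient is 1; in Dirichlet's theorem
  the numerator belonging to it is then the denominator itself, hence nonzero. Second, no angle
  functions with constant brackets against the \<open>p_l\<close> are at hand, only functions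
  \<open>g_j\<close> that locally define G. Their brackets \<open>C_jl\<close> with the
  \<open>p_l\<close> vary, so derivatives of \<open>C_jl\<close> have to be carried along. If
  \<open>E_l\<close> is the failure of \<open>Y_l\<close> to be a derivation of the bracket, what
  remains is \<open>sum_l C_jl E_l = 0\<close> for all j. It says that \<open>sum_l E_l X_l\<close>
  is tangent to G as well as to the fiber, so all \<open>E_l\<close> vanish. The fields
  \<open>Y_i\<close> belong to the frame dual to the \<open>p_i\<close> together with the functions
  that locally define T. The differentials of these functions have no common zero vector but 0
  because T meets the action foliation trivially.\<close>

lemma frechet_derivative_eqI:
  "(f has_derivative f') (at x) \<Longrightarrow> frechet_derivative f (at x) = f'"
  using frechet_derivative_at by metis

lemma Ck_on_Suc_open:
  assumes "open S"
  shows "Ck_on (Suc k) f S \<longleftrightarrow>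
    (\<forall>x\<in>S. f differentiable at x) \<and> (\<forall>v. Ck_on k (\<lambda>x. frechet_derivative f (at x) v) S)"
  unfolding Ck_on.simps differentiable_on_def using at_within_open[OF _ assms] by metis

declare Ck_on.simps(2) [simp del]

lemma Ck_on_SucI:
  assumes "open S" "\<And>x. x \<in> S \<Longrightarrow> f differentiable at x"
    "\<And>v. Ck_on k (\<lambda>x. frechet_derivative f (at x) v) S"
  shows "Ck_on (Suc k) f S"
  using assms Ck_on_Suc_open by blast

lemma Ck_on_Suc_differentiable: "Ck_on (Suc k) f S \<Longrightarrow> open S \<Longrightarrow> x \<in> S \<Longrightarrow> f differentiable at x"
  and Ck_on_Suc_frechet: "Ck_on (Suc k) f S \<Longrightarrow> open S \<Longrightarrow> Ck_on k (\<lambda>x. frechet_derivative f (at x) v) S"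
  using Ck_on_Suc_open by blast+

text \<open>On an open set the full derivative at a point depends only on the values on the set.
  This lets the induction replace the derivatives of \<open>g\<close> by those of
  \<open>f\<close>.\<close>

lemma Ck_on_cong:
  assumes "open S" "\<And>x. x \<in> S \<Longrightarrow> f x = g x" "Ck_on k f S"
  shows "Ck_on k g S"
  using assms(2,3)
proof (induction k arbitrary: f g)
  case 0
  then show ?case by (metis Ck_on.simps(1) continuous_on_cong)
next
  case (Suc k)
  have D: "(g has_derivative frechet_derivative f (at x)) (at x)" if "x \<in> S" for x
    using Suc.prems that \<open>open S\<close>
    by (metis Ck_on_Suc_differentiable frechet_derivative_works has_derivative_transform_within_open)
  note eq = frechet_derivative_eqI[OF D]
  show ?case
  proof (rule Ck_on_SucI[OF \<open>open S\<close>])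
    show "Ck_on k (\<lambda>x. frechet_derivative g (at x) v) S" for v
      by (rule Suc.IH[where f = "\<lambda>x. frechet_derivative f (at x) v"])
        (simp_all add: eq Ck_on_Suc_frechet[OF Suc.prems(2) \<open>open S\<close>])
  qed (rule differentiableI[OF D])
qed

lemma Ck_on_subset:
  assumes "Ck_on k f S" "T \<subseteq> S"
  shows "Ck_on k f T"
  using assms
proof (induction k arbitrary: f)
  case 0
  then show ?case using continuous_on_subset by auto
next
  case (Suc k)
  then show ?case using differentiable_on_subset by (fastforce simp: Ck_on.simps(2))
qed

lemma Ck_on_SucD: "open S \<Longrightarrow> Ck_on (Suc k) f S \<Longrightarrow> Ck_on k f S"
proof (induction k arbitrary: f)
  case 0
  then show ?case by (simp add: Ck_on.simps(2) differentiable_imp_continuous_on)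
next
  case (Suc k)
  then show ?case by (metis Ck_on.simps(2))
qed

lemma Ck_on_local:
  assumes "open S" "\<And>x. x \<in> S \<Longrightarrow> \<exists>T. open T \<and> x \<in> T \<and> Ck_on k f T"
  shows "Ck_on k f S"
  using assms(2)
proof (induction k arbitrary: f)
  case 0
  have "isCont f x" if "x \<in> S" for x
  proof -
    from 0[OF that] obtain T where T: "open T" "x \<in> T" "continuous_on T f" by auto
    then show ?thesis by (simp add: continuous_on_eq_continuous_at)
  qed
  then have "continuous_on S f" by (intro continuous_at_imp_continuous_on) blast
  then show ?case by simp
next
  case (Suc k)
  show ?case
  proof (rule Ck_on_SucI[OF \<open>open S\<close>])
    show "Ck_on k (\<lambda>x. frechet_derivative f (at x) v) S" for v
    proof (rule Suc.IH)
      fix x assume "x \<in> S"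
      from Suc.prems[OF this] obtain T where T: "open T" "x \<in> T" "Ck_on (Suc k) f T" by auto
      then show "\<exists>T. open T \<and> x \<in> T \<and> Ck_on k (\<lambda>x. frechet_derivative f (at x) v) T"
        using Ck_on_Suc_frechet[OF T(3,1)] by auto
    qed
    fix x assume "x \<in> S"
    from Suc.prems[OF this] obtain T where T: "open T" "x \<in> T" "Ck_on (Suc k) f T" by auto
    show "f differentiable at x" by (rule Ck_on_Suc_differentiable[OF T(3,1,2)])
  qed
qed

lemma Ck_on_const: "open S \<Longrightarrow> Ck_on k (\<lambda>x. c) S"
proof (induction k arbitrary: c)
  case (Suc k)
  then show ?case unfolding Ck_on_Suc_open[OF Suc.prems] by simp
qed simp

lemma frechet_derivative_bounded_linear_compose:
  assumes "bounded_linear L" "f differentiable at x"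
  shows "frechet_derivative (\<lambda>x. L (f x)) (at x) = (\<lambda>v. L (frechet_derivative f (at x) v))"
  by (rule frechet_derivative_eqI)
     (rule bounded_linear.has_derivative[OF assms(1) assms(2)[unfolded frechet_derivative_works]])

lemma Ck_on_bounded_linear:
  assumes L: "bounded_linear L" and "open S" "Ck_on k f S"
  shows "Ck_on k (\<lambda>x. L (f x)) S"
  using assms(3)
proof (induction k arbitrary: f)
  case 0
  then show ?case using L by (auto intro: bounded_linear.continuous_on)
next
  case (Suc k)
  note d = Ck_on_Suc_differentiable[OF Suc.prems \<open>open S\<close>]
  show ?case
  proof (rule Ck_on_SucI[OF \<open>open S\<close>])
    show "Ck_on k (\<lambda>x. frechet_derivative (\<lambda>x. L (f x)) (at x) v) S" for v
      by (rule Ck_on_cong[where f = "\<lambda>x. L (frechet_derivative f (at x) v)"])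
         (simp_all add: \<open>open S\<close> d frechet_derivative_bounded_linear_compose[OF L] Suc.IH
            Ck_on_Suc_frechet[OF Suc.prems])
    show "(\<lambda>x. L (f x)) differentiable at x" if "x \<in> S" for x
      by (rule differentiableI)
         (rule bounded_linear.has_derivative[OF L d[OF that, unfolded frechet_derivative_works]])
  qed
qed

lemma Ck_on_add:
  assumes "open S" "Ck_on k f S" "Ck_on k g S"
  shows "Ck_on k (\<lambda>x. f x + g x) S"
  using assms(2,3)
proof (induction k arbitrary: f g)
  case 0
  then show ?case by (auto intro: continuous_on_add)
next
  case (Suc k)
  note d = Ck_on_Suc_differentiable[OF Suc.prems(1) \<open>open S\<close>]
    Ck_on_Suc_differentiable[OF Suc.prems(2) \<open>open S\<close>]
  have eq: "frechet_derivative (\<lambda>x. f x + g x) (at x)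
      = (\<lambda>v. frechet_derivative f (at x) v + frechet_derivative g (at x) v)" if "x \<in> S" for x
    by (rule frechet_derivative_eqI)
       (intro has_derivative_add d[OF that, unfolded frechet_derivative_works])
  show ?case
  proof (rule Ck_on_SucI[OF \<open>open S\<close>])
    show "Ck_on k (\<lambda>x. frechet_derivative (\<lambda>x. f x + g x) (at x) v) S" for v
      by (rule Ck_on_cong[where
            f = "\<lambda>x. frechet_derivative f (at x) v + frechet_derivative g (at x) v"])
         (simp_all add: \<open>open S\<close> eq Suc.IH Ck_on_Suc_frechet[OF Suc.prems(1)]
            Ck_on_Suc_frechet[OF Suc.prems(2)])
  qed (use d in auto)
qed

lemma Ck_on_sum:
  assumes "open S" "\<And>i. i \<in> I \<Longrightarrow> Ck_on k (f i) S"
  shows "Ck_on k (\<lambda>x. \<Sum>i\<in>I. f i x) S"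
  using assms(2)
  by (induction I rule: infinite_finite_induct) (auto simp: Ck_on_const Ck_on_add \<open>open S\<close>)

text \<open>The product rule leaves one factor undifferentiated, with one order of regularity to
  spare; \<open>Ck_on_SucD\<close> gives that order up. The bilinear form covers products of reals
  and scalar multiples at once.\<close>

lemma Ck_on_bilinear:
  assumes B: "bounded_bilinear B" and "open S" "Ck_on k f S" "Ck_on k g S"
  shows "Ck_on k (\<lambda>x. B (f x) (g x)) S"
  using assms(3,4)
proof (induction k arbitrary: f g)
  case 0
  then show ?case using B by (auto intro: bounded_bilinear.continuous_on)
next
  case (Suc k)
  note d = Ck_on_Suc_differentiable[OF Suc.prems(1) \<open>open S\<close>]
    Ck_on_Suc_differentiable[OF Suc.prems(2) \<open>open S\<close>]
  have D: "((\<lambda>x. B (f x) (g x)) has_derivative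
      (\<lambda>v. B (f x) (frechet_derivative g (at x) v) + B (frechet_derivative f (at x) v) (g x))) (at x)"
    if "x \<in> S" for x
    by (rule bounded_bilinear.FDERIV[OF B]) (use that d frechet_derivative_works in blast)+
  have C: "Ck_on k (\<lambda>x. frechet_derivative (\<lambda>x. B (f x) (g x)) (at x) v) S" for v
  proof (rule Ck_on_cong[where f = "\<lambda>x. B (f x) (frechet_derivative g (at x) v)
       + B (frechet_derivative f (at x) v) (g x)"])
    show "Ck_on k (\<lambda>x. B (f x) (frechet_derivative g (at x) v)
       + B (frechet_derivative f (at x) v) (g x)) S"
      by (rule Ck_on_add[OF \<open>open S\<close> Suc.IH[OF Ck_on_SucD[OF \<open>open S\<close> Suc.prems(1)]
              Ck_on_Suc_frechet[OF Suc.prems(2) \<open>open S\<close>]]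
            Suc.IH[OF Ck_on_Suc_frechet[OF Suc.prems(1) \<open>open S\<close>]
              Ck_on_SucD[OF \<open>open S\<close> Suc.prems(2)]]])
  qed (simp_all add: \<open>open S\<close> frechet_derivative_eqI[OF D])
  show ?case by (rule Ck_on_SucI[OF \<open>open S\<close> differentiableI[OF D] C])
qed

lemma linear_euclidean_expansion:
  fixes L :: "'a::euclidean_space \<Rightarrow> 'b::real_vector"
  assumes "linear L"
  shows "L x = (\<Sum>b\<in>Basis. (x \<bullet> b) *\<^sub>R L b)"
  by (metis (no_types, lifting) assms euclidean_representation linear_scale linear_sum sum.cong)

lemma frechet_derivative_compose_at:
  assumes "g differentiable at (f x)" "f differentiable at x"
  shows "frechet_derivative (\<lambda>x. g (f x)) (at x)
    = (\<lambda>v. frechet_derivative g (at (f x)) (frechet_derivative f (at x) v))"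
  using frechet_derivative_compose[OF assms(2,1)] by (simp add: o_def)

text \<open>Expanding the derivative of \<open>f\<close> in \<open>Basis\<close> turns the chain
  rule into a finite sum of products: a component of that derivative times a directional derivative
  of \<open>g\<close> after \<open>f\<close>. The latter is again a composition, so the induction
  runs over all \<open>g\<close>.\<close>

lemma Ck_on_compose:
  fixes f :: "'a::real_normed_vector \<Rightarrow> 'b::euclidean_space"
  assumes "open S" "open T" "f ` S \<subseteq> T" "Ck_on k f S" "Ck_on k g T"
  shows "Ck_on k (\<lambda>x. g (f x)) S"
  using assms(4,5)
proof (induction k arbitrary: g)
  case 0
  then show ?case using \<open>f ` S \<subseteq> T\<close> by (metis Ck_on.simps(1) continuous_on_compose2)
next
  case (Suc k)
  have d: "g differentiable at (f x)" "f differentiable at x" if "x \<in> S" for x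
    using that Ck_on_Suc_differentiable[OF Suc.prems(1)] Ck_on_Suc_differentiable[OF Suc.prems(2)]
      assms(1-3) by blast+
  have C: "Ck_on k (\<lambda>x. frechet_derivative (\<lambda>x. g (f x)) (at x) v) S" for v
  proof (rule Ck_on_cong[where f = "\<lambda>x. \<Sum>b\<in>Basis. (frechet_derivative f (at x) v \<bullet> b) *\<^sub>R
      frechet_derivative g (at (f x)) b"])
    show "Ck_on k (\<lambda>x. \<Sum>b\<in>Basis. (frechet_derivative f (at x) v \<bullet> b) *\<^sub>R
        frechet_derivative g (at (f x)) b) S"
    proof (intro Ck_on_sum Ck_on_bilinear[OF bounded_bilinear_scaleR] \<open>open S\<close>)
      fix b :: 'b
      show "Ck_on k (\<lambda>x. frechet_derivative f (at x) v \<bullet> b) S"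
        by (rule Ck_on_bounded_linear[OF bounded_linear_inner_left \<open>open S\<close>])
           (rule Ck_on_Suc_frechet[OF Suc.prems(1) \<open>open S\<close>])
      show "Ck_on k (\<lambda>x. frechet_derivative g (at (f x)) b) S"
        by (rule Suc.IH[OF Ck_on_SucD[OF assms(1) Suc.prems(1)]
              Ck_on_Suc_frechet[OF Suc.prems(2) assms(2)]])
    qed
    show "(\<Sum>b\<in>Basis. (frechet_derivative f (at x) v \<bullet> b) *\<^sub>R frechet_derivative g (at (f x)) b)
        = frechet_derivative (\<lambda>x. g (f x)) (at x) v" if "x \<in> S" for x
      unfolding frechet_derivative_compose_at[OF d[OF that]]
      by (rule linear_euclidean_expansion[OF linear_frechet_derivative[OF d(1)[OF that]], symmetric])
  qed fact
  show ?case
    by (rule Ck_on_SucI[OF \<open>open S\<close> differentiable_chain_at[OF d(2,1), unfolded o_def] C])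
qed

lemma smooth_on_differentiable:
  assumes "open S" "smooth_on f S" "x \<in> S"
  shows "f differentiable at x"
proof -
  have "Ck_on (Suc 0) f S" using assms by (simp add: smooth_on_def del: Ck_on.simps)
  then show ?thesis using assms(1,3) by (rule Ck_on_Suc_differentiable)
qed

lemma smooth_on_frechet_derivative:
  assumes "open S" "smooth_on f S"
  shows "smooth_on (\<lambda>x. frechet_derivative f (at x) v) S"
  unfolding smooth_on_def
proof
  fix k
  have "Ck_on (Suc k) f S" using assms by (simp add: smooth_on_def del: Ck_on.simps)
  then show "Ck_on k (\<lambda>x. frechet_derivative f (at x) v) S" using assms(1) by (rule Ck_on_Suc_frechet)
qed

lemma smooth_on_has_derivative:
  "open S \<Longrightarrow> smooth_on f S \<Longrightarrow> x \<in> S \<Longrightarrow> (f has_derivative frechet_derivative f (at x)) (at x)"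
  using smooth_on_differentiable frechet_derivative_works by blast

lemma smooth_on_continuous: "smooth_on f S \<Longrightarrow> continuous_on S f"
  unfolding smooth_on_def by (metis Ck_on.simps(1))

lemma smooth_on_cong:
  "open S \<Longrightarrow> (\<And>x. x \<in> S \<Longrightarrow> f x = g x) \<Longrightarrow> smooth_on f S \<Longrightarrow> smooth_on g S"
  unfolding smooth_on_def using Ck_on_cong by metis

lemma smooth_on_subset: "smooth_on f S \<Longrightarrow> T \<subseteq> S \<Longrightarrow> smooth_on f T"
  unfolding smooth_on_def using Ck_on_subset by metis

lemma smooth_on_local:
  "open S \<Longrightarrow> (\<And>x. x \<in> S \<Longrightarrow> \<exists>T. open T \<and> x \<in> T \<and> smooth_on f T) \<Longrightarrow> smooth_on f S"
  unfolding smooth_on_def using Ck_on_local by metis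

lemma smooth_on_const: "open S \<Longrightarrow> smooth_on (\<lambda>x. c) S"
  unfolding smooth_on_def using Ck_on_const by metis

lemma smooth_on_bounded_linear:
  "bounded_linear L \<Longrightarrow> open S \<Longrightarrow> smooth_on f S \<Longrightarrow> smooth_on (\<lambda>x. L (f x)) S"
  unfolding smooth_on_def using Ck_on_bounded_linear by metis

lemma smooth_on_sum:
  "open S \<Longrightarrow> (\<And>i. i \<in> I \<Longrightarrow> smooth_on (f i) S) \<Longrightarrow> smooth_on (\<lambda>x. \<Sum>i\<in>I. f i x) S"
  unfolding smooth_on_def using Ck_on_sum by metis

lemma smooth_on_bilinear:
  "bounded_bilinear B \<Longrightarrow> open S \<Longrightarrow> smooth_on f S \<Longrightarrow> smooth_on g S
    \<Longrightarrow> smooth_on (\<lambda>x. B (f x) (g x)) S"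
  unfolding smooth_on_def using Ck_on_bilinear by metis

lemma smooth_on_compose:
  fixes f :: "'a::real_normed_vector \<Rightarrow> 'b::euclidean_space"
  shows "open S \<Longrightarrow> open T \<Longrightarrow> f ` S \<subseteq> T \<Longrightarrow> smooth_on f S \<Longrightarrow> smooth_on g T
    \<Longrightarrow> smooth_on (\<lambda>x. g (f x)) S"
  unfolding smooth_on_def using Ck_on_compose by metis

lemma smooth_on_euclidean:
  fixes f :: "'a::real_normed_vector \<Rightarrow> 'b::euclidean_space"
  assumes "open S" "\<And>b. b \<in> Basis \<Longrightarrow> smooth_on (\<lambda>x. f x \<bullet> b) S"
  shows "smooth_on f S"
proof -
  have "smooth_on (\<lambda>x. \<Sum>b\<in>Basis. (f x \<bullet> b) *\<^sub>R b) S"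
    by (intro smooth_on_sum smooth_on_bilinear[OF bounded_bilinear_scaleR] smooth_on_const assms)
  then show ?thesis by (simp add: euclidean_representation)
qed

lemma smooth_on_derivative_along:
  fixes f :: "'a::euclidean_space \<Rightarrow> 'b::real_normed_vector"
  assumes "open S" "smooth_on f S" "smooth_on X S"
  shows "smooth_on (\<lambda>x. frechet_derivative f (at x) (X x)) S"
proof (rule smooth_on_cong[OF \<open>open S\<close>])
  show "smooth_on (\<lambda>x. \<Sum>b\<in>Basis. (X x \<bullet> b) *\<^sub>R frechet_derivative f (at x) b) S"
    by (intro smooth_on_sum smooth_on_bilinear[OF bounded_bilinear_scaleR] assms
        smooth_on_bounded_linear[OF bounded_linear_inner_left] smooth_on_frechet_derivative)
  show "(\<Sum>b\<in>Basis. (X x \<bullet> b) *\<^sub>R frechet_derivative f (at x) b)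
      = frechet_derivative f (at x) (X x)" if "x \<in> S" for x
    by (rule linear_euclidean_expansion[OF linear_frechet_derivative[OF
          smooth_on_differentiable[OF assms(1,2) that]], symmetric])
qed


section \<open>Curves, mixed second derivatives and differential inequalities\<close>

lemma has_vector_derivative_compose:
  assumes "(\<gamma> has_vector_derivative v) (at t)" "(f has_derivative f') (at (\<gamma> t))"
  shows "((\<lambda>t. f (\<gamma> t)) has_vector_derivative f' v) (at t)"
  using has_derivative_compose[OF assms(1)[unfolded has_vector_derivative_def] assms(2)]
  by (simp add: has_vector_derivative_def linear_scale[OF has_derivative_linear[OF assms(2)]])

text \<open>The mean value theorem is used once in each direction. The point is that the second
  difference on the left is symmetric in \<open>v\<close> and \<open>w\<close>, while the right side
  singles out an order of differentiation.\<close>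

lemma second_difference_mean_value:
  fixes f :: "'a::real_normed_vector \<Rightarrow> real"
  assumes "open S" "smooth_on f S" "h > 0"
    and seg: "\<And>s t. 0 \<le> s \<Longrightarrow> s \<le> h \<Longrightarrow> 0 \<le> t \<Longrightarrow> t \<le> h \<Longrightarrow> x + s *\<^sub>R v + t *\<^sub>R w \<in> S"
  obtains s t where "0 \<le> s" "s \<le> h" "0 \<le> t" "t \<le> h"
    "f (x + h *\<^sub>R v + h *\<^sub>R w) - f (x + h *\<^sub>R v) - f (x + h *\<^sub>R w) + f x
      = h\<^sup>2 * frechet_derivative (\<lambda>y. frechet_derivative f (at y) v) (at (x + s *\<^sub>R v + t *\<^sub>R w)) w"
proof -
  let ?D = "\<lambda>y. frechet_derivative f (at y) v"
  have Df: "((\<lambda>s. f (x + s *\<^sub>R v + t *\<^sub>R w)) has_real_derivative ?D (x + s *\<^sub>R v + t *\<^sub>R w)) (at s)"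
    if "0 \<le> s" "s \<le> h" "0 \<le> t" "t \<le> h" for s t
  proof -
    have "((\<lambda>s. x + s *\<^sub>R v + t *\<^sub>R w) has_vector_derivative v) (at s)"
      by (auto intro!: derivative_eq_intros)
    from has_vector_derivative_compose[OF this smooth_on_has_derivative[OF assms(1,2) seg[OF that]]]
    show ?thesis by (simp add: has_real_derivative_iff_has_vector_derivative)
  qed
  let ?g = "\<lambda>s. f (x + s *\<^sub>R v + h *\<^sub>R w) - f (x + s *\<^sub>R v)"
  have "(?g has_real_derivative (?D (x + s *\<^sub>R v + h *\<^sub>R w) - ?D (x + s *\<^sub>R v))) (at s)"
    if "0 \<le> s" "s \<le> h" for s
    using DERIV_diff[OF Df[OF that, of h] Df[OF that, of 0]] \<open>h > 0\<close> by simp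
  from MVT2[OF \<open>h > 0\<close> this] obtain s where s: "0 < s" "s < h"
    "?g h - ?g 0 = h * (?D (x + s *\<^sub>R v + h *\<^sub>R w) - ?D (x + s *\<^sub>R v))" by auto
  have "((\<lambda>t. ?D (x + s *\<^sub>R v + t *\<^sub>R w)) has_real_derivative
      frechet_derivative ?D (at (x + s *\<^sub>R v + t *\<^sub>R w)) w) (at t)"
    if "0 \<le> t" "t \<le> h" for t
  proof -
    have "((\<lambda>t. x + s *\<^sub>R v + t *\<^sub>R w) has_vector_derivative w) (at t)"
      by (auto intro!: derivative_eq_intros)
    from has_vector_derivative_compose[OF this smooth_on_has_derivative[OF assms(1)
          smooth_on_frechet_derivative[OF assms(1,2)] seg]] that s
    show ?thesis by (simp add: has_real_derivative_iff_has_vector_derivative)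
  qed
  from MVT2[OF \<open>h > 0\<close> this] obtain t where t: "0 < t" "t < h"
    "?D (x + s *\<^sub>R v + h *\<^sub>R w) - ?D (x + s *\<^sub>R v)
      = h * frechet_derivative ?D (at (x + s *\<^sub>R v + t *\<^sub>R w)) w" by auto
  show thesis
    by (rule that[of s t]) (use s t in \<open>simp_all add: power2_eq_square algebra_simps\<close>)
qed

text \<open>The same second difference is evaluated in both orders. Each evaluation point lies in a
  small parallelogram at \<open>x\<close>, so continuity of the two mixed derivatives makes their
  values at \<open>x\<close> differ by less than any \<open>e\<close>.\<close>

lemma frechet_derivative_symmetric_real:
  fixes f :: "'a::real_normed_vector \<Rightarrow> real"
  assumes "open S" "smooth_on f S" "x \<in> S"
  shows "frechet_derivative (\<lambda>y. frechet_derivative f (at y) v) (at x) w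
       = frechet_derivative (\<lambda>y. frechet_derivative f (at y) w) (at x) v"
proof -
  let ?A = "\<lambda>y. frechet_derivative (\<lambda>y. frechet_derivative f (at y) v) (at y) w"
  let ?B = "\<lambda>y. frechet_derivative (\<lambda>y. frechet_derivative f (at y) w) (at y) v"
  have cont: "isCont ?A x" "isCont ?B x"
    using assms smooth_on_continuous[OF smooth_on_frechet_derivative[OF assms(1)
        smooth_on_frechet_derivative[OF assms(1,2)]]]
    by (auto simp: continuous_on_eq_continuous_at)
  have "\<bar>?A x - ?B x\<bar> < e" if "e > 0" for e
  proof -
    obtain d1 where d1: "d1 > 0" "\<And>y. dist y x < d1 \<Longrightarrow> \<bar>?A y - ?A x\<bar> < e/2"
      using cont(1)[unfolded continuous_at_eps_delta, rule_format, of "e/2"] \<open>e > 0\<close>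
      by (auto simp: dist_real_def)
    obtain d2 where d2: "d2 > 0" "\<And>y. dist y x < d2 \<Longrightarrow> \<bar>?B y - ?B x\<bar> < e/2"
      using cont(2)[unfolded continuous_at_eps_delta, rule_format, of "e/2"] \<open>e > 0\<close>
      by (auto simp: dist_real_def)
    obtain d3 where d3: "d3 > 0" "ball x d3 \<subseteq> S" using assms open_contains_ball by blast
    define d where "d = min d1 (min d2 d3)"
    \<comment> \<open>This size makes the sides of the parallelogram reach at most
      \<open>d / 2\<close> from \<open>x\<close>. The summand 1 keeps the denominator positive when
      both vectors are zero.\<close>
    define h where "h = d / (2 * (norm v + norm w + 1))"
    have "d > 0" using d1 d2 d3 by (simp add: d_def)
    have n: "norm v + norm w + 1 > 0" by (simp add: add_nonneg_pos)
    then have "h > 0" using \<open>d > 0\<close> by (simp add: h_def)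
    have near: "dist (x + s *\<^sub>R v + t *\<^sub>R w) x < d"
      if "0 \<le> s" "s \<le> h" "0 \<le> t" "t \<le> h" for s t
    proof -
      have "dist (x + s *\<^sub>R v + t *\<^sub>R w) x = norm (s *\<^sub>R v + t *\<^sub>R w)"
        by (simp add: dist_norm add.assoc)
      also have "\<dots> \<le> s * norm v + t * norm w"
        using norm_triangle_ineq[of "s *\<^sub>R v" "t *\<^sub>R w"] that by simp
      also have "\<dots> \<le> h * norm v + h * norm w"
        by (intro add_mono mult_right_mono) (use that in auto)
      also have "\<dots> \<le> h * (norm v + norm w + 1)"
        using \<open>h > 0\<close> by (simp add: algebra_simps)
      also have "\<dots> = d / 2" using n by (simp add: h_def field_simps)
      finally show ?thesis using \<open>d > 0\<close> by simp
    qed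
    have inS: "y \<in> S" if "dist y x < d" for y
      using that d3 by (auto simp: d_def dist_commute)
    obtain s t where st: "0 \<le> s" "s \<le> h" "0 \<le> t" "t \<le> h"
      "f (x + h *\<^sub>R v + h *\<^sub>R w) - f (x + h *\<^sub>R v) - f (x + h *\<^sub>R w) + f x
        = h\<^sup>2 * ?A (x + s *\<^sub>R v + t *\<^sub>R w)"
      by (rule second_difference_mean_value[OF assms(1,2) \<open>h > 0\<close> inS[OF near]])
    have near': "dist (x + s *\<^sub>R w + t *\<^sub>R v) x < d"
      if "0 \<le> s" "s \<le> h" "0 \<le> t" "t \<le> h" for s t
      using near[of t s] that by (simp add: add_ac)
    obtain s' t' where st': "0 \<le> s'" "s' \<le> h" "0 \<le> t'" "t' \<le> h"
      "f (x + h *\<^sub>R w + h *\<^sub>R v) - f (x + h *\<^sub>R w) - f (x + h *\<^sub>R v) + f x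
        = h\<^sup>2 * ?B (x + s' *\<^sub>R w + t' *\<^sub>R v)"
      by (rule second_difference_mean_value[OF assms(1,2) \<open>h > 0\<close> inS[OF near']])
    have "h\<^sup>2 * ?A (x + s *\<^sub>R v + t *\<^sub>R w) = h\<^sup>2 * ?B (x + s' *\<^sub>R w + t' *\<^sub>R v)"
    proof -
      have "x + h *\<^sub>R w + h *\<^sub>R v = x + h *\<^sub>R v + h *\<^sub>R w" by (simp add: add_ac)
      from st'(5)[unfolded this] st(5) show ?thesis by linarith
    qed
    then have "?A (x + s *\<^sub>R v + t *\<^sub>R w) = ?B (x + s' *\<^sub>R w + t' *\<^sub>R v)"
      using \<open>h > 0\<close> by simp
    moreover have "\<bar>?A (x + s *\<^sub>R v + t *\<^sub>R w) - ?A x\<bar> < e/2"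
      by (rule d1(2)) (use near[OF st(1-4)] in \<open>simp add: d_def\<close>)
    moreover have "\<bar>?B (x + s' *\<^sub>R w + t' *\<^sub>R v) - ?B x\<bar> < e/2"
      by (rule d2(2)) (use near'[OF st'(1-4)] in \<open>simp add: d_def\<close>)
    ultimately show ?thesis by linarith
  qed
  from this[of "\<bar>?A x - ?B x\<bar>"] show ?thesis by (cases "?A x = ?B x") auto
qed

lemma frechet_derivative_inner:
  "f differentiable at x \<Longrightarrow>
    frechet_derivative (\<lambda>y. f y \<bullet> b) (at x) = (\<lambda>v. frechet_derivative f (at x) v \<bullet> b)"
  by (rule frechet_derivative_bounded_linear_compose[OF bounded_linear_inner_left])

lemma frechet_derivative_cong:
  assumes "open S" "x \<in> S" "\<And>y. y \<in> S \<Longrightarrow> f y = g y"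
  shows "frechet_derivative f (at x) = frechet_derivative g (at x)"
proof -
  have "(f has_derivative D) (at x) \<longleftrightarrow> (g has_derivative D) (at x)" for D
    using assms has_derivative_transform_within_open[of f D x UNIV S g]
      has_derivative_transform_within_open[of g D x UNIV S f] by auto
  then show ?thesis by (simp add: frechet_derivative_def)
qed

lemma frechet_derivative_symmetric:
  fixes f :: "'a::real_normed_vector \<Rightarrow> 'b::euclidean_space"
  assumes "open S" "smooth_on f S" "x \<in> S"
  shows "frechet_derivative (\<lambda>y. frechet_derivative f (at y) v) (at x) w
       = frechet_derivative (\<lambda>y. frechet_derivative f (at y) w) (at x) v"
proof (rule euclidean_eqI)
  fix b :: 'b
  have eq: "frechet_derivative (\<lambda>y. frechet_derivative (\<lambda>y. f y \<bullet> b) (at y) v) (at x) w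
      = frechet_derivative (\<lambda>y. frechet_derivative f (at y) v) (at x) w \<bullet> b" for v w
  proof -
    have "frechet_derivative (\<lambda>y. frechet_derivative (\<lambda>y. f y \<bullet> b) (at y) v) (at x)
        = frechet_derivative (\<lambda>y. frechet_derivative f (at y) v \<bullet> b) (at x)"
      by (rule frechet_derivative_cong[OF assms(1,3)])
         (simp add: frechet_derivative_inner smooth_on_differentiable[OF assms(1,2)])
    then show ?thesis
      using smooth_on_differentiable[OF assms(1) smooth_on_frechet_derivative[OF assms(1,2)] assms(3)]
      by (simp add: frechet_derivative_inner)
  qed
  show "frechet_derivative (\<lambda>y. frechet_derivative f (at y) v) (at x) w \<bullet> b
      = frechet_derivative (\<lambda>y. frechet_derivative f (at y) w) (at x) v \<bullet> b"
    using frechet_derivative_symmetric_real[OF assms(1)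
        smooth_on_bounded_linear[OF bounded_linear_inner_left assms(1,2)] assms(3), of b v w]
    by (simp add: eq)
qed

text \<open>The squared norm with an exponential weight is nonincreasing by Cauchy-Schwarz,
  nonnegative, and zero at \<open>a\<close>. The factor 2 in the exponent stems from differentiating
  a square.\<close>

lemma gronwall_zero:
  fixes z :: "real \<Rightarrow> 'a::euclidean_space"
  assumes "a \<le> b" and z: "\<And>t. a \<le> t \<Longrightarrow> t \<le> b \<Longrightarrow> (z has_vector_derivative z' t) (at t)"
    and bound: "\<And>t. a \<le> t \<Longrightarrow> t \<le> b \<Longrightarrow> norm (z' t) \<le> K * norm (z t)" and "z a = 0"
  shows "z b = 0"
proof -
  let ?w = "\<lambda>t. exp (- 2 * K * t) * (z t \<bullet> z t)"
  have d: "(?w has_real_derivative exp (- 2 * K * t) * (2 * (z t \<bullet> z' t) - 2 * K * (z t \<bullet> z t))) (at t)"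
    if "a \<le> t" "t \<le> b" for t
  proof -
    have "((\<lambda>t. z t \<bullet> z t) has_derivative (\<lambda>h. z t \<bullet> (h *\<^sub>R z' t) + (h *\<^sub>R z' t) \<bullet> z t)) (at t)"
      using z[OF that] unfolding has_vector_derivative_def by (intro has_derivative_inner)
    moreover have "(\<lambda>h. z t \<bullet> (h *\<^sub>R z' t) + (h *\<^sub>R z' t) \<bullet> z t) = (*) (2 * (z t \<bullet> z' t))"
      by (auto simp: inner_commute)
    ultimately have "((\<lambda>t. z t \<bullet> z t) has_real_derivative 2 * (z t \<bullet> z' t)) (at t)"
      by (simp add: has_field_derivative_def)
    then show ?thesis by (auto intro!: derivative_eq_intros simp: algebra_simps)
  qed
  have "?w b \<le> ?w a"
  proof (rule DERIV_nonpos_imp_nonincreasing[OF \<open>a \<le> b\<close>])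
    fix t assume t: "a \<le> t" "t \<le> b"
    have "z t \<bullet> z' t \<le> norm (z t) * norm (z' t)" by (rule norm_cauchy_schwarz)
    also have "\<dots> \<le> norm (z t) * (K * norm (z t))"
      by (intro mult_left_mono bound t) simp
    also have "\<dots> = K * (z t \<bullet> z t)" by (simp add: dot_square_norm power2_eq_square)
    finally have "exp (- 2 * K * t) * (2 * (z t \<bullet> z' t) - 2 * K * (z t \<bullet> z t)) \<le> 0"
      by (intro mult_nonneg_nonpos) auto
    with d[OF t] show "\<exists>y. DERIV ?w t :> y \<and> y \<le> 0" by blast
  qed
  also have "?w a = 0" using \<open>z a = 0\<close> by simp
  finally have "z b \<bullet> z b \<le> 0" by (simp add: mult_le_0_iff)
  then show ?thesis using inner_ge_zero[of "z b"] by (metis antisym inner_eq_zero_iff)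
qed

text \<open>Time reversal settles the case \<open>b < a\<close>. Both directions are wanted because
  zeros are later propagated between arbitrary times of a neighbourhood.\<close>

lemma gronwall_zero_two_sided:
  fixes z :: "real \<Rightarrow> 'a::euclidean_space"
  assumes z: "\<And>t. t \<in> {min a b..max a b} \<Longrightarrow> (z has_vector_derivative z' t) (at t)"
    and bound: "\<And>t. t \<in> {min a b..max a b} \<Longrightarrow> norm (z' t) \<le> K * norm (z t)" and "z a = 0"
  shows "z b = 0"
proof (cases "a \<le> b")
  case True
  then show ?thesis using gronwall_zero[of a b z z' K] assms by auto
next
  case False
  have "((\<lambda>t. z (- t)) has_vector_derivative - z' (- t)) (at t)" if "- a \<le> t" "t \<le> - b" for t
  proof -
    have "((\<lambda>t. - t) has_vector_derivative - 1) (at t)" by (auto intro!: derivative_eq_intros)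
    from vector_diff_chain_at[OF this, of z "z' (- t)"] z[of "- t"] that False
    show ?thesis by (simp add: o_def)
  qed
  from gronwall_zero[of "- a" "- b", OF _ this, of K] show ?thesis using assms False by auto
qed


text \<open>At the time \<open>s\<close> where \<open>\<bar>y\<bar>\<close> is maximal, the Lipschitz bound keeps \<open>y t \<bullet> y s\<close> positive for all \<open>t\<close>
  unless \<open>y s = 0\<close>, so a nonconstant orbit cannot close up after time 1.\<close>

lemma periodic_orbit_constant:
  fixes \<gamma> :: "real \<Rightarrow> 'a::euclidean_space"
  assumes \<gamma>: "\<And>t. t \<in> {0..1} \<Longrightarrow> (\<gamma> has_vector_derivative y t) (at t)"
    and lip: "\<And>s t. s \<in> {0..1} \<Longrightarrow> t \<in> {0..1} \<Longrightarrow> norm (y s - y t) \<le> L * norm (\<gamma> s - \<gamma> t)"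
    and "0 \<le> L" "L < 1" "\<gamma> 0 = \<gamma> 1"
    and "continuous_on {0..1} y"
  shows "y 0 = 0"
proof -
  have "\<exists>s\<in>{0..1}. \<forall>t\<in>{0..1}. norm (y t) \<le> norm (y s)"
    by (rule continuous_attains_sup) (use assms in \<open>auto intro: continuous_on_norm\<close>)
  then obtain s where s: "s \<in> {0..1}" "\<And>t. t \<in> {0..1} \<Longrightarrow> norm (y t) \<le> norm (y s)" by blast
  have dist: "norm (\<gamma> t - \<gamma> s) \<le> norm (y s)" if "t \<in> {0..1}" for t
  proof -
    have "norm (\<gamma> t - \<gamma> s) \<le> norm (y s) * norm (t - s)"
    proof (rule differentiable_bound[where S = "{0..1}" and f' = "\<lambda>u h. h *\<^sub>R y u"])
      fix u :: real assume u: "u \<in> {0..1}"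
      show "(\<gamma> has_derivative (\<lambda>h. h *\<^sub>R y u)) (at u within {0..1})"
        using \<gamma>[OF u] by (auto simp: has_vector_derivative_def intro: has_derivative_at_withinI)
      show "onorm (\<lambda>h. h *\<^sub>R y u) \<le> norm (y s)"
        by (rule onorm_le) (use s(2)[OF u] in \<open>simp add: mult.commute[of "norm (y s)"] mult_left_mono\<close>)
    qed (use that s in auto)
    also have "\<dots> \<le> norm (y s) * 1" by (rule mult_left_mono) (use that s in auto)
    finally show ?thesis by simp
  qed
  have d: "((\<lambda>t. \<gamma> t \<bullet> y s) has_real_derivative y t \<bullet> y s) (at t)" if "t \<in> {0..1}" for t
    using has_vector_derivative_compose[OF \<gamma>[OF that]
        bounded_linear_imp_has_derivative[OF bounded_linear_inner_left]]
    by (simp add: has_real_derivative_iff_has_vector_derivative)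
  obtain t where t: "0 < t" "t < 1" "y t \<bullet> y s = 0"
    using MVT2[of 0 1 "\<lambda>t. \<gamma> t \<bullet> y s" "\<lambda>t. y t \<bullet> y s"] d \<open>\<gamma> 0 = \<gamma> 1\<close> by auto
  have "norm (y s) * norm (y s) = (y s - y t) \<bullet> y s"
    using t by (simp add: inner_diff_left dot_square_norm power2_eq_square)
  also have "\<dots> \<le> norm (y s - y t) * norm (y s)" by (rule norm_cauchy_schwarz)
  also have "\<dots> \<le> (L * norm (y s)) * norm (y s)"
  proof (rule mult_right_mono)
    have "norm (y s - y t) \<le> L * norm (\<gamma> t - \<gamma> s)"
      using lip[of s t] s t by (simp add: norm_minus_commute)
    also have "\<dots> \<le> L * norm (y s)"
      by (rule mult_left_mono) (use dist[of t] t assms in auto)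
    finally show "norm (y s - y t) \<le> L * norm (y s)" .
  qed simp
  finally have "(1 - L) * (norm (y s) * norm (y s)) \<le> 0" by (simp add: algebra_simps)
  then have "norm (y s) = 0" using \<open>L < 1\<close> by (auto simp: mult_le_0_iff)
  then show ?thesis using s(2)[of 0] by simp
qed

text \<open>The lower bound \<open>c\<close> of the injective map \<open>L x0\<close> absorbs the
  perturbation: once \<open>e x < c / 2\<close>, half of \<open>c * norm (y x - y x0)\<close>
  survives on the left side. No inverse of \<open>L x\<close> enters.\<close>

lemma linear_solve_continuous:
  fixes y :: "'p::real_normed_vector \<Rightarrow> 'a::euclidean_space"
    and L :: "'p \<Rightarrow> 'a \<Rightarrow> 'b::euclidean_space"
  assumes "open S" and L: "\<And>x. x \<in> S \<Longrightarrow> linear (L x)" "\<And>x. x \<in> S \<Longrightarrow> inj (L x)"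
    and contL: "\<And>v. continuous_on S (\<lambda>x. L x v)" and contb: "continuous_on S b"
    and y: "\<And>x. x \<in> S \<Longrightarrow> L x (y x) = b x"
  shows "continuous_on S y"
proof (rule continuous_at_imp_continuous_on, rule ballI)
  fix x0 assume x0: "x0 \<in> S"
  obtain c where c: "c > 0" "\<And>z. c * norm z \<le> norm (L x0 z)"
    using linear_inj_bounded_below_pos[OF L[OF x0]] by blast
  \<comment> \<open>A bound for the operator norm of \<open>L x - L x0\<close> built from values on
    fixed vectors, since only these are assumed to be continuous in \<open>x\<close>.\<close>
  define e where "e x = (\<Sum>i\<in>Basis. norm (L x i - L x0 i))" for x
  have e: "norm (L x z - L x0 z) \<le> e x * norm z" if "x \<in> S" for x z
  proof -
    have "L x z - L x0 z = (\<Sum>i\<in>Basis. (z \<bullet> i) *\<^sub>R (L x i - L x0 i))"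
      unfolding linear_euclidean_expansion[OF L(1)[OF that], of z]
        linear_euclidean_expansion[OF L(1)[OF x0], of z]
      by (simp add: sum_subtractf scaleR_diff_right)
    also have "norm \<dots> \<le> (\<Sum>i\<in>Basis. norm z * norm (L x i - L x0 i))"
      by (rule sum_norm_le) (simp add: Basis_le_norm mult_right_mono)
    finally show ?thesis by (simp add: e_def sum_distrib_left mult.commute)
  qed
  have cL: "((\<lambda>x. L x v) \<longlongrightarrow> L x0 v) (at x0)" for v
    using contL x0 \<open>open S\<close> by (simp add: continuous_on_eq_continuous_at isCont_def)
  have cb: "(b \<longlongrightarrow> b x0) (at x0)"
    using contb x0 \<open>open S\<close> by (simp add: continuous_on_eq_continuous_at isCont_def)
  have e0: "(e \<longlongrightarrow> 0) (at x0)"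
    unfolding e_def by (auto intro!: tendsto_eq_intros cL)
  have S: "\<forall>\<^sub>F x in at x0. x \<in> S" using \<open>open S\<close> x0 by (rule eventually_at_in_open')
  let ?g = "\<lambda>x. (2 / c) * (norm (b x - b x0) + e x * norm (y x0))"
  have E: "\<forall>\<^sub>F x in at x0. e x < c / 2" using order_tendstoD(2)[OF e0, of "c / 2"] c by simp
  have "\<forall>\<^sub>F x in at x0. norm (y x - y x0) \<le> ?g x"
    using S E
  proof eventually_elim
    case (elim x)
    then have "e x < c / 2" using c by simp
    have "c * norm (y x - y x0) \<le> norm (L x0 (y x - y x0))" by (rule c)
    also have "L x0 (y x - y x0) = (b x - b x0) - (L x (y x) - L x0 (y x))"
      using y[OF \<open>x \<in> S\<close>] y[OF x0] by (simp add: linear_diff[OF L(1)[OF x0]])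
    also have "norm \<dots> \<le> norm (b x - b x0) + e x * norm (y x)"
      using norm_triangle_ineq4[of "b x - b x0" "L x (y x) - L x0 (y x)"] e[OF \<open>x \<in> S\<close>, of "y x"]
      by linarith
    also have "e x * norm (y x) \<le> e x * norm (y x0) + (c / 2) * norm (y x - y x0)"
    proof -
      have "e x \<ge> 0" by (simp add: e_def sum_nonneg)
      have "norm (y x) \<le> norm (y x0) + norm (y x - y x0)"
        using norm_triangle_ineq[of "y x0" "y x - y x0"] by simp
      then have "e x * norm (y x) \<le> e x * norm (y x0) + e x * norm (y x - y x0)"
        using mult_left_mono[OF _ \<open>e x \<ge> 0\<close>] by (metis distrib_left)
      moreover have "e x * norm (y x - y x0) \<le> (c / 2) * norm (y x - y x0)"
        using \<open>e x < c / 2\<close> by (intro mult_right_mono) auto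
      ultimately show ?thesis by linarith
    qed
    finally have "(c / 2) * norm (y x - y x0) \<le> norm (b x - b x0) + e x * norm (y x0)"
      by simp
    then show ?case using c(1) by (simp add: field_simps)
  qed
  moreover have "(?g \<longlongrightarrow> 0) (at x0)"
  proof -
    have "((\<lambda>x. norm (b x - b x0)) \<longlongrightarrow> 0) (at x0)" using cb by (simp add: LIM_zero tendsto_norm_zero)
    from tendsto_mult[OF tendsto_const tendsto_add[OF this tendsto_mult[OF e0 tendsto_const]]]
    show ?thesis by (rule tendsto_eq_rhs) simp
  qed
  ultimately have "((\<lambda>x. y x - y x0) \<longlongrightarrow> 0) (at x0)" by (rule Lim_null_comparison)
  then show "isCont y x0" by (simp add: isCont_def LIM_zero_iff)
qed

text \<open>The error term \<open>(a x - a x0) *\<^sub>R u x\<close> is a quantity tending to 0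
  times one of order \<open>norm (x - x0)\<close>. This starts a bootstrapping in which an unknown
  solution, so far only continuous, is the first factor.\<close>

lemma has_derivative_continuous_mult_zero:
  fixes a :: "'p::real_normed_vector \<Rightarrow> real" and u :: "'p \<Rightarrow> 'b::real_normed_vector"
  assumes a: "isCont a x0" and u: "(u has_derivative u') (at x0)" "u x0 = 0"
  shows "((\<lambda>x. a x *\<^sub>R u x) has_derivative (\<lambda>v. a x0 *\<^sub>R u' v)) (at x0)"
proof -
  have "((\<lambda>x. (a x - a x0) *\<^sub>R u x) has_derivative (\<lambda>v. 0)) (at x0)"
  proof -
    have lin: "bounded_linear u'" using u(1) by (rule has_derivative_bounded_linear)
    have l: "((\<lambda>x. norm (u x - u x0 - u' (x - x0)) / norm (x - x0)) \<longlongrightarrow> 0) (at x0)"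
      using u(1) unfolding has_derivative_iff_norm by auto
    obtain K where K: "\<And>v. norm (u' v) \<le> norm v * K" "K > 0"
      using bounded_linear.pos_bounded[OF lin] by blast
    have "((\<lambda>x. norm ((a x - a x0) *\<^sub>R u x) / norm (x - x0)) \<longlongrightarrow> 0) (at x0)"
    proof (rule Lim_null_comparison)
      show "\<forall>\<^sub>F x in at x0. norm (norm ((a x - a x0) *\<^sub>R u x) / norm (x - x0))
          \<le> \<bar>a x - a x0\<bar> * (norm (u x - u x0 - u' (x - x0)) / norm (x - x0) + K)"
        unfolding eventually_at_filter
      proof (rule always_eventually, safe)
        fix x assume "x \<noteq> x0"
        have "norm (u x) \<le> norm (u x - u x0 - u' (x - x0)) + norm (x - x0) * K"
          using norm_triangle_ineq[of "u x - u x0 - u' (x - x0)" "u' (x - x0)"] K(1)[of "x - x0"]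
          by (simp add: u(2))
        then have "norm (u x) / norm (x - x0)
            \<le> norm (u x - u x0 - u' (x - x0)) / norm (x - x0) + K"
          using \<open>x \<noteq> x0\<close> by (simp add: field_simps)
        from mult_left_mono[OF this, of "\<bar>a x - a x0\<bar>"]
        show "norm (norm ((a x - a x0) *\<^sub>R u x) / norm (x - x0))
          \<le> \<bar>a x - a x0\<bar> * (norm (u x - u x0 - u' (x - x0)) / norm (x - x0) + K)" by simp
      qed
      have "((\<lambda>x. \<bar>a x - a x0\<bar>) \<longlongrightarrow> 0) (at x0)"
        using a by (simp add: isCont_def LIM_zero tendsto_rabs_zero)
      from tendsto_mult[OF this tendsto_add[OF l tendsto_const]]
      show "((\<lambda>x. \<bar>a x - a x0\<bar> * (norm (u x - u x0 - u' (x - x0)) / norm (x - x0) + K)) \<longlongrightarrow> 0) (at x0)"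
        by simp
    qed
    then show ?thesis by (simp add: has_derivative_iff_norm)
  qed
  moreover have "((\<lambda>x. a x0 *\<^sub>R u x) has_derivative (\<lambda>v. a x0 *\<^sub>R u' v)) (at x0)"
    using u(1) by (rule has_derivative_scaleR_right)
  ultimately have "((\<lambda>x. (a x - a x0) *\<^sub>R u x + a x0 *\<^sub>R u x) has_derivative (\<lambda>v. 0 + a x0 *\<^sub>R u' v)) (at x0)"
    by (rule has_derivative_add)
  then show ?thesis by (simp flip: scaleR_add_left)
qed

text \<open>Each directional derivative of \<open>y\<close> solves the same linear system with a new
  right side \<open>R v\<close>, which contains \<open>y\<close> itself but no derivative of it. So
  the induction hypothesis, general in \<open>b\<close> and \<open>y\<close>, raises the regularity
  of \<open>y\<close> by one order.\<close>

lemma Ck_on_linear_solve: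
  fixes y :: "'p::real_normed_vector \<Rightarrow> 'a::euclidean_space"
    and L :: "'p \<Rightarrow> 'a \<Rightarrow> 'a"
  assumes "open S" and L: "\<And>x. x \<in> S \<Longrightarrow> linear (L x)" "\<And>x. x \<in> S \<Longrightarrow> inj (L x)"
    and smL: "\<And>v. smooth_on (\<lambda>x. L x v) S" and b: "Ck_on k b S"
    and y: "\<And>x. x \<in> S \<Longrightarrow> L x (y x) = b x"
  shows "Ck_on k y S"
  using b y
proof (induction k arbitrary: b y)
  case 0
  then show ?case
    using linear_solve_continuous[OF \<open>open S\<close> L smooth_on_continuous[OF smL], of b y] by simp
next
  case (Suc k)
  have CkL: "Ck_on j (\<lambda>x. L x v) S" for j v using smL by (simp add: smooth_on_def)
  have Ck: "Ck_on k y S" by (rule Suc.IH[OF Ck_on_SucD[OF \<open>open S\<close> Suc.prems(1)] Suc.prems(2)])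
  have cont: "continuous_on S y"
    by (rule linear_solve_continuous[OF \<open>open S\<close> L smooth_on_continuous[OF smL] _ Suc.prems(2)])
       (use Suc.prems(1) Ck_on_Suc_differentiable[OF _ \<open>open S\<close>] in
         \<open>auto intro!: continuous_at_imp_continuous_on differentiable_imp_continuous_within\<close>)
  \<comment> \<open>What results from differentiating \<open>L x (y x) = b x\<close> in direction
    \<open>v\<close> and moving the derivative of \<open>L\<close> to the right.\<close>
  define R where "R v x = frechet_derivative b (at x) v
      - (\<Sum>i\<in>Basis. (y x \<bullet> i) *\<^sub>R frechet_derivative (\<lambda>x. L x i) (at x) v)" for v x
  have linv: "\<exists>M. linear M \<and> (\<forall>z. M (L x z) = z) \<and> (\<forall>z. L x (M z) = z)" if xS: "x \<in> S" for x
  proof -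
    obtain M where M: "linear M" "M \<circ> L x = id"
      using linear_injective_left_inverse[OF L(1)[OF xS] L(2)[OF xS]] by blast
    have "L x (M z) = z" for z
    proof -
      obtain w where "z = L x w"
        using linear_injective_imp_surjective[OF L(1)[OF xS] L(2)[OF xS]] by (auto elim: surjE)
      then show ?thesis using M(2) by (simp add: fun_eq_iff)
    qed
    then show ?thesis using M by (intro exI[of _ M]) (simp add: fun_eq_iff)
  qed
  have D: "\<exists>y'. (y has_derivative y') (at x0) \<and> (\<forall>v. L x0 (y' v) = R v x0)" if x0: "x0 \<in> S" for x0
  proof -
    obtain M where M: "linear M" "\<And>z. M (L x0 z) = z" "\<And>z. L x0 (M z) = z" using linv[OF x0] by blast
    have bM: "bounded_linear M" using M(1) by (simp add: linear_conv_bounded_linear)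
    \<comment> \<open>With \<open>M\<close> inverse to \<open>L x0\<close>, the equation for
      \<open>y\<close> is rewritten so that \<open>y\<close> occurs on the right only as a factor of
      \<open>L x i - L x0 i\<close>. That difference vanishes at \<open>x0\<close>, so continuity of
      \<open>y\<close> is enough to differentiate.\<close>
    let ?rhs = "\<lambda>x. M (b x - (\<Sum>i\<in>Basis. (y x \<bullet> i) *\<^sub>R (L x i - L x0 i)))"
    have "(?rhs has_derivative (\<lambda>v. M (frechet_derivative b (at x0) v
        - (\<Sum>i\<in>Basis. (y x0 \<bullet> i) *\<^sub>R frechet_derivative (\<lambda>x. L x i) (at x0) v)))) (at x0)"
    proof (intro bounded_linear.has_derivative[OF bM] has_derivative_diff has_derivative_sum
        has_derivative_continuous_mult_zero)
      show "(b has_derivative frechet_derivative b (at x0)) (at x0)"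
        using Ck_on_Suc_differentiable[OF Suc.prems(1) \<open>open S\<close> x0] by (simp add: frechet_derivative_works)
      show "isCont (\<lambda>x. y x \<bullet> i) x0" for i
        using cont x0 \<open>open S\<close> by (auto simp: continuous_on_eq_continuous_at intro!: continuous_intros)
      show "((\<lambda>x. L x i - L x0 i) has_derivative frechet_derivative (\<lambda>x. L x i) (at x0)) (at x0)" for i
        using has_derivative_diff[OF smooth_on_has_derivative[OF \<open>open S\<close> smL x0]
            has_derivative_const[of "L x0 i"], of i] by simp
    qed simp
    moreover have "?rhs x = y x" if "x \<in> S" for x
    proof -
      have "(\<Sum>i\<in>Basis. (y x \<bullet> i) *\<^sub>R (L x i - L x0 i)) = L x (y x) - L x0 (y x)"
        unfolding linear_euclidean_expansion[OF L(1)[OF that], of "y x"]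
          linear_euclidean_expansion[OF L(1)[OF x0], of "y x"]
        by (simp add: sum_subtractf scaleR_diff_right)
      then show ?thesis using Suc.prems(2)[OF that] by (simp add: M)
    qed
    ultimately have "(y has_derivative (\<lambda>v. M (R v x0))) (at x0)"
      unfolding R_def by (rule has_derivative_transform_within_open[OF _ \<open>open S\<close> x0])
    then show ?thesis using M(3) by blast
  qed
  have d: "y differentiable at x" "L x (frechet_derivative y (at x) v) = R v x" if "x \<in> S" for x v
  proof -
    from D[OF that] obtain y' where y': "(y has_derivative y') (at x)" "\<And>v. L x (y' v) = R v x"
      by blast
    show "y differentiable at x" by (rule differentiableI[OF y'(1)])
    show "L x (frechet_derivative y (at x) v) = R v x"
      unfolding frechet_derivative_eqI[OF y'(1)] by (rule y'(2))
  qed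
  show ?case
  proof (rule Ck_on_SucI[OF \<open>open S\<close> d(1)])
    fix v
    show "Ck_on k (\<lambda>x. frechet_derivative y (at x) v) S"
    proof (rule Suc.IH[OF _ d(2)])
      have "Ck_on k (\<lambda>x. frechet_derivative b (at x) v
          + (- 1) *\<^sub>R (\<Sum>i\<in>Basis. (y x \<bullet> i) *\<^sub>R frechet_derivative (\<lambda>x. L x i) (at x) v)) S"
        by (intro Ck_on_add Ck_on_bounded_linear[OF bounded_linear_scaleR_right] Ck_on_sum
            Ck_on_bilinear[OF bounded_bilinear_scaleR] \<open>open S\<close>
            Ck_on_bounded_linear[OF bounded_linear_inner_left] Ck
            Ck_on_Suc_frechet[OF CkL] Ck_on_Suc_frechet[OF Suc.prems(1)])
      then show "Ck_on k (R v) S" by (simp add: R_def[abs_def])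
    qed
  qed
qed

lemma smooth_on_linear_solve:
  fixes y :: "'p::real_normed_vector \<Rightarrow> 'a::euclidean_space"
    and L :: "'p \<Rightarrow> 'a \<Rightarrow> 'a"
  assumes "open S" "\<And>x. x \<in> S \<Longrightarrow> linear (L x)" "\<And>x. x \<in> S \<Longrightarrow> inj (L x)"
    "\<And>v. smooth_on (\<lambda>x. L x v) S" "smooth_on b S" "\<And>x. x \<in> S \<Longrightarrow> L x (y x) = b x"
  shows "smooth_on y S"
  unfolding smooth_on_def
  using Ck_on_linear_solve[OF assms(1-4) _ assms(6)] assms(5) by (simp add: smooth_on_def)

section \<open>Differentials in charts\<close>

lemma differentiable_transform_open:
  assumes "f differentiable at x" "\<And>y. y \<in> S \<Longrightarrow> f y = g y" "open S" "x \<in> S"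
  shows "g differentiable at x"
  by (rule differentiableI, rule has_derivative_transform_within_open[OF
        assms(1)[unfolded frechet_derivative_works] assms(3,4)]) (rule assms(2))

abbreviation chart_dom :: "('m, 'e) atlas \<Rightarrow> 'm \<Rightarrow> 'm set" where
  "chart_dom A m \<equiv> fst (chart_at A m)"

context
  fixes A :: "('m::{t2_space, second_countable_topology}, 'e::euclidean_space) atlas"
  assumes mfd: "smooth_manifold A"
begin

lemma chart_at_in_atlas: "(chart_dom A m, coord A m) \<in> A"
  and chart_at_mem: "m \<in> chart_dom A m"
proof -
  have "m \<in> (\<Union>(D, c)\<in>A. D)" using mfd unfolding smooth_manifold_def by simp
  then have "\<exists>C. C \<in> A \<and> m \<in> fst C" by auto
  from someI_ex[OF this] show "(chart_dom A m, coord A m) \<in> A" "m \<in> chart_dom A m"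
    by (simp_all add: chart_at_def coord_def)
qed

lemma chart_homeomorphism:
  assumes "(D, c) \<in> A"
  shows "open D" "open (c ` D)" "homeomorphism D (c ` D) c (inv_into D c)"
proof -
  have "\<forall>(D, c)\<in>A. open D \<and> open (c ` D) \<and> homeomorphism D (c ` D) c (inv_into D c)"
    using mfd unfolding smooth_manifold_def by (elim conjE)
  from bspec[OF this assms] show "open D" "open (c ` D)" "homeomorphism D (c ` D) c (inv_into D c)"
    by simp_all
qed

lemma chart_inv: "(D, c) \<in> A \<Longrightarrow> q \<in> D \<Longrightarrow> inv_into D c (c q) = q"
  using chart_homeomorphism(3) by (simp add: homeomorphism_def)

lemma chart_continuous: "(D, c) \<in> A \<Longrightarrow> continuous_on D c"
  and chart_inv_continuous: "(D, c) \<in> A \<Longrightarrow> continuous_on (c ` D) (inv_into D c)"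
  using chart_homeomorphism(3) by (auto simp: homeomorphism_def)

lemma chart_image_eq:
  assumes "(D, c) \<in> A"
  shows "c ` (U \<inter> D) = c ` D \<inter> inv_into D c -` U"
  using chart_inv[OF assms] by auto

lemma open_chart_image:
  assumes "(D, c) \<in> A" "open U"
  shows "open (c ` (U \<inter> D))"
  unfolding chart_image_eq[OF assms(1)]
  using continuous_open_preimage[OF chart_inv_continuous[OF assms(1)] chart_homeomorphism(2)[OF assms(1)] assms(2)] .

lemma open_chart_preimage:
  assumes "(D, c) \<in> A" "open O'"
  shows "open (D \<inter> c -` O')"
  using continuous_open_preimage[OF chart_continuous[OF assms(1)] chart_homeomorphism(1)[OF assms(1)] assms(2)] .

lemma smooth_transition:
  assumes "(D, c) \<in> A" "(D', c') \<in> A"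
  shows "smooth_on (\<lambda>x. c' (inv_into D c x)) (c ` (D \<inter> D'))"
proof -
  have "\<forall>(D, c)\<in>A. \<forall>(D', c')\<in>A. smooth_on (c' \<circ> inv_into D c) (c ` (D \<inter> D'))"
    using mfd unfolding smooth_manifold_def by (elim conjE)
  from bspec[OF this assms(1)] assms(2) show ?thesis by (auto simp: o_def)
qed

lemma transition_differentiable:
  assumes "(D, c) \<in> A" "(D', c') \<in> A" "q \<in> D" "q \<in> D'"
  shows "(\<lambda>x. c' (inv_into D c x)) differentiable at (c q)"
proof (rule smooth_on_differentiable[OF _ smooth_transition[OF assms(1,2)]])
  show "open (c ` (D \<inter> D'))"
    using open_chart_image[OF assms(1) chart_homeomorphism(1)[OF assms(2)]] by (simp add: Int_commute)
qed (use assms in auto)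

lemma smooth_fun_on_chart:
  assumes "smooth_fun_on A U f" "(D, c) \<in> A"
  shows "smooth_on (\<lambda>x. f (inv_into D c x)) (c ` (U \<inter> D))"
  using bspec[OF assms[unfolded smooth_fun_on_def]] by (simp add: o_def)

lemma smooth_fun_onI:
  "(\<And>D c. (D, c) \<in> A \<Longrightarrow> smooth_on (\<lambda>x. f (inv_into D c x)) (c ` (U \<inter> D))) \<Longrightarrow> smooth_fun_on A U f"
  unfolding smooth_fun_on_def o_def by auto

lemma smooth_fun_on_chart_map:
  assumes "(D, c) \<in> A" "open U" "U \<subseteq> D"
  shows "smooth_fun_on A U c"
proof (rule smooth_fun_onI)
  fix D' c' assume "(D', c') \<in> A"
  from smooth_transition[OF this assms(1)]
  show "smooth_on (\<lambda>x. c (inv_into D' c' x)) (c' ` (U \<inter> D'))"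
    by (rule smooth_on_subset) (use assms in auto)
qed

lemma smooth_fun_on_subset: "smooth_fun_on A U f \<Longrightarrow> W \<subseteq> U \<Longrightarrow> smooth_fun_on A W f"
  by (rule smooth_fun_onI, rule smooth_on_subset[OF smooth_fun_on_chart]) auto

lemma smooth_fun_on_bounded_linear:
  assumes "bounded_linear L" "open U" "smooth_fun_on A U f"
  shows "smooth_fun_on A U (\<lambda>q. L (f q))"
  by (intro smooth_fun_onI smooth_on_bounded_linear[OF assms(1)] open_chart_image assms(2)
      smooth_fun_on_chart[OF assms(3)])

lemma smooth_fun_on_bilinear:
  assumes "bounded_bilinear B" "open U" "smooth_fun_on A U f" "smooth_fun_on A U g"
  shows "smooth_fun_on A U (\<lambda>q. B (f q) (g q))"
  by (intro smooth_fun_onI smooth_on_bilinear[OF assms(1)] open_chart_image assms(2)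
      smooth_fun_on_chart[OF assms(3)] smooth_fun_on_chart[OF assms(4)])

lemma smooth_fun_on_sum:
  assumes "open U" "\<And>i. i \<in> I \<Longrightarrow> smooth_fun_on A U (f i)"
  shows "smooth_fun_on A U (\<lambda>q. \<Sum>i\<in>I. f i q)"
  by (intro smooth_fun_onI smooth_on_sum open_chart_image assms(1) smooth_fun_on_chart[OF assms(2)])

definition differentiable_mfd :: "('m \<Rightarrow> 'v::real_normed_vector) \<Rightarrow> 'm \<Rightarrow> bool" where
  "differentiable_mfd f m \<longleftrightarrow> (\<lambda>x. f (uncoord A m x)) differentiable at (coord A m m)"

lemma differential_eq_frechet:
  assumes "differentiable_mfd f m"
  shows "blinfun_apply (differential A f m) v
    = frechet_derivative (\<lambda>x. f (uncoord A m x)) (at (coord A m m)) v"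
proof -
  have "bounded_linear (frechet_derivative (\<lambda>x. f (uncoord A m x)) (at (coord A m m)))"
    using assms unfolding differentiable_mfd_def frechet_derivative_works
    by (rule has_derivative_bounded_linear)
  then show ?thesis by (simp add: differential_def bounded_linear_Blinfun_apply o_def)
qed

lemma smooth_fun_on_chart_differentiable:
  assumes "smooth_fun_on A U f" "open U" "m \<in> U" "(D, c) \<in> A" "m \<in> D"
  shows "(\<lambda>x. f (inv_into D c x)) differentiable at (c m)"
  by (rule smooth_on_differentiable[OF open_chart_image smooth_fun_on_chart]) (use assms in auto)

lemma smooth_fun_on_differentiable_mfd:
  assumes "smooth_fun_on A U f" "open U" "m \<in> U"
  shows "differentiable_mfd f m"
  unfolding differentiable_mfd_def uncoord_def
  by (rule smooth_fun_on_chart_differentiable[OF assms chart_at_in_atlas chart_at_mem])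

text \<open>The chain rule for the transition map from the chosen chart at \<open>m\<close> to
  \<open>c\<close>; the derivative of that transition map is by definition
  \<open>differential A c m\<close>. From here on differentials can be computed in any chart around
  the point.\<close>

lemma differential_chart:
  assumes f: "((\<lambda>x. f (inv_into D c x)) has_derivative f') (at (c m))"
    and c: "(D, c) \<in> A" "m \<in> D"
  shows "differentiable_mfd f m"
    "blinfun_apply (differential A f m) v = f' (blinfun_apply (differential A c m) v)"
proof -
  let ?D = "chart_dom A m" and ?c = "coord A m"
  let ?T = "\<lambda>x. c (uncoord A m x)"
  note ch = chart_at_in_atlas[of m] chart_at_mem[of m]
  have T: "(?T has_derivative frechet_derivative ?T (at (?c m))) (at (?c m))"
    using transition_differentiable[OF ch(1) c(1) ch(2) c(2)]
    by (simp add: uncoord_def frechet_derivative_works)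
  have "?T (?c m) = c m" using chart_inv[OF ch] by (simp add: uncoord_def)
  then have "((\<lambda>x. f (inv_into D c (?T x))) has_derivative
      (\<lambda>v. f' (frechet_derivative ?T (at (?c m)) v))) (at (?c m))"
    using has_derivative_compose[OF T] f by simp
  then have *: "((\<lambda>x. f (uncoord A m x)) has_derivative
      (\<lambda>v. f' (frechet_derivative ?T (at (?c m)) v))) (at (?c m))"
    by (rule has_derivative_transform_within_open[OF _ open_chart_image[OF ch(1) chart_homeomorphism(1)[OF c(1)]]])
       (use ch c in \<open>auto simp: uncoord_def chart_inv\<close>)
  then show d: "differentiable_mfd f m"
    unfolding differentiable_mfd_def by (rule differentiableI)
  have "differentiable_mfd c m" unfolding differentiable_mfd_def using T by (rule differentiableI)
  then show "blinfun_apply (differential A f m) v = f' (blinfun_apply (differential A c m) v)"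
    by (simp add: differential_eq_frechet d frechet_derivative_eqI[OF *])
qed

lemma differentiable_mfd_chart:
  assumes f: "differentiable_mfd f m" and c: "(D, c) \<in> A" "m \<in> D"
  shows "(\<lambda>x. f (inv_into D c x)) differentiable at (c m)"
proof -
  let ?D = "chart_dom A m" and ?c = "coord A m"
  let ?T = "\<lambda>x. ?c (inv_into D c x)"
  note ch = chart_at_in_atlas[of m] chart_at_mem[of m]
  have T: "?T differentiable at (c m)"
    by (rule transition_differentiable[OF c(1) ch(1) c(2) ch(2)])
  have "?T (c m) = ?c m" using chart_inv[OF c] by simp
  then have "((\<lambda>x. f (uncoord A m x)) \<circ> ?T) differentiable at (c m)"
    by (intro differentiable_chain_at T) (use f in \<open>simp add: differentiable_mfd_def\<close>)
  then show ?thesis unfolding o_def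
    by (rule differentiable_transform_open[OF _ _ open_chart_image[OF c(1) chart_homeomorphism(1)[OF ch(1)]]])
       (use ch c in \<open>auto simp: uncoord_def chart_inv\<close>)
qed

lemma differential_eq_chart:
  assumes f: "differentiable_mfd f m" and c: "(D, c) \<in> A" "m \<in> D"
  shows "blinfun_apply (differential A f m) v
    = frechet_derivative (\<lambda>x. f (inv_into D c x)) (at (c m)) (blinfun_apply (differential A c m) v)"
  by (rule differential_chart(2)[OF _ c])
     (use differentiable_mfd_chart[OF assms] in \<open>simp add: frechet_derivative_works\<close>)

text \<open>This is the identification of the tangent space at \<open>m\<close> with the model
  space: the chosen chart composed with its own inverse is the identity near
  \<open>coord A m m\<close>.\<close>

lemma differential_coord: "blinfun_apply (differential A (coord A m) m) v = v"
proof -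
  note ch = chart_at_in_atlas[of m] chart_at_mem[of m]
  have "((\<lambda>x. coord A m (uncoord A m x)) has_derivative (\<lambda>v. v)) (at (coord A m m))"
    by (rule has_derivative_transform_within_open[OF has_derivative_ident chart_homeomorphism(2)[OF ch(1)]])
       (use ch in \<open>auto simp: uncoord_def chart_inv\<close>)
  note * = this
  then have "differentiable_mfd (coord A m) m"
    unfolding differentiable_mfd_def by (rule differentiableI)
  then show ?thesis by (simp add: differential_eq_frechet frechet_derivative_eqI[OF *])
qed

text \<open>The chosen chart factors through \<open>c\<close> near \<open>m\<close>, and its own
  differential is the identity.\<close>

lemma differential_chart_inj:
  assumes c: "(D, c) \<in> A" "m \<in> D"
  shows "inj (blinfun_apply (differential A c m))"
proof (rule injI)
  fix v w assume eq: "blinfun_apply (differential A c m) v = blinfun_apply (differential A c m) w"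
  note ch = chart_at_in_atlas[of m] chart_at_mem[of m]
  have "differentiable_mfd (coord A m) m"
    by (rule smooth_fun_on_differentiable_mfd[OF smooth_fun_on_chart_map[OF ch(1)]])
       (use ch chart_homeomorphism in auto)
  from differential_eq_chart[OF this c, of v] differential_eq_chart[OF this c, of w] eq
  show "v = w" by (simp add: differential_coord)
qed

lemma differential_chart_surj:
  assumes c: "(D, c) \<in> A" "m \<in> D"
  shows "surj (blinfun_apply (differential A c m))"
  by (rule linear_injective_imp_surjective[OF bounded_linear.linear[OF blinfun.bounded_linear_right] differential_chart_inj[OF c] refl])

lemma differential_cong:
  assumes "open W" "m \<in> W" "\<And>q. q \<in> W \<Longrightarrow> f q = g q"
  shows "differential A f m = differential A g m"
  unfolding differential_def o_def
  by (rule arg_cong[where f = Blinfun], rule frechet_derivative_cong[OF open_chart_image[OF chart_at_in_atlas[of m] assms(1)]])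
     (use assms chart_at_mem in \<open>auto simp: uncoord_def chart_inv[OF chart_at_in_atlas]\<close>)

lemma differential_const: "differential A (\<lambda>q. k) m = 0"
proof (rule blinfun_eqI)
  have "((\<lambda>x. k) has_derivative (\<lambda>v. 0)) (at (coord A m m))" by simp
  from differential_chart(2)[where f = "\<lambda>q. k", OF this chart_at_in_atlas chart_at_mem]
  show "blinfun_apply (differential A (\<lambda>q. k) m) v = blinfun_apply 0 v" for v by simp
qed

lemma differential_eq_0:
  assumes "open W" "m \<in> W" "\<And>q. q \<in> W \<Longrightarrow> f q = k"
  shows "differential A f m = 0"
  using differential_cong[OF assms(1,2), of f "\<lambda>_. k"] assms(3) differential_const by simp

lemma differentiable_mfd_has_derivative:
  assumes "differentiable_mfd f m"
  shows "((\<lambda>x. f (uncoord A m x)) has_derivative blinfun_apply (differential A f m)) (at (coord A m m))"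
proof -
  have "blinfun_apply (differential A f m) = frechet_derivative (\<lambda>x. f (uncoord A m x)) (at (coord A m m))"
    using differential_eq_frechet[OF assms] by auto
  then show ?thesis
    using assms by (simp add: differentiable_mfd_def frechet_derivative_works)
qed

lemma differential_has_derivative:
  assumes "((\<lambda>x. f (uncoord A m x)) has_derivative f') (at (coord A m m))"
  shows "differentiable_mfd f m" "blinfun_apply (differential A f m) v = f' v"
proof -
  show d: "differentiable_mfd f m"
    using assms unfolding differentiable_mfd_def by (rule differentiableI)
  show "blinfun_apply (differential A f m) v = f' v"
    by (simp add: differential_eq_frechet[OF d] frechet_derivative_eqI[OF assms])
qed

lemma uncoord_coord: "uncoord A m (coord A m m) = m"
  using chart_inv[OF chart_at_in_atlas chart_at_mem] by (simp add: uncoord_def)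

lemma differential_sum:
  assumes "\<And>i. i \<in> I \<Longrightarrow> differentiable_mfd (f i) m"
  shows "differential A (\<lambda>q. \<Sum>i\<in>I. f i q) m = (\<Sum>i\<in>I. differential A (f i) m)"
  by (rule blinfun_eqI, subst differential_has_derivative(2)[OF has_derivative_sum])
     (auto intro!: differentiable_mfd_has_derivative assms simp: blinfun.sum_left)

lemma differential_scaleR:
  assumes "differentiable_mfd f m"
  shows "differential A (\<lambda>q. k *\<^sub>R f q) m = k *\<^sub>R differential A f m"
  by (rule blinfun_eqI, subst differential_has_derivative(2)[OF has_derivative_scaleR_right])
     (auto intro!: differentiable_mfd_has_derivative assms simp: blinfun.scaleR_left)

lemma differential_bounded_linear:
  assumes "bounded_linear L" "differentiable_mfd f m"
  shows "blinfun_apply (differential A (\<lambda>q. L (f q)) m) v = L (blinfun_apply (differential A f m) v)"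
  by (rule differential_has_derivative(2)[OF bounded_linear.has_derivative[OF assms(1)
        differentiable_mfd_has_derivative[OF assms(2)]]])

lemma differential_mult:
  fixes f g :: "'m \<Rightarrow> real"
  assumes "differentiable_mfd f m" "differentiable_mfd g m"
  shows "differential A (\<lambda>q. f q * g q) m = f m *\<^sub>R differential A g m + g m *\<^sub>R differential A f m"
  by (rule blinfun_eqI, subst differential_has_derivative(2)[OF has_derivative_mult])
     (auto intro!: differentiable_mfd_has_derivative assms
       simp: blinfun.add_left blinfun.scaleR_left uncoord_coord)

text \<open>The components of a field in one fixed chart. The values of \<open>X\<close> itself
  refer to charts that jump from point to point, so only this version is a smooth map between
  Euclidean spaces and can enter differential equations.\<close>

definition field_in_chart :: "'m set \<Rightarrow> ('m \<Rightarrow> 'e) \<Rightarrow> ('m \<Rightarrow> 'e) \<Rightarrow> 'e \<Rightarrow> 'e" where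
  "field_in_chart D c X x = blinfun_apply (differential A c (inv_into D c x)) (X (inv_into D c x))"

lemma field_in_chart_at:
  "(D, c) \<in> A \<Longrightarrow> q \<in> D \<Longrightarrow> field_in_chart D c X (c q) = blinfun_apply (differential A c q) (X q)"
  by (simp add: field_in_chart_def chart_inv)

lemma differential_along_field:
  assumes "differentiable_mfd f q" "(D, c) \<in> A" "q \<in> D"
  shows "blinfun_apply (differential A f q) (X q)
    = frechet_derivative (\<lambda>x. f (inv_into D c x)) (at (c q)) (field_in_chart D c X (c q))"
  using assms by (simp add: differential_eq_chart field_in_chart_at)

lemma chart_map_differentiable:
  assumes "(D, c) \<in> A" "q \<in> D"
  shows "differentiable_mfd c q"
  by (rule smooth_fun_on_differentiable_mfd[OF smooth_fun_on_chart_map[OF assms(1)]])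
     (use assms chart_homeomorphism in auto)

text \<open>Smoothness of a field is tested on real functions; here the test functions are the
  components \<open>c q \<bullet> b\<close> of the chart.\<close>

lemma smooth_field_in_chart:
  assumes X: "smooth_vector_field A U X" and "open U" and c: "(D, c) \<in> A"
  shows "smooth_on (field_in_chart D c X) (c ` (U \<inter> D))"
proof (rule smooth_on_euclidean[OF open_chart_image[OF c \<open>open U\<close>]])
  fix b :: 'e
  let ?W = "U \<inter> D"
  have W: "open ?W" using \<open>open U\<close> chart_homeomorphism(1)[OF c] by auto
  have "smooth_fun_on A ?W (\<lambda>q. c q \<bullet> b)"
    by (intro smooth_fun_on_bounded_linear[OF bounded_linear_inner_left W] smooth_fun_on_chart_map[OF c W]) auto
  with X W have "smooth_fun_on A ?W (\<lambda>q. differential A (\<lambda>q. c q \<bullet> b) q (X q))"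
    unfolding smooth_vector_field_def by (metis inf_le1)
  from smooth_fun_on_chart[OF this c]
  have "smooth_on (\<lambda>x. differential A (\<lambda>q. c q \<bullet> b) (inv_into D c x) (X (inv_into D c x))) (c ` ?W)"
    by (simp add: inf.absorb1)
  then show "smooth_on (\<lambda>x. field_in_chart D c X x \<bullet> b) (c ` ?W)"
    by (rule smooth_on_cong[OF open_chart_image[OF c \<open>open U\<close>], rotated])
       (auto simp: field_in_chart_def chart_inv[OF c] chart_map_differentiable[OF c]
         differential_bounded_linear[OF bounded_linear_inner_left])
qed

lemma smooth_vector_fieldI:
  assumes "open U" "\<And>D c. (D, c) \<in> A \<Longrightarrow> smooth_on (field_in_chart D c X) (c ` (U \<inter> D))"
  shows "smooth_vector_field A U X"
  unfolding smooth_vector_field_def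
proof (intro allI impI, elim conjE)
  fix W and f :: "'m \<Rightarrow> real"
  assume W: "open W" "W \<subseteq> U" and f: "smooth_fun_on A W f"
  show "smooth_fun_on A W (\<lambda>q. differential A f q (X q))"
  proof (rule smooth_fun_onI)
    fix D c assume c: "(D, c) \<in> A"
    show "smooth_on (\<lambda>x. differential A f (inv_into D c x) (X (inv_into D c x))) (c ` (W \<inter> D))"
    proof (rule smooth_on_cong[OF open_chart_image[OF c W(1)]])
      show "smooth_on (\<lambda>x. frechet_derivative (\<lambda>x. f (inv_into D c x)) (at x) (field_in_chart D c X x))
          (c ` (W \<inter> D))"
        by (intro smooth_on_derivative_along open_chart_image[OF c W(1)] smooth_fun_on_chart f c
            smooth_on_subset[OF assms(2)[OF c]]) (use W in auto)
      show "frechet_derivative (\<lambda>x. f (inv_into D c x)) (at x) (field_in_chart D c X x)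
          = differential A f (inv_into D c x) (X (inv_into D c x))" if "x \<in> c ` (W \<inter> D)" for x
        using that differential_along_field[OF smooth_fun_on_differentiable_mfd[OF f W(1)] c, of _ X]
        by (auto simp: chart_inv[OF c])
    qed
  qed
qed

lemma smooth_fun_on_field:
  fixes f :: "'m \<Rightarrow> real"
  assumes "smooth_vector_field A U X" "smooth_fun_on A W f" "open W" "W \<subseteq> U"
  shows "smooth_fun_on A W (\<lambda>q. differential A f q (X q))"
  using assms unfolding smooth_vector_field_def by blast

lemma smooth_vector_field_subset:
  "smooth_vector_field A U X \<Longrightarrow> W \<subseteq> U \<Longrightarrow> smooth_vector_field A W X"
  unfolding smooth_vector_field_def by (meson order_trans)

text \<open>The first summand, with \<open>Z\<close> frozen at \<open>x\<close>, is the second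
  derivative of \<open>f\<close>. It is kept apart so that symmetry can cancel it in a Lie
  bracket.\<close>

lemma frechet_derivative_product_rule_along:
  fixes f :: "'a::euclidean_space \<Rightarrow> real"
  assumes "open S" "smooth_on f S" "smooth_on Z S" "x \<in> S"
  shows "frechet_derivative (\<lambda>y. frechet_derivative f (at y) (Z y)) (at x) v
    = frechet_derivative (\<lambda>y. frechet_derivative f (at y) (Z x)) (at x) v
      + frechet_derivative f (at x) (frechet_derivative Z (at x) v)"
proof -
  let ?f = "\<lambda>b y. frechet_derivative f (at y) b"
  have d: "f differentiable at x" by (rule smooth_on_differentiable[OF assms(1,2,4)])
  have f: "(?f b has_derivative frechet_derivative (?f b) (at x)) (at x)" for b
    by (rule smooth_on_has_derivative[OF assms(1) smooth_on_frechet_derivative[OF assms(1,2)] assms(4)])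
  have Z: "(Z has_derivative frechet_derivative Z (at x)) (at x)"
    by (rule smooth_on_has_derivative[OF assms(1,3,4)])
  have ex: "?f w y = (\<Sum>b\<in>Basis. (w \<bullet> b) * ?f b y)" if "y \<in> S" for w y
    using linear_euclidean_expansion[OF linear_frechet_derivative[OF smooth_on_differentiable[OF assms(1,2) that]], of w]
    by simp
  have "((\<lambda>y. \<Sum>b\<in>Basis. (Z y \<bullet> b) * ?f b y) has_derivative
      (\<lambda>v. \<Sum>b\<in>Basis. (Z x \<bullet> b) * frechet_derivative (?f b) (at x) v
        + (frechet_derivative Z (at x) v \<bullet> b) * ?f b x)) (at x)"
    by (intro has_derivative_sum has_derivative_mult f
        bounded_linear.has_derivative[OF bounded_linear_inner_left] Z)
  then have "((\<lambda>y. ?f (Z y) y) has_derivative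
      (\<lambda>v. \<Sum>b\<in>Basis. (Z x \<bullet> b) * frechet_derivative (?f b) (at x) v
        + (frechet_derivative Z (at x) v \<bullet> b) * ?f b x)) (at x)"
    by (rule has_derivative_transform_within_open[OF _ assms(1,4)]) (simp add: ex)
  note 1 = frechet_derivative_eqI[OF this]
  have "((\<lambda>y. \<Sum>b\<in>Basis. (Z x \<bullet> b) * ?f b y) has_derivative
      (\<lambda>v. \<Sum>b\<in>Basis. (Z x \<bullet> b) * frechet_derivative (?f b) (at x) v)) (at x)"
    by (intro has_derivative_sum has_derivative_mult_right f)
  then have "((\<lambda>y. ?f (Z x) y) has_derivative
      (\<lambda>v. \<Sum>b\<in>Basis. (Z x \<bullet> b) * frechet_derivative (?f b) (at x) v)) (at x)"
    by (rule has_derivative_transform_within_open[OF _ assms(1,4)]) (simp add: ex)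
  note 2 = frechet_derivative_eqI[OF this]
  show ?thesis
    unfolding 1 2 ex[OF assms(4), of "frechet_derivative Z (at x) v"] by (simp add: sum.distrib)
qed

text \<open>\<open>lie_bracket\<close> is defined by the chosen coordinates at \<open>m\<close>
  only. In this chart each iterated derivative splits into a second derivative of \<open>f\<close>
  and a first derivative of the inner field; the second derivatives cancel by symmetry.\<close>

lemma lie_bracket_apply:
  fixes f :: "'m \<Rightarrow> real"
  assumes "open U" "m \<in> U" and f: "smooth_fun_on A U f"
    and Y: "smooth_vector_field A U Y" and Z: "smooth_vector_field A U Z"
  shows "differential A f m (lie_bracket A Y Z m)
    = differential A (\<lambda>q. differential A f q (Z q)) m (Y m)
    - differential A (\<lambda>q. differential A f q (Y q)) m (Z m)"
proof -
  let ?D = "chart_dom A m" and ?c = "coord A m"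
  note ch = chart_at_in_atlas[of m] chart_at_mem[of m]
  let ?S = "?c ` (U \<inter> ?D)" and ?x = "?c m"
  let ?f = "\<lambda>x. f (inv_into ?D ?c x)"
  have S: "open ?S" "?x \<in> ?S" using open_chart_image[OF ch(1) \<open>open U\<close>] ch \<open>m \<in> U\<close> by auto
  have sf: "smooth_on ?f ?S" by (rule smooth_fun_on_chart[OF f ch(1)])
  have bracket: "differential A (\<lambda>q. differential A ?c q (X q)) m v
      = frechet_derivative (field_in_chart ?D ?c X) (at ?x) v"
    if "smooth_vector_field A U X" for X v
  proof -
    have "(field_in_chart ?D ?c X has_derivative frechet_derivative (field_in_chart ?D ?c X) (at ?x)) (at ?x)"
      by (rule smooth_on_has_derivative[OF S(1) smooth_field_in_chart[OF that \<open>open U\<close> ch(1)] S(2)])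
    then show ?thesis
      by (intro differential_has_derivative(2)) (simp add: field_in_chart_def[abs_def] uncoord_def)
  qed
  have second: "differential A (\<lambda>q. differential A f q (X q)) m v
      = frechet_derivative (\<lambda>y. frechet_derivative ?f (at y) (field_in_chart ?D ?c X y)) (at ?x) v"
    if X: "smooth_vector_field A U X" for X v
  proof -
    let ?h = "\<lambda>y. frechet_derivative ?f (at y) (field_in_chart ?D ?c X y)"
    have "smooth_on ?h ?S"
      by (rule smooth_on_derivative_along[OF S(1) sf smooth_field_in_chart[OF that \<open>open U\<close> ch(1)]])
    from smooth_on_has_derivative[OF S(1) this S(2)]
    have "((\<lambda>x. differential A f (uncoord A m x) (X (uncoord A m x))) has_derivative
        frechet_derivative ?h (at ?x)) (at ?x)"
      by (rule has_derivative_transform_within_open[OF _ S])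
         (auto simp: uncoord_def chart_inv[OF ch(1)]
            differential_along_field[OF smooth_fun_on_differentiable_mfd[OF f \<open>open U\<close>] ch(1)])
    then show ?thesis by (rule differential_has_derivative(2))
  qed
  note hat = field_in_chart_at[OF ch, unfolded differential_coord]
  note pr = frechet_derivative_product_rule_along[OF S(1) sf smooth_field_in_chart[OF _ \<open>open U\<close> ch(1)] S(2)]
  have lin: "linear (frechet_derivative ?f (at ?x))"
    by (rule linear_frechet_derivative[OF smooth_on_differentiable[OF S(1) sf S(2)]])
  have "differential A f m w = frechet_derivative ?f (at ?x) w" for w
    using differential_eq_chart[OF smooth_fun_on_differentiable_mfd[OF f \<open>open U\<close> \<open>m \<in> U\<close>] ch, of w]
    by (simp add: differential_coord)
  then show ?thesis
    unfolding second[OF Y] second[OF Z] pr[OF Y] pr[OF Z] lie_bracket_def bracket[OF Y] bracket[OF Z] hat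
    using frechet_derivative_symmetric[OF S(1) sf S(2), of "Z m" "Y m"]
    by (simp add: linear_diff[OF lin])
qed

end

section \<open>Maps between manifolds\<close>

lemma smooth_fun_on_compose_map:
  fixes A :: "('m::{t2_space, second_countable_topology}, 'e::euclidean_space) atlas"
    and A' :: "('n::{t2_space, second_countable_topology}, 'f::euclidean_space) atlas"
  assumes mA: "smooth_manifold A" and mA': "smooth_manifold A'"
    and \<phi>: "smooth_map_on A A' U \<phi>" and "open U" "open W" and g: "smooth_fun_on A' W g"
  shows "smooth_fun_on A (U \<inter> \<phi> -` W) (\<lambda>q. g (\<phi> q))"
proof (rule smooth_fun_onI[OF mA])
  fix D c assume c: "(D, c) \<in> A"
  have pre: "open (U \<inter> \<phi> -` S)" if "open S" for S
    using \<phi> \<open>open U\<close> that unfolding smooth_map_on_def by (blast intro: continuous_open_preimage)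
  show "smooth_on (\<lambda>x. g (\<phi> (inv_into D c x))) (c ` (U \<inter> \<phi> -` W \<inter> D))"
  proof (rule smooth_on_local[OF open_chart_image[OF mA c pre[OF \<open>open W\<close>]]])
    fix x assume "x \<in> c ` (U \<inter> \<phi> -` W \<inter> D)"
    then obtain q where q: "q \<in> U" "\<phi> q \<in> W" "q \<in> D" "x = c q" by auto
    let ?D' = "chart_dom A' (\<phi> q)" and ?c' = "coord A' (\<phi> q)"
    note ch = chart_at_in_atlas[OF mA', of "\<phi> q"] chart_at_mem[OF mA', of "\<phi> q"]
    let ?T = "c ` (U \<inter> \<phi> -` (W \<inter> ?D') \<inter> D)"
    have "open (W \<inter> ?D')" using \<open>open W\<close> chart_homeomorphism(1)[OF mA' ch(1)] by auto
    from open_chart_image[OF mA c pre[OF this]] have T: "open ?T" .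
    have "smooth_on (?c' \<circ> \<phi> \<circ> inv_into D c) (c ` (U \<inter> D \<inter> \<phi> -` ?D'))"
      using \<phi> c ch(1) unfolding smooth_map_on_def by fast
    then have s: "smooth_on (\<lambda>x. ?c' (\<phi> (inv_into D c x))) ?T"
      unfolding o_def by (rule smooth_on_subset) auto
    have "smooth_on (\<lambda>x. g (inv_into ?D' ?c' (?c' (\<phi> (inv_into D c x))))) ?T"
      by (rule smooth_on_compose[OF T open_chart_image[OF mA' ch(1) \<open>open W\<close>] _ s
            smooth_fun_on_chart[OF mA' g ch(1)]])
         (auto simp: chart_inv[OF mA c])
    then have "smooth_on (\<lambda>x. g (\<phi> (inv_into D c x))) ?T"
      by (rule smooth_on_cong[OF T, rotated])
         (auto simp: chart_inv[OF mA c] chart_inv[OF mA' ch(1)])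
    with T q ch show "\<exists>T. open T \<and> x \<in> T \<and> smooth_on (\<lambda>x. g (\<phi> (inv_into D c x))) T" by blast
  qed
qed

text \<open>Only differentiability of the coordinate expression at the point is asked of
  \<open>\<psi>\<close>. This covers the time \<open>t\<close> maps of a flow, whose smoothness is
  given jointly with time and not as that of a map between two manifolds.\<close>

lemma differential_compose_map:
  fixes A :: "('m::{t2_space, second_countable_topology}, 'e::euclidean_space) atlas"
    and A' :: "('n::{t2_space, second_countable_topology}, 'f::euclidean_space) atlas"
  assumes mA: "smooth_manifold A" and mA': "smooth_manifold A'"
    and W: "open W" "m \<in> W" "\<psi> ` W \<subseteq> chart_dom A' (\<psi> m)"
    and \<psi>: "differentiable_mfd A (\<lambda>q. coord A' (\<psi> m) (\<psi> q)) m"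
    and g: "differentiable_mfd A' g (\<psi> m)"
  shows "differentiable_mfd A (\<lambda>q. g (\<psi> q)) m"
    "blinfun_apply (differential A (\<lambda>q. g (\<psi> q)) m) v
      = blinfun_apply (differential A' g (\<psi> m)) (blinfun_apply (tangent_map A A' \<psi> m) v)"
proof -
  let ?S = "coord A m ` (W \<inter> chart_dom A m)"
  note ch = chart_at_in_atlas[OF mA, of m] chart_at_mem[OF mA, of m]
  note ch' = chart_at_in_atlas[OF mA', of "\<psi> m"] chart_at_mem[OF mA', of "\<psi> m"]
  have "((\<lambda>x. g (uncoord A' (\<psi> m) (coord A' (\<psi> m) (\<psi> (uncoord A m x))))) has_derivative
     (\<lambda>v. differential A' g (\<psi> m) (differential A (\<lambda>q. coord A' (\<psi> m) (\<psi> q)) m v))) (at (coord A m m))"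
    by (rule has_derivative_compose[OF differentiable_mfd_has_derivative[OF mA \<psi>]])
       (use differentiable_mfd_has_derivative[OF mA' g] in \<open>simp add: uncoord_coord[OF mA]\<close>)
  then have *: "((\<lambda>x. g (\<psi> (uncoord A m x))) has_derivative
     (\<lambda>v. differential A' g (\<psi> m) (differential A (\<lambda>q. coord A' (\<psi> m) (\<psi> q)) m v))) (at (coord A m m))"
  proof (rule has_derivative_transform_within_open)
    show "open ?S" by (rule open_chart_image[OF mA ch(1) W(1)])
    show "coord A m m \<in> ?S" using ch W by auto
    fix x assume "x \<in> ?S"
    then obtain q where "q \<in> W" "uncoord A m x = q"
      by (auto simp: uncoord_def chart_inv[OF mA ch(1)])
    then show "g (uncoord A' (\<psi> m) (coord A' (\<psi> m) (\<psi> (uncoord A m x)))) = g (\<psi> (uncoord A m x))"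
      using W(3) chart_inv[OF mA' ch'(1)] by (auto simp: uncoord_def)
  qed
  show "differentiable_mfd A (\<lambda>q. g (\<psi> q)) m"
    by (rule differential_has_derivative(1)[OF mA *])
  show "blinfun_apply (differential A (\<lambda>q. g (\<psi> q)) m) v
      = blinfun_apply (differential A' g (\<psi> m)) (blinfun_apply (tangent_map A A' \<psi> m) v)"
    unfolding differential_has_derivative(2)[OF mA *] by (simp add: tangent_map_def o_def)
qed

lemma differential_compose_smooth_map:
  fixes A :: "('m::{t2_space, second_countable_topology}, 'e::euclidean_space) atlas"
    and A' :: "('n::{t2_space, second_countable_topology}, 'f::euclidean_space) atlas"
  assumes mA: "smooth_manifold A" and mA': "smooth_manifold A'"
    and \<phi>: "smooth_map_on A A' U \<phi>" and "open U" "m \<in> U" and g: "differentiable_mfd A' g (\<phi> m)"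
  shows "differentiable_mfd A (\<lambda>q. g (\<phi> q)) m"
    and "blinfun_apply (differential A (\<lambda>q. g (\<phi> q)) m) v
      = blinfun_apply (differential A' g (\<phi> m)) (blinfun_apply (tangent_map A A' \<phi> m) v)"
proof -
  note ch' = chart_at_in_atlas[OF mA', of "\<phi> m"] chart_at_mem[OF mA', of "\<phi> m"]
  note o' = chart_homeomorphism(1)[OF mA' ch'(1)]
  let ?W = "U \<inter> \<phi> -` chart_dom A' (\<phi> m)"
  have W: "open ?W" "m \<in> ?W"
    using \<phi> \<open>open U\<close> \<open>m \<in> U\<close> ch' o' unfolding smooth_map_on_def
    by (auto intro: continuous_open_preimage)
  have "smooth_fun_on A ?W (\<lambda>q. coord A' (\<phi> m) (\<phi> q))"
    by (rule smooth_fun_on_compose_map[OF mA mA' \<phi> \<open>open U\<close> o'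
          smooth_fun_on_chart_map[OF mA' ch'(1) o' order_refl]])
  from smooth_fun_on_differentiable_mfd[OF mA this W]
  have d: "differentiable_mfd A (\<lambda>q. coord A' (\<phi> m) (\<phi> q)) m" .
  have s: "\<phi> ` ?W \<subseteq> chart_dom A' (\<phi> m)" by auto
  from differential_compose_map[OF mA mA' W s d g]
  show "differentiable_mfd A (\<lambda>q. g (\<phi> q)) m"
    "blinfun_apply (differential A (\<lambda>q. g (\<phi> q)) m) v
      = blinfun_apply (differential A' g (\<phi> m)) (blinfun_apply (tangent_map A A' \<phi> m) v)" .
qed

lemma differential_pullback:
  fixes A :: "('m::{t2_space, second_countable_topology}, 'e::euclidean_space) atlas"
    and A' :: "('n::{t2_space, second_countable_topology}, 'f::euclidean_space) atlas"
  assumes "smooth_manifold A" "smooth_manifold A'" "smooth_map_on A A' U \<phi>" "open U" "m \<in> U"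
    and "differentiable_mfd A' g (\<phi> m)"
  shows "differential A (\<lambda>q. g (\<phi> q)) m = pullback A A' \<phi> m (differential A' g (\<phi> m))"
  by (rule blinfun_eqI) (simp add: differential_compose_smooth_map(2)[OF assms] pullback_def)

section \<open>Poisson brackets\<close>

lemma blinfun_separates:
  fixes v w :: "'e::euclidean_space"
  assumes "\<And>\<eta> :: 'e \<Rightarrow>\<^sub>L real. \<eta> v = \<eta> w"
  shows "v = w"
proof (rule euclidean_eqI)
  fix b :: 'e
  from assms[of "blinfun_inner_left b"] show "v \<bullet> b = w \<bullet> b" by (simp add: inner_commute)
qed

context
  fixes A :: "('m::{t2_space, second_countable_topology}, 'e::euclidean_space) atlas"
    and P :: "('m, 'e) bivector"
  assumes mfd: "smooth_manifold A" and poisson: "poisson_structure A P"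
begin

lemma bivector_bilinear: "bounded_bilinear (P m)"
  and bivector_antisym: "P m \<xi> \<eta> = - P m \<eta> \<xi>"
proof -
  have "\<forall>m. bounded_bilinear (P m) \<and> (\<forall>\<xi> \<eta>. P m \<xi> \<eta> = - P m \<eta> \<xi>)"
    using poisson unfolding poisson_structure_def by (elim conjE)
  then show "bounded_bilinear (P m)" "P m \<xi> \<eta> = - P m \<eta> \<xi>" by blast+
qed

text \<open>The definite description in \<open>sharp\<close> has to be justified. The vector
  \<open>v\<close> is written down from the values on the dual basis
  \<open>blinfun_inner_left b\<close>, and it is unique because covectors separate vectors.\<close>

lemma sharp_apply: "blinfun_apply \<eta> (sharp P m \<xi>) = P m \<xi> \<eta>"
proof -
  interpret bounded_bilinear "P m" by (rule bivector_bilinear)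
  define v where "v = (\<Sum>b\<in>Basis. P m \<xi> (blinfun_inner_left b) *\<^sub>R b)"
  have v: "blinfun_apply \<eta> v = P m \<xi> \<eta>" for \<eta>
  proof -
    have "\<eta> = (\<Sum>b\<in>Basis. blinfun_apply \<eta> b *\<^sub>R blinfun_inner_left b)"
    proof (rule blinfun_eqI)
      fix x
      have "blinfun_apply \<eta> x = (\<Sum>b\<in>Basis. (x \<bullet> b) *\<^sub>R blinfun_apply \<eta> b)"
        by (rule linear_euclidean_expansion[OF bounded_linear.linear[OF blinfun.bounded_linear_right]])
      then show "blinfun_apply \<eta> x
          = blinfun_apply (\<Sum>b\<in>Basis. blinfun_apply \<eta> b *\<^sub>R blinfun_inner_left b) x"
        by (simp add: blinfun.sum_left blinfun.scaleR_left mult.commute)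
    qed
    then have "P m \<xi> \<eta> = P m \<xi> (\<Sum>b\<in>Basis. blinfun_apply \<eta> b *\<^sub>R blinfun_inner_left b)" by simp
    also have "\<dots> = blinfun_apply \<eta> v"
      by (simp add: v_def sum_right scaleR_right blinfun.sum_right blinfun.scaleR_right mult.commute)
    finally show ?thesis by simp
  qed
  have "sharp P m \<xi> = v"
    unfolding sharp_def
  proof (rule the_equality)
    fix w assume "\<forall>\<eta>. blinfun_apply \<eta> w = P m \<xi> \<eta>"
    then show "w = v" using v by (simp add: blinfun_separates[of w v])
  qed (simp add: v)
  then show ?thesis by (simp add: v)
qed

lemma sharp_linear: "linear (sharp P m)"
proof -
  interpret bounded_bilinear "P m" by (rule bivector_bilinear)
  show ?thesis
    by (rule linearI; rule blinfun_separates)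
       (simp add: sharp_apply blinfun.add_right blinfun.scaleR_right add_left scaleR_left)+
qed

lemma poisson_bracket_sharp:
  "poisson_bracket A P f g m = differential A g m (sharp P m (differential A f m))"
  by (simp add: poisson_bracket_def sharp_apply)

lemma poisson_bracket_antisym: "poisson_bracket A P f g m = - poisson_bracket A P g f m"
  unfolding poisson_bracket_def by (rule bivector_antisym)

lemma smooth_poisson_bracket:
  "open U \<Longrightarrow> smooth_fun_on A U f \<Longrightarrow> smooth_fun_on A U g \<Longrightarrow> smooth_fun_on A U (poisson_bracket A P f g)"
proof -
  assume *: "open U" "smooth_fun_on A U f" "smooth_fun_on A U g"
  have "\<forall>U f g. open U \<and> smooth_fun_on A U f \<and> smooth_fun_on A U g \<longrightarrow>
        smooth_fun_on A U (poisson_bracket A P f g)"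
    using poisson unfolding poisson_structure_def by (elim conjE)
  with * show "smooth_fun_on A U (poisson_bracket A P f g)" by blast
qed

lemma jacobi_identity:
  assumes "open U" "smooth_fun_on A U f" "smooth_fun_on A U g" "smooth_fun_on A U h" "m \<in> U"
  shows "poisson_bracket A P f (poisson_bracket A P g h) m
       + poisson_bracket A P g (poisson_bracket A P h f) m
       + poisson_bracket A P h (poisson_bracket A P f g) m = 0"
proof -
  have "\<forall>U f g h. open U \<and> smooth_fun_on A U f \<and> smooth_fun_on A U g \<and> smooth_fun_on A U h \<longrightarrow>
        (\<forall>m\<in>U. poisson_bracket A P f (poisson_bracket A P g h) m
             + poisson_bracket A P g (poisson_bracket A P h f) m
             + poisson_bracket A P h (poisson_bracket A P f g) m = 0)"
    using poisson unfolding poisson_structure_def by (elim conjE)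
  with assms show ?thesis by blast
qed

lemma poisson_bracket_cong:
  assumes "open W" "m \<in> W" "\<And>q. q \<in> W \<Longrightarrow> f q = f' q" "\<And>q. q \<in> W \<Longrightarrow> g q = g' q"
  shows "poisson_bracket A P f g m = poisson_bracket A P f' g' m"
  unfolding poisson_bracket_def
  using differential_cong[OF mfd assms(1,2,3)] differential_cong[OF mfd assms(1,2,4)] by simp

lemma poisson_bracket_mult_right:
  fixes f g h :: "'m \<Rightarrow> real"
  assumes "differentiable_mfd A g m" "differentiable_mfd A h m"
  shows "poisson_bracket A P f (\<lambda>q. g q * h q) m
    = g m * poisson_bracket A P f h m + h m * poisson_bracket A P f g m"
  unfolding poisson_bracket_sharp differential_mult[OF mfd assms]
  by (simp add: blinfun.add_left blinfun.scaleR_left)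

lemma poisson_bracket_sum_right:
  fixes f :: "'m \<Rightarrow> real"
  assumes "\<And>i. i \<in> I \<Longrightarrow> differentiable_mfd A (g i) m"
  shows "poisson_bracket A P f (\<lambda>q. \<Sum>i\<in>I. g i q) m = (\<Sum>i\<in>I. poisson_bracket A P f (g i) m)"
  using assms by (simp add: poisson_bracket_sharp differential_sum[OF mfd] blinfun.sum_left)

lemma poisson_bracket_zero_right:
  assumes "open W" "m \<in> W" "\<And>q. q \<in> W \<Longrightarrow> g q = 0"
  shows "poisson_bracket A P f g m = 0"
  using differential_eq_0[OF mfd assms(1,2), of g 0] assms(3) by (simp add: poisson_bracket_sharp)

lemma poisson_bracket_uminus_right:
  fixes f :: "'m \<Rightarrow> real"
  assumes "differentiable_mfd A g m"
  shows "poisson_bracket A P f (\<lambda>q. - g q) m = - poisson_bracket A P f g m"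
  using differential_scaleR[OF mfd assms, of "- 1"]
  by (simp add: poisson_bracket_sharp blinfun.minus_left)

lemma poisson_bracket_derivation:
  assumes U: "open U" "m \<in> U"
    and f: "smooth_fun_on A U f" and g: "smooth_fun_on A U g" and h: "smooth_fun_on A U h"
  shows "poisson_bracket A P f (poisson_bracket A P g h) m
    = poisson_bracket A P (poisson_bracket A P f g) h m + poisson_bracket A P g (poisson_bracket A P f h) m"
proof -
  have "poisson_bracket A P g (poisson_bracket A P h f) m
      = poisson_bracket A P g (\<lambda>q. - poisson_bracket A P f h q) m"
    by (rule poisson_bracket_cong[OF U]) (rule refl, rule poisson_bracket_antisym)
  also have "\<dots> = - poisson_bracket A P g (poisson_bracket A P f h) m"
    by (rule poisson_bracket_uminus_right)
       (rule smooth_fun_on_differentiable_mfd[OF mfd smooth_poisson_bracket[OF U(1) f h] U])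
  finally show ?thesis
    using jacobi_identity[OF U(1) f g h U(2)] poisson_bracket_antisym[of h "poisson_bracket A P f g" m]
    by simp
qed

lemma smooth_sharp_differential:
  assumes "open U" "smooth_fun_on A U f"
  shows "smooth_vector_field A U (\<lambda>q. sharp P q (differential A f q))"
  unfolding smooth_vector_field_def
proof (intro allI impI, elim conjE)
  fix W and g :: "'m \<Rightarrow> real" assume W: "open W" "W \<subseteq> U" and g: "smooth_fun_on A W g"
  from smooth_poisson_bracket[OF W(1) smooth_fun_on_subset[OF mfd assms(2) W(2)] g]
  show "smooth_fun_on A W (\<lambda>q. differential A g q (sharp P q (differential A f q)))"
    by (simp add: poisson_bracket_sharp[abs_def])
qed

text \<open>The Jacobi identity is applied to \<open>f\<close>, \<open>g\<close> and a component of
  the chart. The iterated brackets are components of the two derivatives below, and the remaining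
  term contains the bracket of \<open>f\<close> and \<open>g\<close>, which is zero near the
  point.\<close>

lemma commuting_hamiltonians_in_chart:
  assumes U: "open U" and f: "smooth_fun_on A U f" and g: "smooth_fun_on A U g"
    and fg: "\<And>q. q \<in> U \<Longrightarrow> poisson_bracket A P f g q = 0"
    and c: "(D, c) \<in> A" and x: "x \<in> c ` (U \<inter> D)"
  defines "X \<equiv> (\<lambda>f. field_in_chart A D c (\<lambda>q. sharp P q (differential A f q)))"
  shows "frechet_derivative (X g) (at x) (X f x) = frechet_derivative (X f) (at x) (X g x)"
proof (rule euclidean_eqI)
  fix b :: 'e
  let ?W = "U \<inter> D"
  let ?h = "\<lambda>q. c q \<bullet> b"
  have W: "open ?W" "?W \<subseteq> U" using U chart_homeomorphism(1)[OF mfd c] by auto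
  obtain q where q: "q \<in> ?W" "x = c q" using x by auto
  have h: "smooth_fun_on A ?W ?h"
    by (intro smooth_fun_on_bounded_linear[OF mfd bounded_linear_inner_left W(1)]
        smooth_fun_on_chart_map[OF mfd c W(1)]) auto
  note f' = smooth_fun_on_subset[OF mfd f W(2)] and g' = smooth_fun_on_subset[OF mfd g W(2)]
  have coord: "poisson_bracket A P k ?h q = X k (c q) \<bullet> b" if "q \<in> ?W" for k q
    using that differential_bounded_linear[OF mfd bounded_linear_inner_left chart_map_differentiable[OF mfd c]]
    by (simp add: poisson_bracket_sharp X_def field_in_chart_at[OF mfd c])
  have outer: "poisson_bracket A P k (poisson_bracket A P l ?h) q
      = frechet_derivative (X l) (at x) (X k x) \<bullet> b"
    if k: "smooth_fun_on A U k" and l: "smooth_fun_on A U l" for k l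
  proof -
    have d: "differentiable_mfd A (poisson_bracket A P l ?h) q"
      by (rule smooth_fun_on_differentiable_mfd[OF mfd smooth_poisson_bracket[OF W(1)
              smooth_fun_on_subset[OF mfd l W(2)] h] W(1) q(1)])
    have "poisson_bracket A P k (poisson_bracket A P l ?h) q
        = frechet_derivative (\<lambda>x. poisson_bracket A P l ?h (inv_into D c x)) (at x) (X k x)"
      unfolding poisson_bracket_sharp[of k] X_def q(2)
      by (rule differential_along_field[OF mfd d c]) (use q in auto)
    also have "frechet_derivative (\<lambda>x. poisson_bracket A P l ?h (inv_into D c x)) (at x)
        = frechet_derivative (\<lambda>x. X l x \<bullet> b) (at x)"
      by (rule frechet_derivative_cong[OF open_chart_image[OF mfd c U] x])
         (auto simp: chart_inv[OF mfd c] coord)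
    also have "\<dots> = (\<lambda>v. frechet_derivative (X l) (at x) v \<bullet> b)"
      unfolding X_def
      by (intro frechet_derivative_inner smooth_on_differentiable[OF open_chart_image[OF mfd c U]
            smooth_field_in_chart[OF mfd smooth_sharp_differential[OF U l] U c] x])
    finally show ?thesis .
  qed
  have "poisson_bracket A P (poisson_bracket A P f g) ?h q = 0"
    unfolding poisson_bracket_antisym[of "poisson_bracket A P f g"]
    using poisson_bracket_zero_right[OF U, of q "poisson_bracket A P f g" ?h] fg q by simp
  with poisson_bracket_derivation[OF W(1) q(1) f' g' h]
  show "frechet_derivative (X g) (at x) (X f x) \<bullet> b = frechet_derivative (X f) (at x) (X g x) \<bullet> b"
    unfolding outer[OF f g] outer[OF g f] by simp
qed

end

section \<open>Flows\<close>

text \<open>The sum of the norms of the partial derivatives dominates the operator norm and is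
  continuous, so on a small ball it stays below its value at \<open>x0\<close> plus 1. Convexity of
  the ball makes the same constant a Lipschitz constant.\<close>

lemma smooth_on_local_bound:
  fixes f :: "'a::euclidean_space \<Rightarrow> 'b::real_normed_vector"
  assumes "open S" "smooth_on f S" "x0 \<in> S"
  obtains d L where "d > 0" "L \<ge> 0" "ball x0 d \<subseteq> S"
    "\<And>x v. x \<in> ball x0 d \<Longrightarrow> norm (frechet_derivative f (at x) v) \<le> L * norm v"
    "\<And>x y. x \<in> ball x0 d \<Longrightarrow> y \<in> ball x0 d \<Longrightarrow> norm (f x - f y) \<le> L * norm (x - y)"
proof -
  let ?N = "\<lambda>x. \<Sum>b\<in>Basis. norm (frechet_derivative f (at x) b)"
  define L where "L = ?N x0 + 1"
  have "continuous_on S ?N"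
    by (intro continuous_on_sum continuous_on_norm smooth_on_continuous[OF smooth_on_frechet_derivative] assms)
  then have "isCont ?N x0" using assms by (simp add: continuous_on_eq_continuous_at)
  then obtain d1 where d1: "d1 > 0" "\<And>x. dist x x0 < d1 \<Longrightarrow> dist (?N x) (?N x0) < 1"
    unfolding continuous_at_eps_delta by (metis zero_less_one)
  obtain d2 where d2: "d2 > 0" "ball x0 d2 \<subseteq> S" using assms open_contains_ball by blast
  define d where "d = min d1 d2"
  have sub: "ball x0 d \<subseteq> S" using d2 by (auto simp: d_def)
  have bound: "norm (frechet_derivative f (at x) v) \<le> L * norm v" if x: "x \<in> ball x0 d" for x v
  proof -
    have "frechet_derivative f (at x) v = (\<Sum>b\<in>Basis. (v \<bullet> b) *\<^sub>R frechet_derivative f (at x) b)"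
      by (rule linear_euclidean_expansion[OF linear_frechet_derivative[OF smooth_on_differentiable[OF assms(1,2)]]])
         (use x sub in auto)
    also have "norm \<dots> \<le> (\<Sum>b\<in>Basis. norm v * norm (frechet_derivative f (at x) b))"
      by (rule sum_norm_le) (simp add: Basis_le_norm mult_right_mono)
    also have "\<dots> = ?N x * norm v" by (simp add: sum_distrib_left mult.commute)
    also have "\<dots> \<le> L * norm v"
    proof (rule mult_right_mono)
      have "dist x x0 < d1" using x by (simp add: d_def dist_commute)
      from d1(2)[OF this] show "?N x \<le> L" by (simp add: L_def dist_real_def)
    qed simp
    finally show ?thesis .
  qed
  have "norm (f x - f y) \<le> L * norm (x - y)" if "x \<in> ball x0 d" "y \<in> ball x0 d" for x y
  proof (rule differentiable_bound[OF convex_ball _ _ that])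
    fix u assume u: "u \<in> ball x0 d"
    show "(f has_derivative frechet_derivative f (at u)) (at u within ball x0 d)"
      by (rule has_derivative_at_withinI[OF smooth_on_has_derivative[OF assms(1,2)]]) (use u sub in auto)
    show "onorm (frechet_derivative f (at u)) \<le> L"
      by (rule onorm_le) (rule bound[OF u])
  qed
  moreover have "L \<ge> 0" by (simp add: L_def sum_nonneg add_nonneg_nonneg)
  ultimately show thesis using that[of d L] d1(1) d2(1) sub bound by (simp add: d_def)
qed

text \<open>An argument by open and closed sets of times. Near each time the property must pass from
  any time to any other, also backwards, which is what the two-sided differential inequality
  delivers.\<close>

lemma connected_induction_real:
  fixes a b :: real
  assumes "P a" "\<And>a. \<exists>T. open T \<and> a \<in> T \<and> (\<forall>x\<in>T. \<forall>y\<in>T. P x \<longrightarrow> P y)"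
  shows "P b"
proof (rule connected_induction_simple[where P = P, OF connected_UNIV UNIV_I UNIV_I assms(1)])
  fix t :: real
  from assms(2)[of t] obtain T where T: "open T" "t \<in> T" "\<forall>x\<in>T. \<forall>y\<in>T. P x \<longrightarrow> P y" by blast
  moreover have "openin (top_of_set UNIV) T" using T(1) by (simp only: subtopology_UNIV flip: open_openin)
  ultimately show "\<exists>T. openin (top_of_set UNIV) T \<and> t \<in> T \<and> (\<forall>x\<in>T. \<forall>y\<in>T. P x \<longrightarrow> P y)" by blast
qed

context
  fixes A :: "('m::{t2_space, second_countable_topology}, 'e::euclidean_space) atlas"
  assumes mfd: "smooth_manifold A"
begin

text \<open>Integral curves are defined by the chart chosen at each of their points; going back
  through the inverse of that chart gives the derivative of every function along the curve.\<close>

lemma integral_curve_along: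
  assumes \<gamma>: "integral_curve A S X \<gamma>" and f: "differentiable_mfd A f (\<gamma> t)"
  shows "((\<lambda>s. f (\<gamma> s)) has_vector_derivative differential A f (\<gamma> t) (X (\<gamma> t))) (at t)"
proof -
  note ch = chart_at_in_atlas[OF mfd, of "\<gamma> t"] chart_at_mem[OF mfd, of "\<gamma> t"]
  have 1: "((\<lambda>s. coord A (\<gamma> t) (\<gamma> s)) has_vector_derivative X (\<gamma> t)) (at t)"
    using \<gamma> unfolding integral_curve_def by (simp add: o_def)
  have "((\<lambda>s. f (uncoord A (\<gamma> t) (coord A (\<gamma> t) (\<gamma> s)))) has_vector_derivative
      differential A f (\<gamma> t) (X (\<gamma> t))) (at t)"
    by (rule has_vector_derivative_compose[OF 1 differentiable_mfd_has_derivative[OF mfd f]])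
  then show ?thesis
  proof (rule has_vector_derivative_transform_within_open)
    show "open (\<gamma> -` chart_dom A (\<gamma> t))"
      by (rule open_vimage[OF chart_homeomorphism(1)[OF mfd ch(1)]])
         (use \<gamma> in \<open>simp add: integral_curve_def\<close>)
    show "t \<in> \<gamma> -` chart_dom A (\<gamma> t)" using ch by simp
    show "f (uncoord A (\<gamma> t) (coord A (\<gamma> t) (\<gamma> s))) = f (\<gamma> s)" if "s \<in> \<gamma> -` chart_dom A (\<gamma> t)" for s
      using that chart_inv[OF mfd ch(1)] by (simp add: uncoord_def)
  qed
qed

text \<open>The definition insists on the chosen charts; a change of coordinates shows that at each
  time any chart around the point serves.\<close>

lemma integral_curveI:
  assumes "range \<gamma> \<subseteq> S" "continuous_on UNIV \<gamma>"
    and "\<And>t. \<exists>D c. (D, c) \<in> A \<and> \<gamma> t \<in> D \<and>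
      ((\<lambda>s. c (\<gamma> s)) has_vector_derivative differential A c (\<gamma> t) (X (\<gamma> t))) (at t)"
  shows "integral_curve A S X \<gamma>"
proof -
  have "((coord A (\<gamma> t) \<circ> \<gamma>) has_vector_derivative X (\<gamma> t)) (at t)" for t
  proof -
    obtain D c where c: "(D, c) \<in> A" "\<gamma> t \<in> D"
      and d: "((\<lambda>s. c (\<gamma> s)) has_vector_derivative differential A c (\<gamma> t) (X (\<gamma> t))) (at t)"
      using assms(3) by blast
    note ch = chart_at_in_atlas[OF mfd, of "\<gamma> t"] chart_at_mem[OF mfd, of "\<gamma> t"]
    let ?c = "coord A (\<gamma> t)"
    note dc = chart_map_differentiable[OF mfd ch]
    have "((\<lambda>s. ?c (inv_into D c (c (\<gamma> s)))) has_vector_derivative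
      frechet_derivative (\<lambda>x. ?c (inv_into D c x)) (at (c (\<gamma> t))) (differential A c (\<gamma> t) (X (\<gamma> t)))) (at t)"
      by (rule has_vector_derivative_compose[OF d])
         (use differentiable_mfd_chart[OF mfd dc c] in \<open>simp add: frechet_derivative_works\<close>)
    then have "((\<lambda>s. ?c (inv_into D c (c (\<gamma> s)))) has_vector_derivative X (\<gamma> t)) (at t)"
      by (simp add: differential_coord[OF mfd] flip: differential_eq_chart[OF mfd dc c])
    then show ?thesis unfolding o_def
    proof (rule has_vector_derivative_transform_within_open)
      show "open (\<gamma> -` D)"
        by (rule open_vimage[OF chart_homeomorphism(1)[OF mfd c(1)] assms(2)])
      show "t \<in> \<gamma> -` D" using c by simp
      show "?c (inv_into D c (c (\<gamma> s))) = ?c (\<gamma> s)" if "s \<in> \<gamma> -` D" for s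
        using that chart_inv[OF mfd c(1)] by simp
    qed
  qed
  with assms(1,2) show ?thesis unfolding integral_curve_def by blast
qed

text \<open>Around a common point, the Lipschitz bound in one chart and the differential inequality
  give equality at all nearby times. At a time where the curves differ they differ nearby, the
  manifold being Hausdorff, and the implication is void.\<close>

lemma integral_curve_unique:
  assumes X: "smooth_vector_field A U X" "open U"
    and \<gamma>: "integral_curve A U X \<gamma>" and \<delta>: "integral_curve A U X \<delta>" and "\<gamma> t0 = \<delta> t0"
  shows "\<gamma> t = \<delta> t"
proof (rule connected_induction_real[of "\<lambda>t. \<gamma> t = \<delta> t" t0])
  have cont: "continuous_on UNIV \<gamma>" "continuous_on UNIV \<delta>"
    using \<gamma> \<delta> by (auto simp: integral_curve_def)
  fix a :: real
  show "\<exists>T. open T \<and> a \<in> T \<and> (\<forall>x\<in>T. \<forall>y\<in>T. \<gamma> x = \<delta> x \<longrightarrow> \<gamma> y = \<delta> y)"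
  proof (cases "\<gamma> a = \<delta> a")
    case False
    have "open {t. \<gamma> t \<noteq> \<delta> t}" by (rule open_Collect_neq[OF cont])
    with False show ?thesis by (intro exI[of _ "{t. \<gamma> t \<noteq> \<delta> t}"]) simp
  next
    case True
    let ?D = "chart_dom A (\<gamma> a)" and ?c = "coord A (\<gamma> a)"
    note ch = chart_at_in_atlas[OF mfd, of "\<gamma> a"] chart_at_mem[OF mfd, of "\<gamma> a"]
    let ?X = "field_in_chart A ?D ?c X"
    have "\<gamma> a \<in> U" using \<gamma> by (auto simp: integral_curve_def)
    then have "?c (\<gamma> a) \<in> ?c ` (U \<inter> ?D)" using ch by auto
    from smooth_on_local_bound[OF open_chart_image[OF mfd ch(1) X(2)] smooth_field_in_chart[OF mfd X ch(1)] this]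
    obtain d L where d: "d > 0" and lip: "\<And>x y. x \<in> ball (?c (\<gamma> a)) d \<Longrightarrow> y \<in> ball (?c (\<gamma> a)) d
        \<Longrightarrow> norm (?X x - ?X y) \<le> L * norm (x - y)" by metis
    let ?O = "?D \<inter> ?c -` ball (?c (\<gamma> a)) d"
    have O: "open ?O" by (rule open_chart_preimage[OF mfd ch(1) open_ball])
    have "open (\<gamma> -` ?O \<inter> \<delta> -` ?O)"
      by (rule open_Int[OF open_vimage[OF O cont(1)] open_vimage[OF O cont(2)]])
    moreover have "a \<in> \<gamma> -` ?O \<inter> \<delta> -` ?O" using ch d True by simp
    ultimately obtain e where e: "e > 0" "ball a e \<subseteq> \<gamma> -` ?O \<inter> \<delta> -` ?O"
      using open_contains_ball by blast
    have "\<gamma> y = \<delta> y" if "x \<in> ball a e" "y \<in> ball a e" "\<gamma> x = \<delta> x" for x y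
    proof -
      have sub: "{min x y..max x y} \<subseteq> ball a e"
        using that(1,2) by (auto simp: dist_real_def)
      have "?c (\<gamma> y) - ?c (\<delta> y) = 0"
      proof (rule gronwall_zero_two_sided[where a = x and K = L
            and z' = "\<lambda>t. ?X (?c (\<gamma> t)) - ?X (?c (\<delta> t))"])
        fix t assume "t \<in> {min x y..max x y}"
        then have t: "t \<in> \<gamma> -` ?O \<inter> \<delta> -` ?O" using sub e by blast
        show "((\<lambda>t. ?c (\<gamma> t) - ?c (\<delta> t)) has_vector_derivative ?X (?c (\<gamma> t)) - ?X (?c (\<delta> t))) (at t)"
          using integral_curve_along[OF \<gamma> chart_map_differentiable[OF mfd ch(1)], of t]
            integral_curve_along[OF \<delta> chart_map_differentiable[OF mfd ch(1)], of t] t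
          by (auto intro!: has_vector_derivative_diff simp: field_in_chart_at[OF mfd ch(1)])
        show "norm (?X (?c (\<gamma> t)) - ?X (?c (\<delta> t))) \<le> L * norm (?c (\<gamma> t) - ?c (\<delta> t))"
          by (rule lip) (use t in auto)
      qed (use that in simp)
      moreover have "\<gamma> y \<in> ?D" "\<delta> y \<in> ?D" using e that by auto
      ultimately show ?thesis using chart_inv[OF mfd ch(1)] by (metis eq_iff_diff_eq_0)
    qed
    note * = this
    show ?thesis
    proof (intro exI[of _ "ball a e"] conjI ballI impI)
      show "\<gamma> y = \<delta> y" if "x \<in> ball a e" "y \<in> ball a e" "\<gamma> x = \<delta> x" for x y by (rule *[OF that])
    qed (use e(1) in simp_all)
  qed
qed (use assms in auto)

section \<open>Coordinate expressions of a flow and their derivatives\<close>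

lemma flow_domain_open:
  assumes \<Phi>: "is_flow A U X \<Phi>" and "open U" "open S" and c: "(D, c) \<in> A"
  shows "open {(t, x). x \<in> c ` (U \<inter> D) \<and> \<Phi> t (inv_into D c x) \<in> S}"
proof -
  let ?V = "UNIV \<times> c ` (U \<inter> D)"
  have 1: "continuous_on ?V (\<lambda>p. (fst p, inv_into D c (snd p)))"
    by (intro continuous_intros continuous_on_compose2[OF chart_inv_continuous[OF mfd c]]) auto
  have 2: "continuous_on (UNIV \<times> U) (\<lambda>(t, m). \<Phi> t m)"
    using \<Phi> by (simp add: is_flow_def smooth_map_on_def)
  have 3: "(\<lambda>p. (fst p, inv_into D c (snd p))) ` ?V \<subseteq> UNIV \<times> U"
    using chart_inv[OF mfd c] by auto
  from continuous_on_compose2[OF 2 1 3]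
  have "continuous_on ?V (\<lambda>p. \<Phi> (fst p) (inv_into D c (snd p)))" by simp
  moreover have "open ?V" by (intro open_Times open_chart_image[OF mfd c \<open>open U\<close>]) auto
  ultimately have "open (?V \<inter> (\<lambda>p. \<Phi> (fst p) (inv_into D c (snd p))) -` S)"
    using \<open>open S\<close> by (rule continuous_open_preimage)
  moreover have "?V \<inter> (\<lambda>p. \<Phi> (fst p) (inv_into D c (snd p))) -` S
      = {(t, x). x \<in> c ` (U \<inter> D) \<and> \<Phi> t (inv_into D c x) \<in> S}" by auto
  ultimately show ?thesis by simp
qed

lemma flow_chart_smooth:
  assumes \<Phi>: "is_flow A U X \<Phi>" and "open U" and c: "(D, c) \<in> A" and c': "(D', c') \<in> A"
  shows "smooth_on (\<lambda>p. c' (\<Phi> (fst p) (inv_into D c (snd p))))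
    {(t, x). x \<in> c ` (U \<inter> D) \<and> \<Phi> t (inv_into D c x) \<in> D'}"
proof -
  let ?\<Omega> = "{(t, x). x \<in> c ` (U \<inter> D) \<and> \<Phi> t (inv_into D c x) \<in> D'}"
  let ?k = "\<lambda>(t::real, m). (t, c m)"
  have inv: "inv_into (UNIV \<times> D) ?k (t, x) = (t, inv_into D c x)" if "x \<in> c ` D" for t x
    using that chart_inv[OF mfd c] by (intro inv_into_f_eq) (auto simp: inj_on_def, metis)
  have "(UNIV \<times> D, ?k) \<in> cylinder_atlas A" using c by (force simp: cylinder_atlas_def)
  moreover have "smooth_map_on (cylinder_atlas A) A (UNIV \<times> U) (\<lambda>(t, m). \<Phi> t m)"
    using \<Phi> by (simp add: is_flow_def)
  ultimately have "smooth_on (c' \<circ> (\<lambda>(t, m). \<Phi> t m) \<circ> inv_into (UNIV \<times> D) ?k)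
      (?k ` (UNIV \<times> U \<inter> UNIV \<times> D \<inter> (\<lambda>(t, m). \<Phi> t m) -` D'))"
    using c' unfolding smooth_map_on_def by fast
  moreover have "?k ` (UNIV \<times> U \<inter> UNIV \<times> D \<inter> (\<lambda>(t, m). \<Phi> t m) -` D') = ?\<Omega>"
    using chart_inv[OF mfd c] by (auto simp: image_iff)
  ultimately have "smooth_on (c' \<circ> (\<lambda>(t, m). \<Phi> t m) \<circ> inv_into (UNIV \<times> D) ?k) ?\<Omega>" by simp
  then show ?thesis
    by (rule smooth_on_cong[OF flow_domain_open[OF \<Phi> \<open>open U\<close> chart_homeomorphism(1)[OF mfd c'] c], rotated])
       (auto simp: inv)
qed

lemma flow_fun_smooth:
  assumes \<Phi>: "is_flow A U X \<Phi>" and "open U" and c: "(D, c) \<in> A"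
    and g: "smooth_fun_on A S g" "open S"
  shows "smooth_on (\<lambda>p. g (\<Phi> (fst p) (inv_into D c (snd p))))
    {(t, x). x \<in> c ` (U \<inter> D) \<and> \<Phi> t (inv_into D c x) \<in> S}"
proof (rule smooth_on_local[OF flow_domain_open[OF \<Phi> \<open>open U\<close> g(2) c]])
  fix p assume p: "p \<in> {(t, x). x \<in> c ` (U \<inter> D) \<and> \<Phi> t (inv_into D c x) \<in> S}"
  define q where "q = \<Phi> (fst p) (inv_into D c (snd p))"
  let ?D' = "chart_dom A q" and ?c' = "coord A q"
  note ch = chart_at_in_atlas[OF mfd, of q] chart_at_mem[OF mfd, of q]
  note o' = chart_homeomorphism(1)[OF mfd ch(1)]
  let ?T = "{(t, x). x \<in> c ` (U \<inter> D) \<and> \<Phi> t (inv_into D c x) \<in> S \<inter> ?D'}"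
  have T: "open ?T" by (rule flow_domain_open[OF \<Phi> \<open>open U\<close> open_Int[OF g(2) o'] c])
  have s: "smooth_on (\<lambda>p. ?c' (\<Phi> (fst p) (inv_into D c (snd p)))) ?T"
    by (rule smooth_on_subset[OF flow_chart_smooth[OF \<Phi> \<open>open U\<close> c ch(1)]]) auto
  have "smooth_on (\<lambda>p. g (inv_into ?D' ?c' (?c' (\<Phi> (fst p) (inv_into D c (snd p)))))) ?T"
    by (rule smooth_on_compose[OF T open_chart_image[OF mfd ch(1) g(2)] _ s smooth_fun_on_chart[OF mfd g(1) ch(1)]])
       auto
  then have "smooth_on (\<lambda>p. g (\<Phi> (fst p) (inv_into D c (snd p)))) ?T"
    by (rule smooth_on_cong[OF T, rotated]) (auto simp: chart_inv[OF mfd ch(1)])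
  moreover have "p \<in> ?T" using p ch by (auto simp: q_def)
  ultimately show "\<exists>T. open T \<and> p \<in> T \<and> smooth_on (\<lambda>p. g (\<Phi> (fst p) (inv_into D c (snd p)))) T"
    using T by blast
qed

lemma flow_in_domain: "is_flow A U X \<Phi> \<Longrightarrow> m \<in> U \<Longrightarrow> \<Phi> t m \<in> U"
  and flow_integral_curve: "is_flow A U X \<Phi> \<Longrightarrow> m \<in> U \<Longrightarrow> integral_curve A U X (\<lambda>t. \<Phi> t m)"
  and flow_zero: "is_flow A U X \<Phi> \<Longrightarrow> m \<in> U \<Longrightarrow> \<Phi> 0 m = m"
  unfolding is_flow_def integral_curve_def by blast+

lemma frechet_derivative_curve_eq:
  assumes "(\<gamma> has_vector_derivative v) (at t)" "f differentiable at (\<gamma> t)"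
    and "((\<lambda>s. f (\<gamma> s)) has_vector_derivative w) (at t)"
  shows "frechet_derivative f (at (\<gamma> t)) v = w"
  using has_vector_derivative_compose[OF assms(1) assms(2)[unfolded frechet_derivative_works]] assms(3)
  by (rule vector_derivative_unique_at)

lemma flow_time_derivative:
  assumes \<Phi>: "is_flow A U X \<Phi>" and "open U" and c: "(D, c) \<in> A"
    and g: "smooth_fun_on A S g" "open S" and x: "x \<in> c ` (U \<inter> D)" "\<Phi> t (inv_into D c x) \<in> S"
  shows "frechet_derivative (\<lambda>p. g (\<Phi> (fst p) (inv_into D c (snd p)))) (at (t, x)) (1, 0)
    = differential A g (\<Phi> t (inv_into D c x)) (X (\<Phi> t (inv_into D c x)))"
proof -
  let ?q = "inv_into D c x"
  have q: "?q \<in> U" using x chart_inv[OF mfd c] by auto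
  have 1: "((\<lambda>s. (s, x)) has_vector_derivative (1, 0)) (at t)"
    by (auto intro!: derivative_eq_intros simp: has_vector_derivative_def)
  have 2: "(\<lambda>p. g (\<Phi> (fst p) (inv_into D c (snd p)))) differentiable at (t, x)"
    by (rule smooth_on_differentiable[OF flow_domain_open[OF \<Phi> \<open>open U\<close> g(2) c] flow_fun_smooth[OF \<Phi> \<open>open U\<close> c g]])
       (use x in simp)
  show ?thesis
    using frechet_derivative_curve_eq[OF 1 2] integral_curve_along[OF flow_integral_curve[OF \<Phi> q]
        smooth_fun_on_differentiable_mfd[OF mfd g x(2)]] by simp
qed

text \<open>The tangent map of the time \<open>t\<close> map appears in the directions
  \<open>(0, w)\<close>, the generating field in the direction \<open>(1, 0)\<close>. Both are
  partial derivatives of one smooth function of time and space, so their mixed derivatives may be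
  interchanged.\<close>

lemma flow_space_derivative:
  assumes \<Phi>: "is_flow A U X \<Phi>" and "open U" and c: "(D, c) \<in> A"
    and g: "smooth_fun_on A S g" "open S" and q: "q \<in> U" "q \<in> D" "\<Phi> t q \<in> S"
  shows "frechet_derivative (\<lambda>p. g (\<Phi> (fst p) (inv_into D c (snd p)))) (at (t, c q)) (0, differential A c q v)
    = differential A g (\<Phi> t q) (tangent_map A A (\<Phi> t) q v)"
proof -
  have slice: "((\<lambda>x. h (\<Phi> t (inv_into D c x))) has_derivative
      (\<lambda>w. frechet_derivative (\<lambda>p. h (\<Phi> (fst p) (inv_into D c (snd p)))) (at (t, c q)) (0, w))) (at (c q))"
    if h: "smooth_fun_on A S' h" "open S'" "\<Phi> t q \<in> S'" for h :: "'m \<Rightarrow> 'x::real_normed_vector" and S'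
  proof -
    have 1: "((\<lambda>x. (t, x)) has_derivative (\<lambda>w. (0, w))) (at (c q))"
      by (auto intro!: derivative_eq_intros)
    have "((\<lambda>p. h (\<Phi> (fst p) (inv_into D c (snd p)))) has_derivative
       frechet_derivative (\<lambda>p. h (\<Phi> (fst p) (inv_into D c (snd p)))) (at (t, c q))) (at (t, c q))"
      by (rule smooth_on_has_derivative[OF flow_domain_open[OF \<Phi> \<open>open U\<close> h(2) c] flow_fun_smooth[OF \<Phi> \<open>open U\<close> c h(1,2)]])
         (use q h chart_inv[OF mfd c] in auto)
    from has_derivative_compose[OF 1 this] show ?thesis by simp
  qed
  note ch = chart_at_in_atlas[OF mfd, of "\<Phi> t q"] chart_at_mem[OF mfd, of "\<Phi> t q"]
  note o' = chart_homeomorphism(1)[OF mfd ch(1)]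
  have d: "differentiable_mfd A (\<lambda>m. coord A (\<Phi> t q) (\<Phi> t m)) q"
    by (rule differential_chart(1)[OF mfd slice[OF smooth_fun_on_chart_map[OF mfd ch(1) o' order_refl] o' ch(2)] c q(2)])
  have "continuous_on U (\<Phi> t)"
  proof -
    have "continuous_on (UNIV \<times> U) (\<lambda>(t, m). \<Phi> t m)"
      using \<Phi> by (simp add: is_flow_def smooth_map_on_def)
    moreover have "continuous_on U (\<lambda>m. (t, m))"
      by (intro continuous_on_Pair continuous_on_const continuous_on_id)
    ultimately have "continuous_on U (\<lambda>m. (\<lambda>(t, m). \<Phi> t m) (t, m))"
      by (rule continuous_on_compose2) auto
    then show ?thesis by simp
  qed
  then have W: "open (U \<inter> \<Phi> t -` chart_dom A (\<Phi> t q))" "q \<in> U \<inter> \<Phi> t -` chart_dom A (\<Phi> t q)"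
    using \<open>open U\<close> o' q ch by (auto intro: continuous_open_preimage)
  have s: "\<Phi> t ` (U \<inter> \<Phi> t -` chart_dom A (\<Phi> t q)) \<subseteq> chart_dom A (\<Phi> t q)" by auto
  have "differential A (\<lambda>m. g (\<Phi> t m)) q v
      = differential A g (\<Phi> t q) (tangent_map A A (\<Phi> t) q v)"
    by (rule differential_compose_map(2)[OF mfd mfd W s d
          smooth_fun_on_differentiable_mfd[OF mfd g q(3)]])
  then show ?thesis
    unfolding differential_chart(2)[OF mfd slice[OF g q(3)] c q(2)] by simp
qed


text \<open>In a chart, the difference between the transported vector and \<open>Z\<close> solves
  the linear equation \<open>z' = DX z\<close> along the orbit: for the transported vector by
  interchanging time and space derivatives, for \<open>Z\<close> because \<open>DZ X = DX Z\<close>.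
  It is zero at time 0 and therefore always.\<close>

lemma flow_preserves_commuting_field:
  assumes \<Phi>: "is_flow A U X \<Phi>" and "open U"
    and X: "smooth_vector_field A U X" and Z: "smooth_vector_field A U Z"
    and comm: "\<And>D c x. (D, c) \<in> A \<Longrightarrow> x \<in> c ` (U \<inter> D) \<Longrightarrow>
      frechet_derivative (field_in_chart A D c Z) (at x) (field_in_chart A D c X x)
      = frechet_derivative (field_in_chart A D c X) (at x) (field_in_chart A D c Z x)"
    and m: "m \<in> U"
  shows "tangent_map A A (\<Phi> t) m (Z m) = Z (\<Phi> t m)"
proof (rule connected_induction_real[of "\<lambda>t. tangent_map A A (\<Phi> t) m (Z m) = Z (\<Phi> t m)" 0])
  have "tangent_map A A (\<Phi> 0) m = differential A (coord A m) m"
    unfolding tangent_map_def flow_zero[OF \<Phi> m]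
    by (rule differential_cong[OF mfd \<open>open U\<close> m]) (simp add: flow_zero[OF \<Phi>])
  then show "tangent_map A A (\<Phi> 0) m (Z m) = Z (\<Phi> 0 m)"
    by (simp add: flow_zero[OF \<Phi> m] differential_coord[OF mfd])
next
  fix a :: real
  define p where "p = \<Phi> a m"
  let ?D = "chart_dom A m" and ?c = "coord A m"
  let ?D' = "chart_dom A p" and ?c' = "coord A p"
  note ch = chart_at_in_atlas[OF mfd, of m] chart_at_mem[OF mfd, of m]
  note ch' = chart_at_in_atlas[OF mfd, of p] chart_at_mem[OF mfd, of p]
  note o' = chart_homeomorphism(1)[OF mfd ch'(1)]
  note c's = smooth_fun_on_chart_map[OF mfd ch'(1) o' order_refl]
  let ?\<Omega> = "{(t, x). x \<in> ?c ` (U \<inter> ?D) \<and> \<Phi> t (inv_into ?D ?c x) \<in> ?D'}"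
  define H where "H = (\<lambda>q. ?c' (\<Phi> (fst q) (inv_into ?D ?c (snd q))))"
  let ?X = "field_in_chart A ?D' ?c' X" and ?Z = "field_in_chart A ?D' ?c' Z"
  let ?S = "?c' ` (U \<inter> ?D')"
  note S = open_chart_image[OF mfd ch'(1) \<open>open U\<close>]
  note sX = smooth_field_in_chart[OF mfd X \<open>open U\<close> ch'(1)] and sZ = smooth_field_in_chart[OF mfd Z \<open>open U\<close> ch'(1)]
  have \<Omega>: "open ?\<Omega>" by (rule flow_domain_open[OF \<Phi> \<open>open U\<close> o' ch(1)])
  have sH: "smooth_on H ?\<Omega>" unfolding H_def by (rule flow_fun_smooth[OF \<Phi> \<open>open U\<close> ch(1) c's o'])
  have HS: "H q \<in> ?S" if "q \<in> ?\<Omega>" for q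
    using that flow_in_domain[OF \<Phi>] chart_inv[OF mfd ch(1)] by (auto simp: H_def)
  have timeD: "frechet_derivative H (at q) (1, 0) = ?X (H q)" if q: "q \<in> ?\<Omega>" for q
  proof -
    obtain t x where tx: "q = (t, x)" "x \<in> ?c ` (U \<inter> ?D)" "\<Phi> t (inv_into ?D ?c x) \<in> ?D'" using q by auto
    show ?thesis
      unfolding tx(1) H_def flow_time_derivative[OF \<Phi> \<open>open U\<close> ch(1) c's o' tx(2,3)]
      using tx by (simp add: field_in_chart_at[OF mfd ch'(1)])
  qed
  let ?x = "?c m" and ?z = "differential A ?c m (Z m)"
  have in\<Omega>: "(t, ?x) \<in> ?\<Omega>" if "\<Phi> t m \<in> ?D'" for t
    using that m ch chart_inv[OF mfd ch] by auto
  have Ht: "H (t, ?x) = ?c' (\<Phi> t m)" for t using chart_inv[OF mfd ch] by (simp add: H_def)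
  have spaceD: "frechet_derivative H (at (t, ?x)) (0, ?z)
      = differential A ?c' (\<Phi> t m) (tangent_map A A (\<Phi> t) m (Z m))" if "\<Phi> t m \<in> ?D'" for t
    unfolding H_def by (rule flow_space_derivative[OF \<Phi> \<open>open U\<close> ch(1) c's o' m ch(2) that])
  have "?c' p \<in> ?S" using ch' flow_in_domain[OF \<Phi> m] by (auto simp: p_def)
  from smooth_on_local_bound[OF S sX this]
  obtain d L where d: "d > 0" and bnd: "\<And>y v. y \<in> ball (?c' p) d
      \<Longrightarrow> norm (frechet_derivative ?X (at y) v) \<le> L * norm v" by metis
  let ?O = "?D' \<inter> ?c' -` ball (?c' p) d"
  have O: "open ?O" by (rule open_chart_preimage[OF mfd ch'(1) open_ball])
  have "continuous_on UNIV (\<lambda>t. \<Phi> t m)"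
    using flow_integral_curve[OF \<Phi> m] by (simp add: integral_curve_def)
  from open_vimage[OF O this] have "open ((\<lambda>t. \<Phi> t m) -` ?O)" .
  moreover have "a \<in> (\<lambda>t. \<Phi> t m) -` ?O" using ch' d by (simp add: p_def)
  ultimately obtain e where e: "e > 0" "ball a e \<subseteq> (\<lambda>t. \<Phi> t m) -` ?O"
    using open_contains_ball by blast
  \<comment> \<open>The chart has injective differentials, so the property at time \<open>t\<close>
    is the vanishing of a vector in the model space, to which a differential inequality can be
    applied.\<close>
  have iff: "tangent_map A A (\<Phi> t) m (Z m) = Z (\<Phi> t m) \<longleftrightarrow>
      frechet_derivative H (at (t, ?x)) (0, ?z) - ?Z (H (t, ?x)) = 0" if "t \<in> ball a e" for t
  proof -
    have t: "\<Phi> t m \<in> ?D'" using that e by auto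
    show ?thesis
      unfolding spaceD[OF t] Ht field_in_chart_at[OF mfd ch'(1) t]
      by (simp add: inj_eq[OF differential_chart_inj[OF mfd ch'(1) t]])
  qed
  show "\<exists>T. open T \<and> a \<in> T \<and> (\<forall>x\<in>T. \<forall>y\<in>T. tangent_map A A (\<Phi> x) m (Z m) = Z (\<Phi> x m) \<longrightarrow>
      tangent_map A A (\<Phi> y) m (Z m) = Z (\<Phi> y m))"
  proof (intro exI[of _ "ball a e"] conjI ballI impI)
    fix s t assume s: "s \<in> ball a e" and t: "t \<in> ball a e"
      and eq: "tangent_map A A (\<Phi> s) m (Z m) = Z (\<Phi> s m)"
    have sub: "{min s t..max s t} \<subseteq> ball a e" using s t by (auto simp: dist_real_def)
    have "frechet_derivative H (at (t, ?x)) (0, ?z) - ?Z (H (t, ?x)) = 0"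
    proof (rule gronwall_zero_two_sided[where a = s and K = L and
          z = "\<lambda>t. frechet_derivative H (at (t, ?x)) (0, ?z) - ?Z (H (t, ?x))" and
          z' = "\<lambda>t. frechet_derivative ?X (at (H (t, ?x)))
            (frechet_derivative H (at (t, ?x)) (0, ?z) - ?Z (H (t, ?x)))"])
      fix r assume "r \<in> {min s t..max s t}"
      then have "r \<in> (\<lambda>t. \<Phi> t m) -` ?O" using sub e(2) by blast
      then have r: "\<Phi> r m \<in> ?O" by simp
      let ?q = "(r, ?x)"
      note q = in\<Omega>[of r] and HS' = HS[OF in\<Omega>[of r]]
      have rD: "\<Phi> r m \<in> ?D'" using r by simp
      have line: "((\<lambda>s. (s, ?x)) has_vector_derivative (1, 0)) (at r)"
        by (auto intro!: derivative_eq_intros simp: has_vector_derivative_def)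
      have 1: "((\<lambda>t. frechet_derivative H (at (t, ?x)) (0, ?z)) has_vector_derivative
          frechet_derivative (\<lambda>q. frechet_derivative H (at q) (0, ?z)) (at ?q) (1, 0)) (at r)"
        by (rule has_vector_derivative_compose[OF line smooth_on_has_derivative[OF \<Omega>
                smooth_on_frechet_derivative[OF \<Omega> sH] q[OF rD]]])
      have "frechet_derivative (\<lambda>q. frechet_derivative H (at q) (0, ?z)) (at ?q) (1, 0)
          = frechet_derivative (\<lambda>q. frechet_derivative H (at q) (1, 0)) (at ?q) (0, ?z)"
        by (rule frechet_derivative_symmetric[OF \<Omega> sH q[OF rD]])
      also have "frechet_derivative (\<lambda>q. frechet_derivative H (at q) (1, 0)) (at ?q)
          = frechet_derivative (\<lambda>q. ?X (H q)) (at ?q)"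
        by (rule frechet_derivative_cong[OF \<Omega> q[OF rD] timeD])
      also have "\<dots> = (\<lambda>v. frechet_derivative ?X (at (H ?q)) (frechet_derivative H (at ?q) v))"
        by (rule frechet_derivative_compose_at[OF smooth_on_differentiable[OF S sX HS'[OF rD]]
              smooth_on_differentiable[OF \<Omega> sH q[OF rD]]])
      finally have A: "frechet_derivative (\<lambda>q. frechet_derivative H (at q) (0, ?z)) (at ?q) (1, 0)
          = frechet_derivative ?X (at (H ?q)) (frechet_derivative H (at ?q) (0, ?z))" .
      have "((\<lambda>t. H (t, ?x)) has_vector_derivative frechet_derivative H (at ?q) (1, 0)) (at r)"
        by (rule has_vector_derivative_compose[OF line smooth_on_has_derivative[OF \<Omega> sH q[OF rD]]])
      from has_vector_derivative_compose[OF this smooth_on_has_derivative[OF S sZ HS'[OF rD]]]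
      have 2: "((\<lambda>t. ?Z (H (t, ?x))) has_vector_derivative
          frechet_derivative ?X (at (H ?q)) (?Z (H ?q))) (at r)"
        unfolding timeD[OF q[OF rD]] comm[OF ch'(1) HS'[OF rD]] .
      have lin: "linear (frechet_derivative ?X (at (H ?q)))"
        by (rule linear_frechet_derivative[OF smooth_on_differentiable[OF S sX HS'[OF rD]]])
      show "((\<lambda>t. frechet_derivative H (at (t, ?x)) (0, ?z) - ?Z (H (t, ?x))) has_vector_derivative
          frechet_derivative ?X (at (H ?q)) (frechet_derivative H (at ?q) (0, ?z) - ?Z (H ?q))) (at r)"
        unfolding linear_diff[OF lin] using has_vector_derivative_diff[OF 1 2] unfolding A .
      show "norm (frechet_derivative ?X (at (H ?q)) (frechet_derivative H (at ?q) (0, ?z) - ?Z (H ?q)))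
          \<le> L * norm (frechet_derivative H (at ?q) (0, ?z) - ?Z (H ?q))"
        by (rule bnd) (use r in \<open>simp add: Ht\<close>)
    qed (use eq iff[OF s] in simp)
    then show "tangent_map A A (\<Phi> t) m (Z m) = Z (\<Phi> t m)" using iff[OF t] by simp
  qed (use e(1) in simp_all)
qed

text \<open>By the chain rule at \<open>(k * t, \<sigma> t)\<close>, the time part contributes
  \<open>k\<close> times \<open>X\<close>, and the space part is the image of \<open>Y\<close> under
  the flow, which is \<open>Y\<close> again by \<open>push\<close>.\<close>

lemma flow_compose_integral_curve:
  assumes \<Phi>: "is_flow A U X \<Phi>" and "open U" and \<sigma>: "integral_curve A U Y \<sigma>"
    and push: "\<And>t m. m \<in> U \<Longrightarrow> tangent_map A A (\<Phi> t) m (Y m) = Y (\<Phi> t m)"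
  shows "integral_curve A U (\<lambda>m. k *\<^sub>R X m + Y m) (\<lambda>t. \<Phi> (k * t) (\<sigma> t))"
proof (rule integral_curveI)
  have \<sigma>U: "\<sigma> t \<in> U" for t using \<sigma> by (auto simp: integral_curve_def)
  show "range (\<lambda>t. \<Phi> (k * t) (\<sigma> t)) \<subseteq> U" using flow_in_domain[OF \<Phi> \<sigma>U] by auto
  have "continuous_on (UNIV \<times> U) (\<lambda>(t, m). \<Phi> t m)"
    using \<Phi> by (simp add: is_flow_def smooth_map_on_def)
  moreover have "continuous_on UNIV (\<lambda>t. (k * t, \<sigma> t))"
    using \<sigma> unfolding integral_curve_def
    by (intro continuous_on_Pair continuous_on_mult_left continuous_on_id) simp
  ultimately have "continuous_on UNIV (\<lambda>t. (\<lambda>(t, m). \<Phi> t m) (k * t, \<sigma> t))"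
    by (rule continuous_on_compose2) (use \<sigma>U in auto)
  then show "continuous_on UNIV (\<lambda>t. \<Phi> (k * t) (\<sigma> t))" by simp
  fix t
  let ?p = "\<Phi> (k * t) (\<sigma> t)" and ?q = "\<sigma> t"
  let ?D = "chart_dom A ?q" and ?c = "coord A ?q" and ?D' = "chart_dom A ?p" and ?c' = "coord A ?p"
  note ch = chart_at_in_atlas[OF mfd, of ?q] chart_at_mem[OF mfd, of ?q]
  note ch' = chart_at_in_atlas[OF mfd, of ?p] chart_at_mem[OF mfd, of ?p]
  note o' = chart_homeomorphism(1)[OF mfd ch'(1)]
  note c's = smooth_fun_on_chart_map[OF mfd ch'(1) o' order_refl]
  let ?H = "\<lambda>p. ?c' (\<Phi> (fst p) (inv_into ?D ?c (snd p)))"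
  let ?\<Omega> = "{(t, x). x \<in> ?c ` (U \<inter> ?D) \<and> \<Phi> t (inv_into ?D ?c x) \<in> ?D'}"
  have q: "(k * t, ?c ?q) \<in> ?\<Omega>" using \<sigma>U ch ch' chart_inv[OF mfd ch] by auto
  have dH: "(?H has_derivative frechet_derivative ?H (at (k * t, ?c ?q))) (at (k * t, ?c ?q))"
    by (rule smooth_on_has_derivative[OF flow_domain_open[OF \<Phi> \<open>open U\<close> o' ch(1)]
          flow_fun_smooth[OF \<Phi> \<open>open U\<close> ch(1) c's o'] q])
  have "((\<lambda>s. (k * s, ?c (\<sigma> s))) has_vector_derivative (k, differential A ?c ?q (Y ?q))) (at t)"
    using integral_curve_along[OF \<sigma> chart_map_differentiable[OF mfd ch]]
    by (auto intro!: has_vector_derivative_Pair derivative_eq_intros)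
  from has_vector_derivative_compose[OF this dH]
  have 1: "((\<lambda>s. ?H (k * s, ?c (\<sigma> s))) has_vector_derivative
      frechet_derivative ?H (at (k * t, ?c ?q)) (k, differential A ?c ?q (Y ?q))) (at t)" by simp
  have lin: "linear (frechet_derivative ?H (at (k * t, ?c ?q)))"
    by (rule has_derivative_linear[OF dH])
  have split: "(k, differential A ?c ?q (Y ?q)) = k *\<^sub>R (1, 0) + (0, differential A ?c ?q (Y ?q))" by simp
  have inv: "inv_into ?D ?c (?c ?q) = ?q" by (rule chart_inv[OF mfd ch])
  have "frechet_derivative ?H (at (k * t, ?c ?q)) (1, 0) = differential A ?c' ?p (X ?p)"
    using flow_time_derivative[OF \<Phi> \<open>open U\<close> ch(1) c's o', of "?c ?q" "k * t"] q inv by simp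
  moreover have "frechet_derivative ?H (at (k * t, ?c ?q)) (0, differential A ?c ?q (Y ?q))
      = differential A ?c' ?p (Y ?p)"
    using flow_space_derivative[OF \<Phi> \<open>open U\<close> ch(1) c's o' \<sigma>U ch(2) ch'(2), of "Y ?q"]
    by (simp add: push[OF \<sigma>U])
  ultimately have "frechet_derivative ?H (at (k * t, ?c ?q)) (k, differential A ?c ?q (Y ?q))
      = differential A ?c' ?p (k *\<^sub>R X ?p + Y ?p)"
    unfolding split linear_add[OF lin] linear_scale[OF lin]
    by (simp add: blinfun.add_right blinfun.scaleR_right)
  with 1 have "((\<lambda>s. ?H (k * s, ?c (\<sigma> s))) has_vector_derivative
      differential A ?c' ?p (k *\<^sub>R X ?p + Y ?p)) (at t)" by simp
  then have "((\<lambda>s. ?c' (\<Phi> (k * s) (\<sigma> s))) has_vector_derivative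
      differential A ?c' ?p (k *\<^sub>R X ?p + Y ?p)) (at t)"
  proof (rule has_vector_derivative_transform_within_open)
    show "open (\<sigma> -` ?D)"
      by (rule open_vimage[OF chart_homeomorphism(1)[OF mfd ch(1)]])
         (use \<sigma> in \<open>simp add: integral_curve_def\<close>)
    show "t \<in> \<sigma> -` ?D" using ch by simp
    show "?H (k * s, ?c (\<sigma> s)) = ?c' (\<Phi> (k * s) (\<sigma> s))" if "s \<in> \<sigma> -` ?D" for s
      using that chart_inv[OF mfd ch(1)] by simp
  qed
  then show "\<exists>D c. (D, c) \<in> A \<and> ?p \<in> D \<and> ((\<lambda>s. c (\<Phi> (k * s) (\<sigma> s))) has_vector_derivative
      differential A c ?p (k *\<^sub>R X ?p + Y ?p)) (at t)"
    using ch' by blast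
qed

text \<open>The Lie derivative along \<open>X\<close> of a function constant along an \<open>X\<close>-invariant distribution is again
  constant along it: interchange the time derivative of the flow with the space derivative.\<close>

lemma flow_invariant_first_integral:
  assumes \<Phi>: "is_flow A U X \<Phi>" and "open U" and X: "smooth_vector_field A U X"
    and inv: "\<And>t m. m \<in> U \<Longrightarrow> tangent_map A A (\<Phi> t) m ` G m = G (\<Phi> t m)"
    and g: "smooth_fun_on A S g" "open S" "S \<subseteq> U"
    and zero: "\<And>q v. q \<in> S \<Longrightarrow> v \<in> G q \<Longrightarrow> differential A g q v = 0"
    and m: "m \<in> S" "v \<in> G m"
  shows "differential A (\<lambda>q. differential A (g :: 'm \<Rightarrow> real) q (X q)) m v = 0"
proof -
  let ?D = "chart_dom A m" and ?c = "coord A m"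
  note ch = chart_at_in_atlas[OF mfd, of m] chart_at_mem[OF mfd, of m]
  let ?x = "?c m" and ?v = "differential A ?c m v"
  define K where "K = (\<lambda>p. g (\<Phi> (fst p) (inv_into ?D ?c (snd p))))"
  let ?\<Omega> = "{(t, x). x \<in> ?c ` (U \<inter> ?D) \<and> \<Phi> t (inv_into ?D ?c x) \<in> S}"
  have \<Omega>: "open ?\<Omega>" by (rule flow_domain_open[OF \<Phi> \<open>open U\<close> g(2) ch(1)])
  have sK: "smooth_on K ?\<Omega>" unfolding K_def by (rule flow_fun_smooth[OF \<Phi> \<open>open U\<close> ch(1) g(1,2)])
  have mU: "m \<in> U" using m g by auto
  have x: "(0, ?x) \<in> ?\<Omega>" using ch mU m chart_inv[OF mfd ch] flow_zero[OF \<Phi> mU] by auto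
  let ?T = "(\<lambda>t. \<Phi> t m) -` S"
  have "continuous_on UNIV (\<lambda>t. \<Phi> t m)"
    using flow_integral_curve[OF \<Phi> mU] by (simp add: integral_curve_def)
  from open_vimage[OF g(2) this] have T: "open ?T" "0 \<in> ?T"
    using flow_zero[OF \<Phi> mU] m by simp_all
  have K0: "frechet_derivative K (at (t, ?x)) (0, ?v) = 0" if "t \<in> ?T" for t
  proof -
    have "tangent_map A A (\<Phi> t) m v \<in> G (\<Phi> t m)" using inv[OF mU, of t] m(2) by auto
    then have "differential A g (\<Phi> t m) (tangent_map A A (\<Phi> t) m v) = 0"
      using zero that by simp
    then show ?thesis
      unfolding K_def using flow_space_derivative[OF \<Phi> \<open>open U\<close> ch(1) g(1,2) mU ch(2), of t v] that by simp
  qed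
  have line: "((\<lambda>s. (s, ?x)) has_vector_derivative (1, 0)) (at 0)"
    by (auto intro!: derivative_eq_intros simp: has_vector_derivative_def)
  note sKv = smooth_on_frechet_derivative[OF \<Omega> sK]
  have "((\<lambda>t. frechet_derivative K (at (t, ?x)) (0, ?v)) has_vector_derivative 0) (at 0)"
    by (rule has_vector_derivative_transform_within_open[OF has_vector_derivative_const T]) (simp add: K0)
  from frechet_derivative_curve_eq[OF line smooth_on_differentiable[OF \<Omega> sKv x] this]
  have mixed: "frechet_derivative (\<lambda>p. frechet_derivative K (at p) (1, 0)) (at (0, ?x)) (0, ?v) = 0"
    using frechet_derivative_symmetric[OF \<Omega> sK x, of "(0, ?v)" "(1, 0)"] by simp
  have "((\<lambda>x. (0, x)) has_derivative (\<lambda>w. (0, w))) (at ?x)"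
    by (auto intro!: derivative_eq_intros)
  from has_derivative_compose[OF this smooth_on_has_derivative[OF \<Omega> sKv x]]
  have "((\<lambda>x. frechet_derivative K (at (0, x)) (1, 0)) has_derivative
      (\<lambda>w. frechet_derivative (\<lambda>p. frechet_derivative K (at p) (1, 0)) (at (0, ?x)) (0, w))) (at ?x)" .
  then have "((\<lambda>x. differential A g (inv_into ?D ?c x) (X (inv_into ?D ?c x))) has_derivative
      (\<lambda>w. frechet_derivative (\<lambda>p. frechet_derivative K (at p) (1, 0)) (at (0, ?x)) (0, w))) (at ?x)"
  proof (rule has_derivative_transform_within_open)
    show "open (?c ` (S \<inter> ?D))" by (rule open_chart_image[OF mfd ch(1) g(2)])
    show "?x \<in> ?c ` (S \<inter> ?D)" using m ch by auto
    fix x assume x: "x \<in> ?c ` (S \<inter> ?D)"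
    then have q: "inv_into ?D ?c x \<in> S" "inv_into ?D ?c x \<in> U" "x \<in> ?c ` (U \<inter> ?D)"
      using chart_inv[OF mfd ch(1)] g(3) by auto
    show "frechet_derivative K (at (0, x)) (1, 0) = differential A g (inv_into ?D ?c x) (X (inv_into ?D ?c x))"
      unfolding K_def using flow_time_derivative[OF \<Phi> \<open>open U\<close> ch(1) g(1,2) q(3), of 0] q
      by (simp add: flow_zero[OF \<Phi>])
  qed
  from differential_chart(2)[OF mfd this ch, of v] mixed show ?thesis by simp
qed

text \<open>In a chart of the base the projected curve has derivative zero, so it is locally
  constant in time.\<close>

lemma vertical_curve_in_fiber:
  fixes A' :: "('n::{t2_space, second_countable_topology}, 'f::euclidean_space) atlas"
  assumes mA': "smooth_manifold A'" and \<phi>: "smooth_map_on A A' UNIV \<phi>"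
    and \<gamma>: "integral_curve A U X \<gamma>" and vert: "\<And>m. m \<in> U \<Longrightarrow> X m \<in> vertical A A' \<phi> m"
  shows "\<phi> (\<gamma> t) = \<phi> (\<gamma> 0)"
proof (rule connected_induction_real[of "\<lambda>t. \<phi> (\<gamma> t) = \<phi> (\<gamma> 0)" 0])
  fix a :: real
  let ?D = "chart_dom A' (\<phi> (\<gamma> a))" and ?c = "coord A' (\<phi> (\<gamma> a))"
  note ch = chart_at_in_atlas[OF mA', of "\<phi> (\<gamma> a)"] chart_at_mem[OF mA', of "\<phi> (\<gamma> a)"]
  have cont: "continuous_on UNIV (\<lambda>t. \<phi> (\<gamma> t))"
    using \<phi> \<gamma> unfolding smooth_map_on_def integral_curve_def
    by (auto intro: continuous_on_compose2)
  have "open ((\<lambda>t. \<phi> (\<gamma> t)) -` ?D)"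
    by (rule open_vimage[OF chart_homeomorphism(1)[OF mA' ch(1)] cont])
  then obtain e where e: "e > 0" "ball a e \<subseteq> (\<lambda>t. \<phi> (\<gamma> t)) -` ?D"
    using ch open_contains_ball by blast
  have const: "\<phi> (\<gamma> x) = \<phi> (\<gamma> y)" if xy: "x \<in> ball a e" "y \<in> ball a e" for x y
  proof -
    have D: "((\<lambda>t. ?c (\<phi> (\<gamma> t))) has_vector_derivative 0) (at t within ball a e)"
      if t: "t \<in> ball a e" for t
    proof -
      have tD: "\<phi> (\<gamma> t) \<in> ?D" using e t by auto
      have tU: "\<gamma> t \<in> U" using \<gamma> by (auto simp: integral_curve_def)
      note dc = chart_map_differentiable[OF mA' ch(1) tD]
      note pb = differential_compose_smooth_map[OF mfd mA' \<phi> open_UNIV UNIV_I dc]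
      have "differential A (\<lambda>q. ?c (\<phi> q)) (\<gamma> t) (X (\<gamma> t)) = 0"
        unfolding pb(2) using vert[OF tU] by (simp add: vertical_def)
      with integral_curve_along[OF \<gamma> pb(1)] show ?thesis
        by (simp add: has_vector_derivative_at_within)
    qed
    obtain k where "\<And>t. t \<in> ball a e \<Longrightarrow> ?c (\<phi> (\<gamma> t)) = k"
      using has_vector_derivative_zero_constant[OF convex_ball D] by blast
    then have "?c (\<phi> (\<gamma> x)) = ?c (\<phi> (\<gamma> y))" using xy by simp
    moreover have "\<phi> (\<gamma> x) \<in> ?D" "\<phi> (\<gamma> y) \<in> ?D" using xy e by auto
    ultimately show ?thesis using chart_inv[OF mA' ch(1)] by metis
  qed
  show "\<exists>T. open T \<and> a \<in> T \<and> (\<forall>x\<in>T. \<forall>y\<in>T. \<phi> (\<gamma> x) = \<phi> (\<gamma> 0) \<longrightarrow> \<phi> (\<gamma> y) = \<phi> (\<gamma> 0))"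
  proof (intro exI[of _ "ball a e"] conjI ballI impI)
    show "\<phi> (\<gamma> y) = \<phi> (\<gamma> 0)" if "x \<in> ball a e" "y \<in> ball a e" "\<phi> (\<gamma> x) = \<phi> (\<gamma> 0)" for x y
      using const[OF that(1,2)] that(3) by simp
  qed (use e(1) in simp_all)
qed simp

end

section \<open>Propagation of zeros along the level sets of a submersion\<close>

lemma span_image_lessThan:
  fixes f :: "nat \<Rightarrow> 'a::real_vector"
  assumes "v \<in> span (f ` {..<r})"
  obtains a where "v = (\<Sum>i<r. a i *\<^sub>R f i)"
proof -
  have "\<exists>a. v = (\<Sum>i<r. a i *\<^sub>R f i)"
    using assms
  proof (induction rule: span_induct_alt)
    case base
    show ?case by (rule exI[of _ "\<lambda>_. 0"]) simp
  next
    case (step c x y)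
    then obtain a k where "y = (\<Sum>i<r. a i *\<^sub>R f i)" "k < r" "x = f k" by auto
    then have "c *\<^sub>R x + y = (\<Sum>i<r. (a i + (if i = k then c else 0)) *\<^sub>R f i)"
      by (simp add: scaleR_add_left sum.distrib if_distrib[of "\<lambda>c. c *\<^sub>R _"] sum.delta cong: if_cong)
    then show ?case by (rule exI[of _ "\<lambda>i. a i + (if i = k then c else 0)"])
  qed
  with that show thesis by blast
qed

text \<open>Independence of an indexed family and not of its set of values: a repeated vector counts
  as a relation. Coefficients are indexed by action variables throughout.\<close>

definition lin_indep :: "nat \<Rightarrow> (nat \<Rightarrow> 'a::real_vector) \<Rightarrow> bool" where
  "lin_indep r f \<longleftrightarrow> (\<forall>a. (\<Sum>i<r. a i *\<^sub>R f i) = 0 \<longrightarrow> (\<forall>i<r. a i = 0))"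

lemma lin_indepD: "lin_indep r f \<Longrightarrow> (\<Sum>i<r. a i *\<^sub>R f i) = 0 \<Longrightarrow> i < r \<Longrightarrow> a i = 0"
  by (simp add: lin_indep_def)

lemma lin_indep_independent:
  assumes "lin_indep r f"
  shows "inj_on f {..<r}" "independent (f ` {..<r})"
proof -
  show inj: "inj_on f {..<r}"
  proof (rule inj_onI, rule ccontr)
    fix i j assume ij: "i \<in> {..<r}" "j \<in> {..<r}" "f i = f j" "i \<noteq> j"
    let ?a = "\<lambda>k. (if k = i then 1 else 0) - (if k = j then 1 else 0) :: real"
    have "(\<Sum>k<r. ?a k *\<^sub>R f k) = 0"
      using ij by (simp add: scaleR_diff_left sum_subtractf if_distrib[of "\<lambda>c. c *\<^sub>R _"] sum.delta cong: if_cong)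
    from lin_indepD[OF assms this, of i] ij show False by simp
  qed
  show "independent (f ` {..<r})"
  proof (rule independent_if_scalars_zero)
    fix g x assume "(\<Sum>x\<in>f ` {..<r}. g x *\<^sub>R x) = 0" "x \<in> f ` {..<r}"
    then have "(\<Sum>i<r. g (f i) *\<^sub>R f i) = 0" by (simp add: sum.reindex[OF inj])
    from lin_indepD[OF assms this] \<open>x \<in> f ` {..<r}\<close> show "g x = 0" by auto
  qed simp
qed

lemma lin_indep_if_dim:
  fixes f :: "nat \<Rightarrow> 'a::euclidean_space"
  assumes "dim (span (f ` {..<r})) = r"
  shows "lin_indep r f"
  unfolding lin_indep_def
proof (intro allI impI)
  fix a i assume sum: "(\<Sum>i<r. a i *\<^sub>R f i) = 0" and i: "i < r"
  let ?B = "f ` {..<r}"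
  have "r \<le> card ?B" using dim_le_card'[of ?B] assms by simp
  then have card: "card ?B = r" using card_image_le[of "{..<r}" f] by simp
  then have inj: "inj_on f {..<r}" by (intro eq_card_imp_inj_on) auto
  have indep: "independent ?B"
    by (rule card_le_dim_spanning[OF span_superset order_refl]) (use card assms in auto)
  have "(\<Sum>v\<in>?B. a (inv_into {..<r} f v) *\<^sub>R v) = 0"
    using sum by (simp add: sum.reindex[OF inj] inv_into_f_f[OF inj])
  from independentD[OF indep _ order_refl this, of "f i"] i show "a i = 0"
    by (simp add: inv_into_f_f[OF inj])
qed

lemma lin_indep_dual:
  fixes f :: "nat \<Rightarrow> 'a::euclidean_space"
  assumes "lin_indep r f" "k < r"
  shows "\<exists>\<theta> :: 'a \<Rightarrow> real. bounded_linear \<theta> \<and> (\<forall>i<r. \<theta> (f i) = (if i = k then 1 else 0))"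
proof -
  note ind = lin_indep_independent[OF assms(1)]
  obtain \<theta> where \<theta>: "linear \<theta>" "\<And>x. x \<in> f ` {..<r} \<Longrightarrow> \<theta> x = (if x = f k then 1 else 0 :: real)"
    using linear_independent_extend[OF ind(2), of "\<lambda>x. if x = f k then 1 else 0 :: real"] by auto
  show ?thesis
  proof (intro exI[of _ \<theta>] conjI allI impI)
    show "bounded_linear \<theta>" using \<theta>(1) by (simp add: linear_conv_bounded_linear)
    show "\<theta> (f i) = (if i = k then 1 else 0)" if "i < r" for i
    proof -
      have "f i = f k \<longleftrightarrow> i = k" using inj_on_eq_iff[OF ind(1), of i k] that assms(2) by simp
      then show ?thesis using \<theta>(2)[of "f i"] that by simp
    qed
  qed
qed

text \<open>The functionals \<open>\<theta> k\<close> dual to the frame at \<open>x0\<close> nearly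
  read off coefficients at nearby points: each entry is off by less than \<open>1 / (2 * r)\<close>.
  The \<open>r\<close> errors, each weighted by at most the largest coefficient \<open>M\<close>,
  add up to at most \<open>M / 2\<close> and are absorbed.\<close>

lemma frame_coefficient_bound:
  fixes w :: "nat \<Rightarrow> 'p::metric_space \<Rightarrow> 'a::euclidean_space"
  assumes indep: "lin_indep r (\<lambda>i. w i x0)" and cont: "\<And>i. i < r \<Longrightarrow> isCont (w i) x0"
  obtains C d where "C \<ge> 0" "d > 0"
    "\<And>x a k. dist x x0 < d \<Longrightarrow> k < r \<Longrightarrow> \<bar>a k\<bar> \<le> C * norm (\<Sum>i<r. a i *\<^sub>R w i x)"
proof (cases "r = 0")
  case True
  then show thesis using that[of 0 1] by simp
next
  case False
  have "\<exists>\<theta> K. bounded_linear \<theta> \<and> (\<forall>i<r. \<theta> (w i x0) = (if i = k then 1 else 0 :: real))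
      \<and> 0 < K \<and> (\<forall>v. \<bar>\<theta> v\<bar> \<le> norm v * K)" if k: "k < r" for k
  proof -
    obtain \<theta> where \<theta>: "bounded_linear \<theta>" "\<forall>i<r. \<theta> (w i x0) = (if i = k then 1 else 0 :: real)"
      using lin_indep_dual[OF indep k] by blast
    obtain K where "0 < K" "\<And>v. norm (\<theta> v) \<le> norm v * K"
      using bounded_linear.pos_bounded[OF \<theta>(1)] by blast
    with \<theta> show ?thesis by (intro exI[of _ \<theta>] exI[of _ K]) simp
  qed
  then obtain \<theta> K where \<theta>: "\<And>k. k < r \<Longrightarrow> bounded_linear (\<theta> k)"
    "\<And>k i. k < r \<Longrightarrow> i < r \<Longrightarrow> \<theta> k (w i x0) = (if i = k then 1 else 0 :: real)"
    "\<And>k. k < r \<Longrightarrow> 0 < K k" "\<And>k v. k < r \<Longrightarrow> \<bar>\<theta> k v\<bar> \<le> norm v * K k" by metis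
  have "\<forall>\<^sub>F x in nhds x0. \<forall>i\<in>{..<r}. \<forall>k\<in>{..<r}. \<bar>\<theta> k (w i x) - \<theta> k (w i x0)\<bar> < 1 / (2 * r)"
  proof (intro eventually_ball_finite ballI)
    fix i k assume "i \<in> {..<r}" "k \<in> {..<r}"
    then have "isCont (\<lambda>x. \<theta> k (w i x)) x0"
      using bounded_linear.isCont[OF \<theta>(1)] cont by auto
    from this[unfolded continuous_at_eps_delta, rule_format, of "1 / (2 * r)"] False
    show "\<forall>\<^sub>F x in nhds x0. \<bar>\<theta> k (w i x) - \<theta> k (w i x0)\<bar> < 1 / (2 * r)"
      unfolding eventually_nhds_metric by (simp add: dist_real_def)
  qed auto
  then obtain d where d: "d > 0" "\<And>x i k. dist x x0 < d \<Longrightarrow> i < r \<Longrightarrow> k < r \<Longrightarrow>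
      \<bar>\<theta> k (w i x) - \<theta> k (w i x0)\<bar> < 1 / (2 * r)"
    unfolding eventually_nhds_metric by auto
  \<comment> \<open>The factor 2 pays for absorbing \<open>M / 2\<close>; the sum is a bound that
    does not depend on the index of the largest coefficient.\<close>
  define C where "C = 2 * (\<Sum>k<r. K k)"
  have KC: "K k \<le> C / 2" if "k < r" for k
    unfolding C_def using member_le_sum[of k "{..<r}" K] that less_imp_le[OF \<theta>(3)] by simp
  show thesis
  proof (rule that[of C d])
    show "C \<ge> 0" unfolding C_def using less_imp_le[OF \<theta>(3)] by (intro mult_nonneg_nonneg sum_nonneg) auto
    fix x a k assume x: "dist x x0 < d" and k: "k < r"
    let ?v = "\<Sum>i<r. a i *\<^sub>R w i x"
    define M where "M = Max ((\<lambda>i. \<bar>a i\<bar>) ` {..<r})"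
    have le: "\<bar>a i\<bar> \<le> M" if "i < r" for i unfolding M_def using that by simp
    have "M \<in> (\<lambda>i. \<bar>a i\<bar>) ` {..<r}" unfolding M_def using False by (intro Max_in) auto
    then obtain l where l: "l < r" "\<bar>a l\<bar> = M" by auto
    interpret bounded_linear "\<theta> l" by (rule \<theta>(1)[OF l(1)])
    have "\<theta> l ?v = (\<Sum>i<r. a i * \<theta> l (w i x))" by (simp add: sum scaleR)
    also have "\<dots> = (\<Sum>i<r. a i * (\<theta> l (w i x) - \<theta> l (w i x0))) + (\<Sum>i<r. a i * \<theta> l (w i x0))"
      by (simp add: right_diff_distrib flip: sum.distrib)
    also have "(\<Sum>i<r. a i * \<theta> l (w i x0)) = (\<Sum>i<r. if i = l then a i else 0)"
      by (rule sum.cong) (use \<theta>(2)[OF l(1)] in auto)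
    also have "\<dots> = a l" using l by simp
    finally have "M \<le> \<bar>\<theta> l ?v\<bar> + \<bar>\<Sum>i<r. a i * (\<theta> l (w i x) - \<theta> l (w i x0))\<bar>" using l by linarith
    also have "\<bar>\<Sum>i<r. a i * (\<theta> l (w i x) - \<theta> l (w i x0))\<bar> \<le> (\<Sum>i<r. M * (1 / (2 * r)))"
      by (rule order_trans[OF sum_abs], rule sum_mono, unfold abs_mult, rule mult_mono)
         (use le d(2)[OF x _ l(1)] in \<open>auto intro: less_imp_le order_trans[OF abs_ge_zero]\<close>)
    also have "\<dots> = M / 2" using False by simp
    finally have "M \<le> 2 * \<bar>\<theta> l ?v\<bar>" by simp
    also have "\<dots> \<le> 2 * (norm ?v * K l)" using \<theta>(4)[OF l(1)] by simp
    also have "\<dots> \<le> 2 * (norm ?v * (C / 2))" 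
      by (intro mult_left_mono KC[OF l(1)]) auto
    finally show "\<bar>a k\<bar> \<le> C * norm ?v" using le[OF k] by (simp add: mult.commute)
  qed (rule d(1))
qed

text \<open>Points of the level set near \<open>x0\<close> must be joined inside it by curves of
  bounded speed. Straightening \<open>F\<close> by \<open>\<Psi>\<close> turns the level set into a
  slice of a ball, which contains segments. Along a lifted segment the velocity is a combination of
  the \<open>w i\<close>, and commutation turns the derivative of \<open>u\<close> into an
  expression linear in \<open>u\<close>.\<close>

lemma level_set_zero_propagation:
  fixes F :: "'a::euclidean_space \<Rightarrow> 'b::euclidean_space" and u :: "'a \<Rightarrow> 'a" and w :: "nat \<Rightarrow> 'a \<Rightarrow> 'a"
  assumes S: "open S" "x0 \<in> S" and F: "smooth_on F S" and u: "smooth_on u S"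
    and w: "\<And>i. i < r \<Longrightarrow> smooth_on (w i) S"
    and surj: "surj (frechet_derivative F (at x0))" and indep: "lin_indep r (\<lambda>i. w i x0)"
    and comm: "\<And>i x. i < r \<Longrightarrow> x \<in> S \<Longrightarrow>
      frechet_derivative u (at x) (w i x) = frechet_derivative (w i) (at x) (u x)"
    and ker: "\<And>x v. x \<in> S \<Longrightarrow> F x = F x0 \<Longrightarrow> frechet_derivative F (at x) v = 0 \<Longrightarrow>
      v \<in> span ((\<lambda>i. w i x) ` {..<r})"
  obtains N where "open N" "x0 \<in> N" "N \<subseteq> S"
    "\<And>x y. x \<in> N \<Longrightarrow> y \<in> N \<Longrightarrow> F x = F x0 \<Longrightarrow> F y = F x0 \<Longrightarrow> u x = 0 \<Longrightarrow> u y = 0"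
proof -
  define D where "D = frechet_derivative F (at x0)"
  have linD: "linear D"
    unfolding D_def by (rule linear_frechet_derivative[OF smooth_on_differentiable[OF S(1) F S(2)]])
  obtain R where R: "linear R" "D \<circ> R = id"
    using linear_surjective_right_inverse[OF linD] surj unfolding D_def by auto
  have DR: "D (R z) = z" for z using R(2) by (simp add: fun_eq_iff)
  have bR: "bounded_linear R" and bD: "bounded_linear D"
    using R(1) linD by (simp_all add: linear_conv_bounded_linear)
  \<comment> \<open>\<open>R\<close> is a right inverse of the derivative \<open>D\<close> of
    \<open>F\<close> at \<open>x0\<close>. With this correction of the identity,
    \<open>D (\<Psi> x) = F x\<close> holds for every \<open>x\<close>, and the derivative of
    \<open>\<Psi>\<close> at \<open>x0\<close> is the identity, as the inverse function theorem
    asks.\<close>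
  define \<Psi> where "\<Psi> x = R (F x) + (x - R (D x))" for x
  define \<Psi>' where "\<Psi>' x = Blinfun (\<lambda>v. R (frechet_derivative F (at x) v) + (v - R (D v)))" for x
  have D\<Psi>: "D (\<Psi> x) = F x" for x
    by (simp add: \<Psi>_def linear_add[OF linD] linear_diff[OF linD] DR)
  have dF: "(F has_derivative frechet_derivative F (at x)) (at x)" if "x \<in> S" for x
    by (rule smooth_on_has_derivative[OF S(1) F that])
  have d\<Psi>: "(\<Psi> has_derivative (\<lambda>v. R (frechet_derivative F (at x) v) + (v - R (D v)))) (at x)"
    if "x \<in> S" for x
    unfolding \<Psi>_def[abs_def]
    by (intro has_derivative_add has_derivative_diff has_derivative_ident
        bounded_linear.has_derivative[OF bR] bounded_linear.has_derivative[OF bD] dF that)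
  have \<Psi>'_apply: "blinfun_apply (\<Psi>' x) = (\<lambda>v. R (frechet_derivative F (at x) v) + (v - R (D v)))"
    if "x \<in> S" for x
    unfolding \<Psi>'_def by (rule bounded_linear_Blinfun_apply[OF has_derivative_bounded_linear[OF d\<Psi>[OF that]]])
  have der: "(\<Psi> has_derivative blinfun_apply (\<Psi>' x)) (at x)" if "x \<in> S" for x
    using d\<Psi>[OF that] \<Psi>'_apply[OF that] by simp
  have cont\<Psi>': "continuous_on S \<Psi>'"
  proof (rule continuous_on_blinfun_componentwise)
    fix i :: 'a
    have "continuous_on S (\<lambda>x. R (frechet_derivative F (at x) i) + (i - R (D i)))"
      by (intro continuous_intros bounded_linear.continuous_on[OF bR]
          smooth_on_continuous[OF smooth_on_frechet_derivative] S F)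
    then show "continuous_on S (\<lambda>x. blinfun_apply (\<Psi>' x) i)"
      by (rule continuous_on_eq) (simp add: \<Psi>'_apply)
  qed
  have id0: "id_blinfun o\<^sub>L \<Psi>' x0 = id_blinfun"
    by (rule blinfun_eqI) (use DR in \<open>simp add: \<Psi>'_apply[OF S(2)] D_def\<close>)
  obtain U' V \<psi> \<psi>' where U': "open U'" "U' \<subseteq> S" "x0 \<in> U'" and V: "open V" "\<Psi> x0 \<in> V"
    and hom: "homeomorphism U' V \<Psi> \<psi>" and d\<psi>: "\<And>y. y \<in> V \<Longrightarrow> (\<psi> has_derivative \<psi>' y) (at y)"
    using inverse_function_theorem[OF S(1) der cont\<Psi>' S(2) id0] by metis
  obtain C d1 where C: "C \<ge> 0" "d1 > 0" "\<And>x a k. dist x x0 < d1 \<Longrightarrow> k < r \<Longrightarrow>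
      \<bar>a k\<bar> \<le> C * norm (\<Sum>i<r. a i *\<^sub>R w i x)"
  proof (rule frame_coefficient_bound[of r w x0, OF indep])
    show "isCont (w i) x0" if "i < r" for i
      using smooth_on_continuous[OF w[OF that]] S by (simp add: continuous_on_eq_continuous_at)
  qed (rule that)
  have "\<exists>d B. d > 0 \<and> B \<ge> 0 \<and> (\<forall>x\<in>ball x0 d. \<forall>v. norm (frechet_derivative (w i) (at x) v) \<le> B * norm v)"
    if "i < r" for i
    by (rule smooth_on_local_bound[OF S(1) w[OF that] S(2)]) blast
  then obtain dw B where dw: "\<And>i. i < r \<Longrightarrow> dw i > 0" and B: "\<And>i. i < r \<Longrightarrow> B i \<ge> (0::real)"
    "\<And>i x v. i < r \<Longrightarrow> x \<in> ball x0 (dw i) \<Longrightarrow> norm (frechet_derivative (w i) (at x) v) \<le> B i * norm v"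
    by metis
  obtain d2 where d2: "d2 > 0" "\<And>x. dist x x0 < d2 \<Longrightarrow> x \<in> S \<Longrightarrow> norm (\<Psi>' x - \<Psi>' x0) < 1 / 2"
    using cont\<Psi>'[unfolded continuous_on_iff, rule_format, OF S(2), of "1/2"] by (auto simp: dist_norm)
  obtain d3 where d3: "d3 > 0" "\<And>i. i < r \<Longrightarrow> d3 \<le> dw i"
  proof -
    have "finite (insert 1 (dw ` {..<r}))" by simp
    then show thesis
      using that[of "Min (insert 1 (dw ` {..<r}))"] dw by auto
  qed
  define d where "d = min d1 (min d2 d3)"
  have d: "d > 0" using C d2 d3 by (simp add: d_def)
  have cont\<psi>: "continuous_on V \<psi>" using hom by (simp add: homeomorphism_def)
  have "open (V \<inter> \<psi> -` ball x0 d)" by (rule continuous_open_preimage[OF cont\<psi> V(1) open_ball])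
  moreover have "\<psi> (\<Psi> x0) = x0" using hom U' by (simp add: homeomorphism_def)
  then have "\<Psi> x0 \<in> V \<inter> \<psi> -` ball x0 d" using V d by simp
  ultimately obtain \<rho> where \<rho>: "\<rho> > 0" "ball (\<Psi> x0) \<rho> \<subseteq> V \<inter> \<psi> -` ball x0 d"
    using open_contains_ball by blast
  let ?N = "U' \<inter> \<Psi> -` ball (\<Psi> x0) \<rho>"
  show thesis
  proof (rule that[of ?N])
    have "continuous_on U' \<Psi>" using hom by (simp add: homeomorphism_def)
    then show "open ?N" by (rule continuous_open_preimage[OF _ U'(1) open_ball])
    show "x0 \<in> ?N" using U' \<rho> by simp
    show "?N \<subseteq> S" using U' by auto
    fix x y assume x: "x \<in> ?N" and y: "y \<in> ?N" and Fxy: "F x = F x0" "F y = F x0" and u0: "u x = 0"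
    define h where "h = \<Psi> y - \<Psi> x"
    define \<sigma> where "\<sigma> s = \<psi> (\<Psi> x + s *\<^sub>R h)" for s :: real
    have inball: "\<Psi> x + s *\<^sub>R h \<in> ball (\<Psi> x0) \<rho>" if "s \<in> {0..1}" for s
    proof -
      have "(1 - s) *\<^sub>R \<Psi> x + s *\<^sub>R \<Psi> y \<in> ball (\<Psi> x0) \<rho>"
        by (rule convexD_alt[OF convex_ball]) (use x y that in auto)
      then show ?thesis by (simp add: h_def algebra_simps)
    qed
    have \<sigma>\<Psi>: "\<Psi> (\<sigma> s) = \<Psi> x + s *\<^sub>R h" "\<sigma> s \<in> U'" "\<sigma> s \<in> S" "dist (\<sigma> s) x0 < d" if "s \<in> {0..1}" for s
    proof -
      have v: "\<Psi> x + s *\<^sub>R h \<in> V" "\<sigma> s \<in> ball x0 d" using inball[OF that] \<rho> by (auto simp: \<sigma>_def)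
      show "\<Psi> (\<sigma> s) = \<Psi> x + s *\<^sub>R h" unfolding \<sigma>_def using hom v by (simp add: homeomorphism_def)
      show "\<sigma> s \<in> U'" unfolding \<sigma>_def using hom v by (auto simp: homeomorphism_def)
      then show "\<sigma> s \<in> S" using U' by auto
      show "dist (\<sigma> s) x0 < d" using v by (simp add: dist_commute)
    qed
    \<comment> \<open>Since \<open>F\<close> has the same value at both ends,
      \<open>D h = 0\<close>; so \<open>D\<close>, and with it \<open>F\<close> along the lifted
      curve, is constant on the segment.\<close>
    have F\<sigma>: "F (\<sigma> s) = F x0" if "s \<in> {0..1}" for s
      using D\<Psi>[of "\<sigma> s"] D\<Psi>[of x] D\<Psi>[of y] Fxy
      by (simp add: \<sigma>\<Psi>[OF that] h_def linear_add[OF linD] linear_diff[OF linD] linear_scale[OF linD])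
    define k where "k s = \<psi>' (\<Psi> x + s *\<^sub>R h) h" for s
    have d\<sigma>: "(\<sigma> has_vector_derivative k s) (at s)" if "s \<in> {0..1}" for s
    proof -
      have 1: "((\<lambda>s. \<Psi> x + s *\<^sub>R h) has_vector_derivative h) (at s)"
        by (auto intro!: derivative_eq_intros)
      have "\<Psi> x + s *\<^sub>R h \<in> V" using inball[OF that] \<rho> by auto
      from has_vector_derivative_compose[OF 1 d\<psi>[OF this]] show ?thesis
        by (simp add: \<sigma>_def[abs_def] k_def)
    qed
    \<comment> \<open>Of \<open>\<psi>'\<close> only its being a derivative of \<open>\<psi>\<close>
      was kept. The velocity is identified by differentiating \<open>\<Psi> (\<sigma> s)\<close>,
      which runs along a straight segment.\<close>
    have \<Psi>k: "blinfun_apply (\<Psi>' (\<sigma> s)) (k s) = h" if s: "s \<in> {0..1}" for s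
    proof -
      have 1: "((\<lambda>s. \<Psi> (\<sigma> s)) has_vector_derivative blinfun_apply (\<Psi>' (\<sigma> s)) (k s)) (at s)"
        by (rule has_vector_derivative_compose[OF d\<sigma>[OF s] der[OF \<sigma>\<Psi>(3)[OF s]]])
      have 2: "((\<lambda>s. \<Psi> x + s *\<^sub>R h) has_vector_derivative h) (at s)"
        by (auto intro!: derivative_eq_intros)
      have o: "open ((\<lambda>s. \<Psi> x + s *\<^sub>R h) -` ball (\<Psi> x0) \<rho>)"
        by (rule open_vimage[OF open_ball]) (intro continuous_intros)
      have e: "\<Psi> (\<sigma> s) = \<Psi> x + s *\<^sub>R h" if "s \<in> (\<lambda>s. \<Psi> x + s *\<^sub>R h) -` ball (\<Psi> x0) \<rho>" for s
      proof -
        have "\<Psi> x + s *\<^sub>R h \<in> V" using that \<rho> by auto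
        then show ?thesis using hom by (simp add: \<sigma>_def homeomorphism_def)
      qed
      have "((\<lambda>s. \<Psi> (\<sigma> s)) has_vector_derivative h) (at s)"
        by (rule has_vector_derivative_transform_within_open[OF 2 o _ e[symmetric]])
           (use inball[OF s] in simp)
      from vector_derivative_unique_at[OF 1 this] show ?thesis .
    qed
    \<comment> \<open>\<open>\<Psi>'\<close> is within 1/2 of the identity here, so
      \<open>k s\<close> differs from \<open>h\<close> by at most half its own length.\<close>
    have kbound: "norm (k s) \<le> 2 * norm h" if s: "s \<in> {0..1}" for s
    proof -
      have "norm (\<Psi>' (\<sigma> s) - \<Psi>' x0) \<le> 1 / 2"
        using d2(2)[of "\<sigma> s"] \<sigma>\<Psi>[OF s] by (simp add: d_def)
      then have "norm (blinfun_apply (\<Psi>' (\<sigma> s) - \<Psi>' x0) (k s)) \<le> 1 / 2 * norm (k s)"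
        using norm_blinfun[of "\<Psi>' (\<sigma> s) - \<Psi>' x0" "k s"] mult_right_mono[OF _ norm_ge_zero[of "k s"]]
        by (meson order_trans)
      moreover have "blinfun_apply (\<Psi>' (\<sigma> s) - \<Psi>' x0) (k s) = h - k s"
        using \<Psi>k[OF s] arg_cong[OF id0, of "\<lambda>f. blinfun_apply f (k s)"] by (simp add: blinfun.diff_left)
      ultimately have "norm (k s - h) \<le> 1 / 2 * norm (k s)" by (simp add: norm_minus_commute)
      then show ?thesis using norm_triangle_ineq2[of "k s" h] by linarith
    qed
    have kerk: "frechet_derivative F (at (\<sigma> s)) (k s) = 0" if s: "s \<in> {0..1}" for s
    proof -
      have "frechet_derivative F (at (\<sigma> s)) (k s) = D (blinfun_apply (\<Psi>' (\<sigma> s)) (k s))"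
        by (simp add: \<Psi>'_apply[OF \<sigma>\<Psi>(3)[OF s]] linear_add[OF linD] linear_diff[OF linD] DR)
      also have "\<dots> = 0" using \<Psi>k[OF s] D\<Psi>[of x] D\<Psi>[of y] Fxy by (simp add: h_def linear_diff[OF linD])
      finally show ?thesis .
    qed
    \<comment> \<open>For each \<open>i\<close>, a bound for the coefficient of \<open>w i\<close>
      in the velocity times a bound for the derivative of \<open>w i\<close>.\<close>
    let ?K = "(\<Sum>i<r. C * (2 * norm h) * B i)"
    have "u (\<sigma> 1) = 0"
    proof (rule gronwall_zero[of 0 1 "\<lambda>s. u (\<sigma> s)" "\<lambda>s. frechet_derivative u (at (\<sigma> s)) (k s)" ?K])
      fix s :: real assume "0 \<le> s" "s \<le> 1"
      then have s: "s \<in> {0..1}" by simp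
      note \<sigma>S = \<sigma>\<Psi>(3)[OF s]
      show "((\<lambda>s. u (\<sigma> s)) has_vector_derivative frechet_derivative u (at (\<sigma> s)) (k s)) (at s)"
        by (rule has_vector_derivative_compose[OF d\<sigma>[OF s] smooth_on_has_derivative[OF S(1) u \<sigma>S]])
      obtain a where a: "k s = (\<Sum>i<r. a i *\<^sub>R w i (\<sigma> s))"
        by (rule span_image_lessThan[OF ker[OF \<sigma>S F\<sigma>[OF s] kerk[OF s]]])
      have abound: "\<bar>a i\<bar> \<le> C * (2 * norm h)" if "i < r" for i
      proof -
        have "\<bar>a i\<bar> \<le> C * norm (k s)"
          unfolding a by (rule C(3)[OF _ that]) (use \<sigma>\<Psi>(4)[OF s] in \<open>simp add: d_def\<close>)
        also have "\<dots> \<le> C * (2 * norm h)" by (rule mult_left_mono[OF kbound[OF s] C(1)])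
        finally show ?thesis .
      qed
      have lin: "linear (frechet_derivative u (at (\<sigma> s)))"
        by (rule linear_frechet_derivative[OF smooth_on_differentiable[OF S(1) u \<sigma>S]])
      have "frechet_derivative u (at (\<sigma> s)) (k s)
          = (\<Sum>i<r. a i *\<^sub>R frechet_derivative (w i) (at (\<sigma> s)) (u (\<sigma> s)))"
        unfolding a linear_sum[OF lin] linear_scale[OF lin] by (rule sum.cong) (use comm \<sigma>S in auto)
      also have "norm \<dots> \<le> (\<Sum>i<r. C * (2 * norm h) * B i * norm (u (\<sigma> s)))"
      proof (rule sum_norm_le)
        fix i assume "i \<in> {..<r}"
        then have i: "i < r" by simp
        have "\<sigma> s \<in> ball x0 (dw i)" using \<sigma>\<Psi>(4)[OF s] d3(2)[OF i] by (simp add: d_def dist_commute)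
        from B(2)[OF i this, of "u (\<sigma> s)"]
        have "\<bar>a i\<bar> * norm (frechet_derivative (w i) (at (\<sigma> s)) (u (\<sigma> s)))
            \<le> (C * (2 * norm h)) * (B i * norm (u (\<sigma> s)))"
          by (intro mult_mono abound[OF i]) (use C in auto)
        then show "norm (a i *\<^sub>R frechet_derivative (w i) (at (\<sigma> s)) (u (\<sigma> s)))
            \<le> C * (2 * norm h) * B i * norm (u (\<sigma> s))" by (simp add: mult.assoc)
      qed
      finally show "norm (frechet_derivative u (at (\<sigma> s)) (k s)) \<le> ?K * norm (u (\<sigma> s))"
        by (simp add: sum_distrib_right)
    next
      have "\<sigma> 0 = x" using x hom by (simp add: \<sigma>_def homeomorphism_def)
      then show "u (\<sigma> 0) = 0" using u0 by simp
    qed simp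
    moreover have "\<sigma> 1 = y" using y hom by (simp add: \<sigma>_def h_def homeomorphism_def)
    ultimately show "u y = 0" by simp
  qed
qed

section \<open>Non-commutative integrable systems\<close>

lemma integral_curve_shift:
  assumes "integral_curve A S X \<gamma>"
  shows "integral_curve A S X (\<lambda>t. \<gamma> (t + s))"
  unfolding integral_curve_def
proof (intro conjI allI)
  show "range (\<lambda>t. \<gamma> (t + s)) \<subseteq> S" using assms by (auto simp: integral_curve_def)
  have "continuous_on UNIV \<gamma>" using assms by (simp add: integral_curve_def)
  then show "continuous_on UNIV (\<lambda>t. \<gamma> (t + s))"
    by (rule continuous_on_compose2) (auto intro: continuous_intros)
  fix t
  have 1: "((\<lambda>t. t + s) has_vector_derivative 1) (at t)" by (auto intro!: derivative_eq_intros)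
  have 2: "((coord A (\<gamma> (t + s)) \<circ> \<gamma>) has_vector_derivative X (\<gamma> (t + s))) (at (t + s))"
    using assms by (simp add: integral_curve_def)
  have "(((coord A (\<gamma> (t + s)) \<circ> \<gamma>) \<circ> (\<lambda>t. t + s)) has_vector_derivative 1 *\<^sub>R X (\<gamma> (t + s))) (at t)"
    by (rule vector_diff_chain_at[OF 1 2])
  then show "((coord A (\<gamma> (t + s)) \<circ> (\<lambda>t. \<gamma> (t + s))) has_vector_derivative X (\<gamma> (t + s))) (at t)"
    by (simp add: o_def)
qed

lemma integral_curve_cong:
  assumes "integral_curve A S X \<gamma>" "S \<subseteq> U" "\<And>m. m \<in> S \<Longrightarrow> X m = Y m"
  shows "integral_curve A U Y \<gamma>"
proof -
  have "\<gamma> t \<in> S" for t using assms(1) unfolding integral_curve_def by blast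
  then have "X (\<gamma> t) = Y (\<gamma> t)" for t by (rule assms(3))
  with assms(1,2) show ?thesis unfolding integral_curve_def by (simp add: subset_iff)
qed

lemma is_flow_cong:
  assumes "is_flow A U X \<Phi>" "\<And>m. m \<in> U \<Longrightarrow> X m = Y m"
  shows "is_flow A U Y \<Phi>"
proof -
  have "integral_curve A U Y (\<lambda>t. \<Phi> t m)" if "m \<in> U" for m
  proof (rule integral_curve_cong[OF _ order_refl assms(2)])
    show "integral_curve A U X (\<lambda>t. \<Phi> t m)" using assms(1) that by (simp add: is_flow_def)
  qed
  with assms(1) show ?thesis by (simp add: is_flow_def)
qed

text \<open>Before the first exit time the curve has moved by at most \<open>\<rho>\<close> in the
  chart, so it lies in the preimage of a closed ball of half the radius. That preimage is compact,
  hence closed in the Hausdorff manifold, and contains the exit point too, a contradiction. This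
  excludes that the curve leaves the chart domain unnoticed by the coordinates.\<close>

lemma integral_curve_stays_in_ball:
  fixes A :: "('m::{t2_space, second_countable_topology}, 'e::euclidean_space) atlas"
  assumes mfd: "smooth_manifold A" and \<sigma>: "integral_curve A U Y \<sigma>" and c: "(D, c) \<in> A" "\<sigma> 0 \<in> D"
    and "\<rho> > 0" and sub: "ball (c (\<sigma> 0)) (2 * \<rho>) \<subseteq> c ` D"
    and speed: "\<And>t. \<sigma> t \<in> D \<Longrightarrow> c (\<sigma> t) \<in> ball (c (\<sigma> 0)) (2 * \<rho>) \<Longrightarrow>
      norm (differential A c (\<sigma> t) (Y (\<sigma> t))) \<le> \<rho>"
    and t: "t \<in> {0..1}"
  shows "\<sigma> t \<in> D \<inter> c -` ball (c (\<sigma> 0)) (2 * \<rho>)"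
proof (rule ccontr)
  assume bad: "\<sigma> t \<notin> D \<inter> c -` ball (c (\<sigma> 0)) (2 * \<rho>)"
  let ?G = "D \<inter> c -` ball (c (\<sigma> 0)) (2 * \<rho>)"
  let ?K = "inv_into D c ` cball (c (\<sigma> 0)) \<rho>"
  have cont: "continuous_on UNIV \<sigma>" using \<sigma> by (simp add: integral_curve_def)
  have cb: "cball (c (\<sigma> 0)) \<rho> \<subseteq> c ` D" using sub \<open>\<rho> > 0\<close> by (fastforce simp: subset_iff)
  have "compact ?K"
    by (rule compact_continuous_image[OF continuous_on_subset[OF chart_inv_continuous[OF mfd c(1)] cb] compact_cball])
  then have K: "closed ?K" by (rule compact_imp_closed)
  have KG: "?K \<subseteq> ?G"
  proof
    fix q assume "q \<in> ?K"
    then obtain x where x: "x \<in> cball (c (\<sigma> 0)) \<rho>" "q = inv_into D c x" by auto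
    moreover obtain q' where "q' \<in> D" "x = c q'" using x cb by auto
    ultimately show "q \<in> ?G" using chart_inv[OF mfd c(1)] \<open>\<rho> > 0\<close> by auto
  qed
  have G: "open (\<sigma> -` ?G)"
    by (rule open_vimage[OF open_chart_preimage[OF mfd c(1) open_ball] cont])
  have "compact ({0..1} \<inter> - (\<sigma> -` ?G))"
    by (rule compact_Int_closed[OF compact_Icc closed_Compl[OF G]])
  moreover have "{0..1} \<inter> - (\<sigma> -` ?G) \<noteq> {}" using bad t by auto
  ultimately have "\<exists>s\<in>{0..1} \<inter> - (\<sigma> -` ?G). \<forall>r\<in>{0..1} \<inter> - (\<sigma> -` ?G). s \<le> r"
    by (rule compact_attains_inf)
  then obtain s where "s \<in> {0..1} \<inter> - (\<sigma> -` ?G)"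
    and min: "\<forall>r\<in>{0..1} \<inter> - (\<sigma> -` ?G). s \<le> r" by (rule bexE)
  then have s: "s \<in> {0..1}" "\<sigma> s \<notin> ?G" by simp_all
  have least: "s \<le> r" if "r \<in> {0..1}" "\<sigma> r \<notin> ?G" for r
    by (rule min[rule_format]) (use that in simp)
  have "s \<noteq> 0" using s(2) c(2) \<open>\<rho> > 0\<close> by auto
  then have "s > 0" using s(1) by auto
  have inK: "\<sigma> r \<in> ?K" if r: "r \<in> {0..<s}" for r
  proof -
    have inG: "\<sigma> u \<in> ?G" if "u \<in> {0..r}" for u
    proof (rule ccontr)
      assume "\<sigma> u \<notin> ?G"
      moreover have "u \<in> {0..1}" using that r s(1) by simp
      ultimately have "s \<le> u" by (intro least)
      then show False using that r by simp
    qed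
    have "norm (c (\<sigma> r) - c (\<sigma> 0)) \<le> \<rho> * norm (r - 0)"
    proof (rule differentiable_bound[where S = "{0..r}" and f = "\<lambda>u. c (\<sigma> u)"
          and f' = "\<lambda>u h. h *\<^sub>R differential A c (\<sigma> u) (Y (\<sigma> u))"])
      fix u assume u: "u \<in> {0..r}"
      have uD: "\<sigma> u \<in> D" using inG[OF u] by simp
      show "((\<lambda>u. c (\<sigma> u)) has_derivative (\<lambda>h. h *\<^sub>R differential A c (\<sigma> u) (Y (\<sigma> u)))) (at u within {0..r})"
        using integral_curve_along[OF mfd \<sigma> chart_map_differentiable[OF mfd c(1) uD]]
        by (simp add: has_vector_derivative_def has_derivative_at_withinI)
      show "onorm (\<lambda>h. h *\<^sub>R differential A c (\<sigma> u) (Y (\<sigma> u))) \<le> \<rho>"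
      proof (rule onorm_le)
        fix h :: real
        have "norm (differential A c (\<sigma> u) (Y (\<sigma> u))) \<le> \<rho>" by (rule speed) (use inG[OF u] in auto)
        from mult_left_mono[OF this abs_ge_zero[of h]]
        show "norm (h *\<^sub>R differential A c (\<sigma> u) (Y (\<sigma> u))) \<le> \<rho> * norm h"
          by (simp add: mult.commute)
      qed
    qed (use r in auto)
    also have "\<dots> \<le> \<rho> * 1" by (rule mult_left_mono) (use r s(1) \<open>\<rho> > 0\<close> in auto)
    finally have "c (\<sigma> r) \<in> cball (c (\<sigma> 0)) \<rho>" by (simp add: dist_norm norm_minus_commute)
    moreover have "\<sigma> r \<in> D" using inG[of r] r by simp
    ultimately show ?thesis using chart_inv[OF mfd c(1)] by (metis image_eqI)
  qed
  have "closed (\<sigma> -` ?K)" by (rule closed_vimage[OF K cont])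
  moreover have "{0..<s} \<subseteq> \<sigma> -` ?K" using inK by auto
  ultimately have "closure {0..<s} \<subseteq> \<sigma> -` ?K" by (rule closure_minimal[rotated])
  moreover have "s \<in> closure {0..<s}" using \<open>s > 0\<close> by simp
  ultimately have "\<sigma> s \<in> ?K" by (meson subsetD vimageD)
  with KG s(2) show False by blast
qed

context
  fixes A :: "('m::{t2_space, second_countable_topology}, 'e::euclidean_space) atlas"
    and P :: "('m, 'e) bivector"
    and A' :: "('n::{t2_space, second_countable_topology}, 'f::euclidean_space) atlas"
    and P' :: "('n, 'f) bivector"
    and \<phi> :: "'m \<Rightarrow> 'n" and r :: nat
  assumes nci: "nci_system A P A' P' \<phi> r"
begin

lemma nci_mfd: "smooth_manifold A" and nci_mfd': "smooth_manifold A'"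
  and nci_poisson: "poisson_structure A P" and nci_poisson': "poisson_structure A' P'"
  and nci_smooth: "smooth_map_on A A' UNIV \<phi>"
  and nci_surj: "surj \<phi>" and nci_submersion: "surj (blinfun_apply (tangent_map A A' \<phi> m))"
  and nci_connected: "connected (\<phi> -` {b})" and nci_poisson_map: "poisson_map A P A' P' \<phi>"
  and nci_foliation: "foliation A r UNIV (vertical A A' \<phi>)"
  using nci unfolding nci_system_def abstract_nci_def by blast+

lemma dim_vertical: "dim (vertical A A' \<phi> m) = r"
  using nci_foliation unfolding foliation_def by blast

lemma subspace_vertical: "subspace (vertical A A' \<phi> m)"
  unfolding vertical_def subspace_def by (simp add: blinfun.add_right blinfun.scaleR_right)

text \<open>A Hamiltonian field is minus \<open>sharp\<close> of the differential. The first
  integrals are negated once here so that all later computations can use \<open>sharp\<close>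
  without signs.\<close>

lemma local_first_integrals:
  obtains U f where "open U" "m \<in> U" "\<And>i. i < r \<Longrightarrow> smooth_fun_on A U (f i :: 'm \<Rightarrow> real)"
    "\<And>q. q \<in> U \<Longrightarrow> span ((\<lambda>i. sharp P q (differential A (f i) q)) ` {..<r}) = vertical A A' \<phi> q"
proof -
  have "\<exists>U f. open U \<and> m \<in> U \<and> (\<forall>i<r. first_integral A (vertical A A' \<phi>) U (f i)) \<and>
        (\<forall>q\<in>U. span ((\<lambda>i. hamiltonian_field A P (f i) q) ` {..<r}) = vertical A A' \<phi> q)"
    using nci unfolding nci_system_def abstract_nci_def by blast
  then obtain U f where U: "open U" "m \<in> U" and f: "\<forall>i<r. first_integral A (vertical A A' \<phi>) U (f i)"
    and span: "\<forall>q\<in>U. span ((\<lambda>i. hamiltonian_field A P (f i) q) ` {..<r}) = vertical A A' \<phi> q" by blast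
  have fs: "smooth_fun_on A U (f i)" if "i < r" for i
    using f that unfolding first_integral_def by blast
  show thesis
  proof (rule that[OF U, of "\<lambda>i q. - f i q"])
    show "smooth_fun_on A U (\<lambda>q. - f i q)" if "i < r" for i
      using smooth_fun_on_bounded_linear[OF nci_mfd bounded_linear_minus[OF bounded_linear_ident] U(1) fs[OF that]] .
    fix q assume q: "q \<in> U"
    have "sharp P q (differential A (\<lambda>q. - f i q) q) = hamiltonian_field A P (f i) q" if "i < r" for i
      using differential_scaleR[OF nci_mfd smooth_fun_on_differentiable_mfd[OF nci_mfd fs[OF that] U(1) q], of "- 1"]
      by (simp add: hamiltonian_field_def linear_neg[OF sharp_linear[OF nci_mfd nci_poisson]])
    then have "(\<lambda>i. sharp P q (differential A (\<lambda>q. - f i q) q)) ` {..<r}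
        = (\<lambda>i. hamiltonian_field A P (f i) q) ` {..<r}" by (intro image_cong) auto
    with span q show "span ((\<lambda>i. sharp P q (differential A (\<lambda>q. - f i q) q)) ` {..<r}) = vertical A A' \<phi> q"
      by simp
  qed
qed

lemma open_lift: "open W \<Longrightarrow> open (\<phi> -` W)"
  using nci_smooth unfolding smooth_map_on_def by (blast intro: open_vimage)

lemma smooth_lift:
  assumes "open W" "smooth_fun_on A' W u"
  shows "smooth_fun_on A (\<phi> -` W) (\<lambda>q. u (\<phi> q))"
  using smooth_fun_on_compose_map[OF nci_mfd nci_mfd' nci_smooth open_UNIV assms] by simp

lemma differential_lift:
  assumes "differentiable_mfd A' u (\<phi> m)"
  shows "differential A (\<lambda>q. u (\<phi> q)) m = pullback A A' \<phi> m (differential A' u (\<phi> m))"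
  by (rule differential_pullback[OF nci_mfd nci_mfd' nci_smooth open_UNIV UNIV_I assms])

lemma pullback_linear: "linear (pullback A A' \<phi> m)"
  by (rule linearI; rule blinfun_eqI) (simp_all add: pullback_def blinfun.add_left blinfun.scaleR_left)

text \<open>Pairing both sides with an arbitrary covector of the base gives the defining identity of
  a Poisson map, and covectors separate vectors.\<close>

lemma project_sharp_pullback:
  "tangent_map A A' \<phi> m (sharp P m (pullback A A' \<phi> m \<xi>)) = sharp P' (\<phi> m) \<xi>"
proof (rule blinfun_separates)
  fix \<eta> :: "'f \<Rightarrow>\<^sub>L real"
  have "\<eta> (tangent_map A A' \<phi> m (sharp P m (pullback A A' \<phi> m \<xi>)))
      = P m (pullback A A' \<phi> m \<xi>) (pullback A A' \<phi> m \<eta>)"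
    using sharp_apply[OF nci_mfd nci_poisson, of "pullback A A' \<phi> m \<eta>"] by (simp add: pullback_def)
  also have "\<dots> = P' (\<phi> m) \<xi> \<eta>" using nci_poisson_map unfolding poisson_map_def by blast
  finally show "\<eta> (tangent_map A A' \<phi> m (sharp P m (pullback A A' \<phi> m \<xi>))) = \<eta> (sharp P' (\<phi> m) \<xi>)"
    by (simp add: sharp_apply[OF nci_mfd' nci_poisson'])
qed

lemma poisson_bracket_lift:
  assumes "differentiable_mfd A' u (\<phi> m)" "differentiable_mfd A' v (\<phi> m)"
  shows "poisson_bracket A P (\<lambda>q. u (\<phi> q)) (\<lambda>q. v (\<phi> q)) m = poisson_bracket A' P' u v (\<phi> m)"
  using nci_poisson_map unfolding poisson_map_def poisson_bracket_def
  by (simp add: differential_lift[OF assms(1)] differential_lift[OF assms(2)])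

text \<open>The first integrals Poisson commute with \<open>g\<close> after \<open>\<phi>\<close>
  because their Hamiltonian fields are vertical and \<open>g\<close> after \<open>\<phi>\<close> is
  constant along the fibers. The local propagation is the one on level sets, for the coordinate
  expression \<open>?F\<close> of \<open>\<phi>\<close>.\<close>

lemma hamiltonian_lift_zero_on_fiber:
  assumes W: "open W" "b \<in> W" and g: "smooth_fun_on A' W (g :: 'n \<Rightarrow> real)"
    and m: "\<phi> m0 = b" "\<phi> m1 = b"
    and zero: "sharp P m0 (differential A (\<lambda>q. g (\<phi> q)) m0) = 0"
  shows "sharp P m1 (differential A (\<lambda>q. g (\<phi> q)) m1) = 0"
proof (rule connected_induction_simple[where P = "\<lambda>m. sharp P m (differential A (\<lambda>q. g (\<phi> q)) m) = 0"
      and S = "\<phi> -` {b}" and a = m0 and b = m1, OF nci_connected _ _ zero])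
  fix m assume "m \<in> \<phi> -` {b}"
  then have \<phi>m: "\<phi> m = b" by simp
  let ?X = "\<lambda>q. sharp P q (differential A (\<lambda>q. g (\<phi> q)) q)"
  obtain U0 f where U0: "open U0" "m \<in> U0" and f: "\<And>i. i < r \<Longrightarrow> smooth_fun_on A U0 (f i :: 'm \<Rightarrow> real)"
    and span: "\<And>q. q \<in> U0 \<Longrightarrow> span ((\<lambda>i. sharp P q (differential A (f i) q)) ` {..<r}) = vertical A A' \<phi> q"
    by (rule local_first_integrals[of m]) blast
  let ?D = "chart_dom A m" and ?c = "coord A m" and ?D' = "chart_dom A' b" and ?c' = "coord A' b"
  note ch = chart_at_in_atlas[OF nci_mfd, of m] chart_at_mem[OF nci_mfd, of m]
  note ch' = chart_at_in_atlas[OF nci_mfd', of b] chart_at_mem[OF nci_mfd', of b]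
  note o' = chart_homeomorphism(1)[OF nci_mfd' ch'(1)]
  define V where "V = U0 \<inter> \<phi> -` (W \<inter> ?D')"
  have V: "open V" "V \<subseteq> U0" "V \<subseteq> \<phi> -` W" "V \<subseteq> \<phi> -` ?D'" "m \<in> V"
    using U0 open_lift[OF open_Int[OF W(1) o']] W ch' \<phi>m by (auto simp: V_def)
  let ?S = "?c ` (V \<inter> ?D)"
  let ?F = "\<lambda>x. ?c' (\<phi> (inv_into ?D ?c x))"
  let ?u = "field_in_chart A ?D ?c ?X"
  let ?w = "\<lambda>i. field_in_chart A ?D ?c (\<lambda>q. sharp P q (differential A (f i) q))"
  have S: "open ?S" "?c m \<in> ?S" using open_chart_image[OF nci_mfd ch(1) V(1)] V ch by auto
  have gV: "smooth_fun_on A V (\<lambda>q. g (\<phi> q))"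
    by (rule smooth_fun_on_subset[OF nci_mfd smooth_lift[OF W(1) g] V(3)])
  have fV: "smooth_fun_on A V (f i)" if "i < r" for i by (rule smooth_fun_on_subset[OF nci_mfd f[OF that] V(2)])
  have c'V: "smooth_fun_on A V (\<lambda>q. ?c' (\<phi> q))"
    by (rule smooth_fun_on_subset[OF nci_mfd smooth_lift[OF o' smooth_fun_on_chart_map[OF nci_mfd' ch'(1) o' order_refl]] V(4)])
  \<comment> \<open>\<open>tangent_map\<close> at \<open>q\<close> uses the chart chosen at
    \<open>\<phi> q\<close>, which is guaranteed to be \<open>?c'\<close> only when
    \<open>\<phi> q = b\<close>. For this reason the kernel condition for the propagation is imposed
    on one level set.\<close>
  have dF: "frechet_derivative ?F (at (?c q)) (differential A ?c q v) = tangent_map A A' \<phi> q v"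
    if q: "q \<in> V" "q \<in> ?D" "\<phi> q = b" for q v
    using differential_eq_chart[OF nci_mfd smooth_fun_on_differentiable_mfd[OF nci_mfd c'V V(1) q(1)] ch(1) q(2), of v]
    by (simp add: tangent_map_def o_def q(3))
  have surj: "surj (frechet_derivative ?F (at (?c m)))"
  proof (rule surjI)
    fix z
    have "tangent_map A A' \<phi> m (inv (blinfun_apply (tangent_map A A' \<phi> m)) z) = z"
      by (rule surj_f_inv_f[OF nci_submersion])
    then show "frechet_derivative ?F (at (?c m)) (differential A ?c m (inv (blinfun_apply (tangent_map A A' \<phi> m)) z)) = z"
      by (simp add: dF[OF V(5) ch(2) \<phi>m])
  qed
  \<comment> \<open>There are \<open>r\<close> fields and they span the vertical space, whose
    dimension is \<open>r\<close>.\<close>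
  have indep: "lin_indep r (\<lambda>i. ?w i (?c m))"
    unfolding field_in_chart_at[OF nci_mfd ch] differential_coord[OF nci_mfd]
    by (rule lin_indep_if_dim) (simp add: span[OF U0(2)] dim_vertical)
  have wvert: "sharp P q (differential A (f i) q) \<in> vertical A A' \<phi> q" if "q \<in> V" "i < r" for q i
  proof -
    have "sharp P q (differential A (f i) q) \<in> span ((\<lambda>i. sharp P q (differential A (f i) q)) ` {..<r})"
      by (rule span_base, rule imageI) (use that in simp)
    also have "\<dots> = vertical A A' \<phi> q" by (rule span) (use that V(2) in auto)
    finally show ?thesis .
  qed
  have commV: "poisson_bracket A P (\<lambda>q. g (\<phi> q)) (f i) q = 0" if "i < r" "q \<in> V" for i q
  proof -
    have "\<phi> q \<in> W" using that V by auto
    note d = differential_lift[OF smooth_fun_on_differentiable_mfd[OF nci_mfd' g W(1) this]]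
    have "poisson_bracket A P (f i) (\<lambda>q. g (\<phi> q)) q = 0"
      unfolding poisson_bracket_sharp[OF nci_mfd nci_poisson] d
      using wvert[OF that(2,1)] by (simp add: pullback_def vertical_def)
    then show ?thesis
      using poisson_bracket_antisym[OF nci_mfd nci_poisson, of "\<lambda>q. g (\<phi> q)" "f i" q] by simp
  qed
  have ker: "v \<in> span ((\<lambda>i. ?w i x) ` {..<r})"
    if x: "x \<in> ?S" and Fx: "?F x = ?F (?c m)" and v: "frechet_derivative ?F (at x) v = 0" for x v
  proof -
    obtain q where q: "q \<in> V" "q \<in> ?D" "x = ?c q" using x by auto
    have "?c' (\<phi> q) = ?c' b" using Fx q ch chart_inv[OF nci_mfd ch(1)] \<phi>m by simp
    moreover have "\<phi> q \<in> ?D'" using V q by auto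
    ultimately have \<phi>q: "\<phi> q = b" using chart_inv[OF nci_mfd' ch'(1)] ch'(2) by metis
    obtain v0 where v0: "v = differential A ?c q v0"
      using differential_chart_surj[OF nci_mfd ch(1) q(2)] by (auto elim: surjE)
    have "v0 \<in> vertical A A' \<phi> q" using v dF[OF q(1,2) \<phi>q, of v0] by (simp add: v0 q vertical_def)
    then have "v0 \<in> span ((\<lambda>i. sharp P q (differential A (f i) q)) ` {..<r})" using span q V by auto
    then obtain a where "v0 = (\<Sum>i<r. a i *\<^sub>R sharp P q (differential A (f i) q))" by (rule span_image_lessThan)
    then have v: "v = (\<Sum>i<r. a i *\<^sub>R ?w i x)"
      by (simp add: v0 q field_in_chart_at[OF nci_mfd ch(1)] blinfun.sum_right blinfun.scaleR_right)
    show ?thesis unfolding v by (rule span_sum, rule span_scale, rule span_base, rule imageI)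
  qed
  obtain N where N: "open N" "?c m \<in> N" "N \<subseteq> ?S"
    "\<And>x y. x \<in> N \<Longrightarrow> y \<in> N \<Longrightarrow> ?F x = ?F (?c m) \<Longrightarrow> ?F y = ?F (?c m) \<Longrightarrow> ?u x = 0 \<Longrightarrow> ?u y = 0"
  proof (rule level_set_zero_propagation[where F = ?F and u = ?u and w = ?w and r = r, OF S _ _ _ surj indep])
    show "smooth_on ?F ?S" by (rule smooth_fun_on_chart[OF nci_mfd c'V ch(1)])
    show "smooth_on ?u ?S"
      by (rule smooth_field_in_chart[OF nci_mfd smooth_sharp_differential[OF nci_mfd nci_poisson V(1) gV] V(1) ch(1)])
    show "smooth_on (?w i) ?S" if "i < r" for i
      by (rule smooth_field_in_chart[OF nci_mfd smooth_sharp_differential[OF nci_mfd nci_poisson V(1) fV[OF that]] V(1) ch(1)])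
    show "frechet_derivative ?u (at x) (?w i x) = frechet_derivative (?w i) (at x) (?u x)"
      if "i < r" "x \<in> ?S" for i x
      by (rule commuting_hamiltonians_in_chart[OF nci_mfd nci_poisson V(1) gV fV[OF that(1)]
            commV[OF that(1)] ch(1) that(2), symmetric])
    show "v \<in> span ((\<lambda>i. ?w i x) ` {..<r})"
      if "x \<in> ?S" "?F x = ?F (?c m)" "frechet_derivative ?F (at x) v = 0" for x v
      by (rule ker[OF that])
  qed (rule that)
  let ?O = "?D \<inter> ?c -` N"
  have O: "open ?O" by (rule open_chart_preimage[OF nci_mfd ch(1) N(1)])
  show "\<exists>T. openin (top_of_set (\<phi> -` {b})) T \<and> m \<in> T \<and> (\<forall>x\<in>T. \<forall>y\<in>T. ?X x = 0 \<longrightarrow> ?X y = 0)"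
  proof (intro exI[of _ "\<phi> -` {b} \<inter> ?O"] conjI ballI impI)
    show "openin (top_of_set (\<phi> -` {b})) (\<phi> -` {b} \<inter> ?O)" by (rule openin_open_Int[OF O])
    show "m \<in> \<phi> -` {b} \<inter> ?O" using \<phi>m ch N by simp
    fix x y assume x: "x \<in> \<phi> -` {b} \<inter> ?O" and y: "y \<in> \<phi> -` {b} \<inter> ?O" and "?X x = 0"
    have F: "?F (?c z) = ?F (?c m)" if "z \<in> \<phi> -` {b} \<inter> ?O" for z
      using that \<phi>m ch chart_inv[OF nci_mfd ch(1)] by simp
    have "?u (?c y) = 0"
    proof (rule N(4)[OF _ _ F[OF x] F[OF y]])
      show "?u (?c x) = 0" using x \<open>?X x = 0\<close> by (simp add: field_in_chart_at[OF nci_mfd ch(1)])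
    qed (use x y in auto)
    then have "differential A ?c y (?X y) = differential A ?c y 0"
      using y by (simp add: field_in_chart_at[OF nci_mfd ch(1)])
    then show "?X y = 0" by (rule injD[OF differential_chart_inj[OF nci_mfd ch(1)], rotated]) (use y in simp)
  qed
qed (use m in simp_all)

end

section \<open>Independence of the action vector fields\<close>

text \<open>A shift of the orbit by time 1 is an integral curve with the same initial point, hence
  the same orbit. The resulting identity is read forwards for positive integers and backwards for
  negative ones.\<close>

lemma flow_integer_period:
  fixes A :: "('m::{t2_space, second_countable_topology}, 'e::euclidean_space) atlas"
  assumes mfd: "smooth_manifold A" and \<Phi>: "is_flow A U X \<Phi>" and X: "smooth_vector_field A U X" "open U"
    and m: "m \<in> U" "\<Phi> 1 m = m"
  shows "\<Phi> (of_int k) m = m"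
proof -
  note \<gamma> = flow_integral_curve[OF mfd \<Phi> m(1)]
  have step: "\<Phi> (t + 1) m = \<Phi> t m" for t
    by (rule integral_curve_unique[OF mfd X integral_curve_shift[OF \<gamma>] \<gamma>, where ?t0.0 = 0])
       (simp add: m flow_zero[OF mfd \<Phi> m(1)])
  show ?thesis
  proof (induction k rule: int_induct[where k = 0])
    case base
    then show ?case by (simp add: flow_zero[OF mfd \<Phi> m(1)])
  next
    case (step1 i)
    then show ?case using step[of "of_int i"] by simp
  next
    case (step2 i)
    then show ?case using step[of "of_int i - 1"] by simp
  qed
qed

text \<open>The closed curve for the first \<open>n\<close> fields is carried along by the next
  flow, run at speed \<open>k n\<close>. This is an integral curve of the sum because each flow
  preserves the other fields, and it closes up since \<open>k n\<close> is a multiple of the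
  period.\<close>

lemma integer_combination_periodic:
  fixes A :: "('m::{t2_space, second_countable_topology}, 'e::euclidean_space) atlas"
    and k :: "nat \<Rightarrow> int"
  assumes mfd: "smooth_manifold A" and "open U" "m \<in> U"
    and X: "\<And>i. i < n \<Longrightarrow> smooth_vector_field A U (X i)"
    and \<Phi>: "\<And>i. i < n \<Longrightarrow> is_flow A U (X i) (\<Phi> i)"
    and per: "\<And>i. i < n \<Longrightarrow> \<Phi> i 1 m = m"
    and push: "\<And>i j t q. i < n \<Longrightarrow> j < n \<Longrightarrow> q \<in> U \<Longrightarrow>
      tangent_map A A (\<Phi> i t) q (X j q) = X j (\<Phi> i t q)"
  shows "\<exists>\<sigma>. integral_curve A U (\<lambda>q. \<Sum>i<n. of_int (k i) *\<^sub>R X i q) \<sigma> \<and> \<sigma> 0 = m \<and> \<sigma> 1 = m"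
  using X \<Phi> per push
proof (induction n)
  case 0
  have "integral_curve A U (\<lambda>q. 0) (\<lambda>t. m)"
    using \<open>m \<in> U\<close> by (auto simp: integral_curve_def o_def)
  then show ?case by (intro exI[of _ "\<lambda>t. m"]) simp
next
  case (Suc n)
  have "\<exists>\<sigma>. integral_curve A U (\<lambda>q. \<Sum>i<n. of_int (k i) *\<^sub>R X i q) \<sigma> \<and> \<sigma> 0 = m \<and> \<sigma> 1 = m"
    by (rule Suc.IH) (simp_all add: Suc.prems)
  then obtain \<sigma> where \<sigma>: "integral_curve A U (\<lambda>q. \<Sum>i<n. of_int (k i) *\<^sub>R X i q) \<sigma>" "\<sigma> 0 = m" "\<sigma> 1 = m"
    by blast
  note \<Phi>n = Suc.prems(2)[OF lessI]
  have "integral_curve A U (\<lambda>q. of_int (k n) *\<^sub>R X n q + (\<Sum>i<n. of_int (k i) *\<^sub>R X i q))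
      (\<lambda>t. \<Phi> n (of_int (k n) * t) (\<sigma> t))"
    by (rule flow_compose_integral_curve[OF mfd \<Phi>n \<open>open U\<close> \<sigma>(1)])
       (simp add: blinfun.sum_right blinfun.scaleR_right Suc.prems(4))
  then have "integral_curve A U (\<lambda>q. \<Sum>i<Suc n. of_int (k i) *\<^sub>R X i q)
      (\<lambda>t. \<Phi> n (of_int (k n) * t) (\<sigma> t))" by (simp add: add.commute)
  moreover have "\<Phi> n (of_int (k n) * 0) (\<sigma> 0) = m"
    using flow_zero[OF mfd \<Phi>n \<open>m \<in> U\<close>] \<sigma> by simp
  moreover have "\<Phi> n (of_int (k n) * 1) (\<sigma> 1) = m"
    using flow_integer_period[OF mfd \<Phi>n Suc.prems(1)[OF lessI] \<open>open U\<close> \<open>m \<in> U\<close> Suc.prems(3)[OF lessI]] \<sigma>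
    by simp
  ultimately show ?case by blast
qed

section \<open>Action classes and the vector fields of action variables\<close>

context
  fixes A :: "('m::{t2_space, second_countable_topology}, 'e::euclidean_space) atlas"
    and P :: "('m, 'e) bivector"
    and A' :: "('n::{t2_space, second_countable_topology}, 'f::euclidean_space) atlas"
    and P' :: "('n, 'f) bivector"
    and \<phi> :: "'m \<Rightarrow> 'n" and r :: nat
  assumes nci: "nci_system A P A' P' \<phi> r"
begin

lemmas mA = nci_mfd[OF nci] and mA' = nci_mfd'[OF nci]
  and pP = nci_poisson[OF nci] and pP' = nci_poisson'[OF nci]

lemma representative_action_class:
  assumes "\<xi> \<in> sharp_kernel P' b"
  shows "representative (action_class A P A' P' \<phi> b \<xi>) - \<xi> \<in> null_covectors A P A' \<phi> b"
proof -
  have "\<xi> \<in> action_class A P A' P' \<phi> b \<xi>"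
    using assms linear_0[OF pullback_linear[OF nci]] linear_0[OF sharp_linear[OF mA pP]]
    by (simp add: action_class_def null_covectors_def)
  then have "representative (action_class A P A' P' \<phi> b \<xi>) \<in> action_class A P A' P' \<phi> b \<xi>"
    unfolding representative_def by (rule someI)
  then show ?thesis by (simp add: action_class_def)
qed

text \<open>The representative picked by choice differs from \<open>\<xi>\<close> by a null
  covector, which \<open>sharp\<close> after the pullback sends to zero.\<close>

lemma action_vector_action_class:
  assumes "\<xi> \<in> sharp_kernel P' b" "\<phi> m = b"
  shows "action_vector A P A' \<phi> (action_class A P A' P' \<phi> b \<xi>) m = sharp P m (pullback A A' \<phi> m \<xi>)"
proof -
  have "sharp P m (pullback A A' \<phi> m (representative (action_class A P A' P' \<phi> b \<xi>) - \<xi>)) = 0"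
    using representative_action_class[OF assms(1)] assms(2) by (auto simp: null_covectors_def)
  then show ?thesis
    by (simp add: action_vector_def linear_diff[OF pullback_linear[OF nci]] linear_diff[OF sharp_linear[OF mA pP]])
qed

lemma action_class_eqI:
  assumes "\<And>m. \<phi> m = b \<Longrightarrow> sharp P m (pullback A A' \<phi> m \<xi>) = sharp P m (pullback A A' \<phi> m \<zeta>)"
  shows "action_class A P A' P' \<phi> b \<xi> = action_class A P A' P' \<phi> b \<zeta>"
  using assms
  by (auto simp: action_class_def null_covectors_def linear_diff[OF pullback_linear[OF nci]]
      linear_diff[OF sharp_linear[OF mA pP]])

text \<open>Constant curves have period 1. The zero class serves later as the lattice element whose
  coordinates are computed in two ways.\<close>

lemma zero_in_action_lattice: "action_class A P A' P' \<phi> b 0 \<in> action_lattice A P A' P' \<phi> b"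
proof -
  have k: "0 \<in> sharp_kernel P' b"
    by (simp add: sharp_kernel_def linear_0[OF sharp_linear[OF mA' pP']])
  have "integral_curve A (\<phi> -` {b}) (action_vector A P A' \<phi> (action_class A P A' P' \<phi> b 0)) (\<lambda>t. m)"
    if "\<phi> m = b" for m
    using that
    by (auto simp: integral_curve_def o_def action_vector_action_class[OF k that]
        linear_0[OF pullback_linear[OF nci]] linear_0[OF sharp_linear[OF mA pP]])
  with k show ?thesis unfolding action_lattice_def action_space_def by auto
qed

lemma action_variables_smooth:
  "action_variables A P A' P' \<phi> r W p \<Longrightarrow> i < r \<Longrightarrow> smooth_fun_on A' W (p i)"
  and action_variables_kernel:
  "action_variables A P A' P' \<phi> r W p \<Longrightarrow> i < r \<Longrightarrow> q \<in> W \<Longrightarrow> differential A' (p i) q \<in> sharp_kernel P' q"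
  by (simp_all add: action_variables_def casimir_on_def sharp_kernel_def)

lemma action_variables_section:
  "action_variables A P A' P' \<phi> r W p \<Longrightarrow> i < r \<Longrightarrow>
    lattice_section A P A' P' \<phi> W (\<lambda>b. action_class A P A' P' \<phi> b (differential A' (p i) b))"
  by (simp add: action_variables_def lattice_trivialization_def)

context
  fixes W p
  assumes W: "open W" and av: "action_variables A P A' P' \<phi> r W p"
begin

text \<open>The action vector field of the class of the differential of \<open>p i\<close>, written
  with the differential of the lifted function so that smoothness and commutation follow from facts
  about Poisson brackets.\<close>

definition lattice_field :: "nat \<Rightarrow> 'm \<Rightarrow> 'e" where
  "lattice_field i m = sharp P m (differential A (\<lambda>q. p i (\<phi> q)) m)"

lemmas psmooth = action_variables_smooth[OF av]

lemma p_differentiable: "i < r \<Longrightarrow> q \<in> W \<Longrightarrow> differentiable_mfd A' (p i) q"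
  by (rule smooth_fun_on_differentiable_mfd[OF mA' psmooth W])

lemma lifted_p_smooth: "i < r \<Longrightarrow> smooth_fun_on A (\<phi> -` W) (\<lambda>q. p i (\<phi> q))"
  by (rule smooth_lift[OF nci W psmooth])

lemma lifted_p_differentiable: "i < r \<Longrightarrow> \<phi> m \<in> W \<Longrightarrow> differentiable_mfd A (\<lambda>q. p i (\<phi> q)) m"
  by (rule smooth_fun_on_differentiable_mfd[OF mA lifted_p_smooth open_lift[OF nci W]]) simp_all

lemma lattice_field_eq_pullback: "i < r \<Longrightarrow> \<phi> m \<in> W \<Longrightarrow> lattice_field i m = sharp P m (pullback A A' \<phi> m (differential A' (p i) (\<phi> m)))"
  by (simp add: lattice_field_def differential_lift[OF nci p_differentiable])

lemma lattice_field_smooth: "i < r \<Longrightarrow> smooth_vector_field A (\<phi> -` W) (lattice_field i)"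
  unfolding lattice_field_def[abs_def]
  by (rule smooth_sharp_differential[OF mA pP open_lift[OF nci W] lifted_p_smooth])

lemma lattice_field_vertical: "i < r \<Longrightarrow> \<phi> m \<in> W \<Longrightarrow> lattice_field i m \<in> vertical A A' \<phi> m"
  using action_variables_kernel[OF av, of i "\<phi> m"]
  by (simp add: lattice_field_eq_pullback vertical_def project_sharp_pullback[OF nci] sharp_kernel_def)

lemma lifted_bracket_zero:
  assumes "i < r" "\<phi> m \<in> W" and u: "differentiable_mfd A' u (\<phi> m)"
  shows "poisson_bracket A P (\<lambda>q. p i (\<phi> q)) (\<lambda>q. u (\<phi> q)) m = 0"
  using action_variables_kernel[OF av assms(1,2)]
  by (simp add: poisson_bracket_lift[OF nci p_differentiable[OF assms(1,2)] u]
      poisson_bracket_sharp[OF mA' pP'] sharp_kernel_def)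

lemma action_field_eq_lattice_field:
  assumes "i < r" "\<phi> m \<in> W"
  shows "action_field A P A' \<phi> (\<lambda>b. action_class A P A' P' \<phi> b (differential A' (p i) b)) m = lattice_field i m"
  unfolding action_field_def lattice_field_eq_pullback[OF assms]
  by (rule action_vector_action_class[OF action_variables_kernel[OF av assms] refl])

lemma lattice_field_combination:
  assumes "\<phi> m \<in> W"
  shows "sharp P m (differential A (\<lambda>q. \<Sum>i<r. a i *\<^sub>R p i (\<phi> q)) m) = (\<Sum>i<r. a i *\<^sub>R lattice_field i m)"
proof -
  have d: "differentiable_mfd A (\<lambda>q. a i *\<^sub>R p i (\<phi> q)) m" if "i < r" for i
    by (rule smooth_fun_on_differentiable_mfd[OF mA smooth_fun_on_bounded_linear[OF mA
            bounded_linear_scaleR_right open_lift[OF nci W] lifted_p_smooth[OF that]] open_lift[OF nci W]])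
       (use assms in simp)
  have "differential A (\<lambda>q. \<Sum>i<r. a i *\<^sub>R p i (\<phi> q)) m
      = (\<Sum>i<r. differential A (\<lambda>q. a i *\<^sub>R p i (\<phi> q)) m)"
    by (rule differential_sum[OF mA]) (simp add: d del: real_scaleR_def)
  also have "\<dots> = (\<Sum>i<r. a i *\<^sub>R differential A (\<lambda>q. p i (\<phi> q)) m)"
    by (rule sum.cong[OF refl], rule differential_scaleR[OF mA], rule lifted_p_differentiable) (use assms in auto)
  finally show ?thesis
    by (simp add: lattice_field_def linear_sum[OF sharp_linear[OF mA pP]] linear_scale[OF sharp_linear[OF mA pP]])
qed

text \<open>As the coefficients are constants, the combination is \<open>sharp\<close> of the
  differential of a single function lifted from the base, so its zeros spread over the
  fiber.\<close>

lemma lattice_field_relation_on_fiber: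
  assumes "\<phi> m0 \<in> W" "\<phi> m = \<phi> m0" "(\<Sum>i<r. a i *\<^sub>R lattice_field i m0) = 0"
  shows "(\<Sum>i<r. a i *\<^sub>R lattice_field i m) = 0"
proof -
  have "smooth_fun_on A' W (\<lambda>x. \<Sum>i<r. a i *\<^sub>R p i x)"
    by (intro smooth_fun_on_sum[OF mA' W] smooth_fun_on_bounded_linear[OF mA' bounded_linear_scaleR_right W] psmooth) simp
  from hamiltonian_lift_zero_on_fiber[OF nci W assms(1) this refl assms(2)]
  show ?thesis using lattice_field_combination[OF assms(1), of a] lattice_field_combination[of m a] assms by simp
qed

text \<open>The relation extends from \<open>m0\<close> to its fiber and so makes the integers
  \<open>k\<close> coordinates of the zero class, which also has the coordinates 0.\<close>

lemma integer_relation_trivial: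
  fixes k :: "nat \<Rightarrow> int"
  assumes m0: "\<phi> m0 \<in> W" and rel: "(\<Sum>i<r. of_int (k i) *\<^sub>R lattice_field i m0) = 0" and "i < r"
  shows "k i = 0"
proof -
  let ?b = "\<phi> m0"
  let ?e = "\<lambda>i. action_class A P A' P' \<phi> ?b (differential A' (p i) ?b)"
  \<comment> \<open>Truncated because \<open>integer_basis\<close> compares only sequences that
    vanish from the index \<open>r\<close> on.\<close>
  let ?k = "\<lambda>i. if i < r then k i else 0"
  have ib: "integer_basis A P A' P' \<phi> r ?b ?e"
    using av m0 by (simp add: action_variables_def lattice_trivialization_def)
  have "sharp P m (pullback A A' \<phi> m (\<Sum>i<r. of_int (?k i) *\<^sub>R representative (?e i)))
      = sharp P m (pullback A A' \<phi> m 0)" if m: "\<phi> m = ?b" for m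
  proof -
    have "sharp P m (pullback A A' \<phi> m (\<Sum>i<r. of_int (?k i) *\<^sub>R representative (?e i)))
        = (\<Sum>i<r. of_int (?k i) *\<^sub>R action_vector A P A' \<phi> (?e i) m)"
      by (simp add: action_vector_def linear_sum[OF pullback_linear[OF nci]] linear_scale[OF pullback_linear[OF nci]]
          linear_sum[OF sharp_linear[OF mA pP]] linear_scale[OF sharp_linear[OF mA pP]])
    also have "\<dots> = (\<Sum>i<r. of_int (k i) *\<^sub>R lattice_field i m)"
    proof (rule sum.cong[OF refl])
      fix i assume "i \<in> {..<r}"
      then have i: "i < r" by simp
      show "of_int (?k i) *\<^sub>R action_vector A P A' \<phi> (?e i) m = of_int (k i) *\<^sub>R lattice_field i m"
        using action_vector_action_class[OF action_variables_kernel[OF av i m0] m] m m0 i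
        by (simp add: lattice_field_eq_pullback)
    qed
    also have "\<dots> = 0" by (rule lattice_field_relation_on_fiber[OF m0 m rel])
    finally show ?thesis by (simp add: linear_0[OF pullback_linear[OF nci]] linear_0[OF sharp_linear[OF mA pP]])
  qed
  from action_class_eqI[OF this]
  have eq: "action_class A P A' P' \<phi> ?b 0
      = action_class A P A' P' \<phi> ?b (\<Sum>i<r. of_int (?k i) *\<^sub>R representative (?e i))" by simp
  define Q where "Q k \<longleftrightarrow> (\<forall>i\<ge>r. k i = 0) \<and> action_class A P A' P' \<phi> ?b 0
      = action_class A P A' P' \<phi> ?b (\<Sum>i<r. of_int (k i) *\<^sub>R representative (?e i))"
    for k :: "nat \<Rightarrow> int"
  have "\<exists>!k. Q k"
    using ib zero_in_action_lattice[of ?b] unfolding integer_basis_def Q_def by blast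
  then obtain k0 where k0: "\<forall>k'. Q k' \<longrightarrow> k' = k0" by (elim ex1E) simp
  have "Q ?k" unfolding Q_def by (rule conjI[OF _ eq]) simp
  with k0 have "?k = k0" by (elim allE impE)
  moreover have "Q (\<lambda>_. 0)" by (simp add: Q_def)
  with k0 have "(\<lambda>_. 0) = k0" by (elim allE impE)
  ultimately have "?k = (\<lambda>_. 0)" by simp
  from fun_cong[OF this, of i] \<open>i < r\<close> show ?thesis by simp
qed


section \<open>Real independence of the action fields from the periodicity of their flows\<close>

context
  assumes flows: "\<And>i. i < r \<Longrightarrow> \<exists>\<Phi>. is_flow A (\<phi> -` W) (lattice_field i) \<Phi>"
begin

text \<open>Membership in the lattice provides some closed integral curve through \<open>m\<close>
  inside the fiber. Uniqueness of integral curves identifies it with the orbit of the given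
  flow.\<close>

lemma lattice_field_flow_periodic:
  assumes i: "i < r" and \<Phi>: "is_flow A (\<phi> -` W) (lattice_field i) \<Phi>" and m: "\<phi> m \<in> W"
  shows "\<Phi> 1 m = m"
proof -
  let ?e = "action_class A P A' P' \<phi> (\<phi> m) (differential A' (p i) (\<phi> m))"
  have "?e \<in> action_lattice A P A' P' \<phi> (\<phi> m)"
    using action_variables_section[OF av i] m unfolding lattice_section_def by blast
  then obtain \<gamma> where \<gamma>: "integral_curve A (\<phi> -` {\<phi> m}) (action_vector A P A' \<phi> ?e) \<gamma>" "\<gamma> 0 = m" "\<gamma> 1 = m"
    unfolding action_lattice_def by auto
  have "integral_curve A (\<phi> -` W) (lattice_field i) \<gamma>"
  proof (rule integral_curve_cong[OF \<gamma>(1)])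
    show "\<phi> -` {\<phi> m} \<subseteq> \<phi> -` W" using m by auto
    fix q assume "q \<in> \<phi> -` {\<phi> m}"
    then have q: "\<phi> q = \<phi> m" by simp
    show "action_vector A P A' \<phi> ?e q = lattice_field i q"
      using action_vector_action_class[OF action_variables_kernel[OF av i m] q] i m
      by (simp add: lattice_field_eq_pullback q)
  qed
  from integral_curve_unique[OF mA lattice_field_smooth[OF i] open_lift[OF nci W] flow_integral_curve[OF mA \<Phi>] this, of m 0 1]
  show ?thesis using \<gamma> m flow_zero[OF mA \<Phi>, of m] by simp
qed

lemma lattice_field_independent:
  assumes m0: "\<phi> m0 \<in> W"
  shows "lin_indep r (\<lambda>i. lattice_field i m0)"
  unfolding lin_indep_def
proof (rule ccontr)
  assume "\<not> (\<forall>a. (\<Sum>i<r. a i *\<^sub>R lattice_field i m0) = 0 \<longrightarrow> (\<forall>i<r. a i = 0))"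
  then obtain a l where a: "(\<Sum>i<r. a i *\<^sub>R lattice_field i m0) = 0" and l: "l < r" "a l \<noteq> 0" by blast
  \<comment> \<open>The relation is normalized at the index \<open>l\<close>: an approximation of
    the coefficient 1 with denominator \<open>q\<close> and error below 1 must have the numerator
    \<open>q\<close>.\<close>
  define \<theta> where "\<theta> i = a i / a l" for i
  have \<theta>l: "\<theta> l = 1" using l by (simp add: \<theta>_def)
  have "(\<Sum>i<r. \<theta> i *\<^sub>R lattice_field i m0) = (1 / a l) *\<^sub>R (\<Sum>i<r. a i *\<^sub>R lattice_field i m0)"
    by (simp add: \<theta>_def scaleR_sum_right)
  then have \<theta>0: "(\<Sum>i<r. \<theta> i *\<^sub>R lattice_field i m0) = 0" using a by simp
  let ?U = "\<phi> -` W"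
  have U: "open ?U" "m0 \<in> ?U" using open_lift[OF nci W] m0 by auto
  obtain \<Phi> where \<Phi>: "\<And>i. i < r \<Longrightarrow> is_flow A ?U (lattice_field i) (\<Phi> i)" using flows by metis
  let ?D = "chart_dom A m0" and ?c = "coord A m0"
  note ch = chart_at_in_atlas[OF mA, of m0] chart_at_mem[OF mA, of m0]
  let ?S = "?c ` (?U \<inter> ?D)" and ?x = "?c m0"
  let ?X = "\<lambda>i. field_in_chart A ?D ?c (lattice_field i)"
  have S: "open ?S" "?x \<in> ?S" using open_chart_image[OF mA ch(1) U(1)] U ch by auto
  have sX: "smooth_on (?X i) ?S" if "i < r" for i
    by (rule smooth_field_in_chart[OF mA lattice_field_smooth[OF that] U(1) ch(1)])
  have "\<exists>d L. d > 0 \<and> L \<ge> 0 \<and> ball ?x d \<subseteq> ?S \<and>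
      (\<forall>x\<in>ball ?x d. \<forall>y\<in>ball ?x d. norm (?X i x - ?X i y) \<le> L * norm (x - y))" if "i < r" for i
    by (rule smooth_on_local_bound[OF S(1) sX[OF that] S(2)]) blast
  then obtain d L where d: "\<And>i. i < r \<Longrightarrow> d i > 0" "\<And>i. i < r \<Longrightarrow> ball ?x (d i) \<subseteq> ?S"
    and L: "\<And>i. i < r \<Longrightarrow> L i \<ge> (0::real)"
    and lip: "\<And>i x y. i < r \<Longrightarrow> x \<in> ball ?x (d i) \<Longrightarrow> y \<in> ball ?x (d i) \<Longrightarrow>
      norm (?X i x - ?X i y) \<le> L i * norm (x - y)" by metis
  define \<delta> where "\<delta> = Min (d ` {..<r})"
  have \<delta>: "\<delta> > 0" "\<And>i. i < r \<Longrightarrow> \<delta> \<le> d i"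
    unfolding \<delta>_def using d(1) l by (auto intro!: Min_gr_iff[THEN iffD2])
  have in_d: "x \<in> ball ?x (d i)" if "x \<in> ball ?x \<delta>" "i < r" for x i using that \<delta>(2)[of i] by simp
  \<comment> \<open>On the ball of radius \<open>\<delta>\<close>, \<open>Ls\<close> and
    \<open>K\<close> bound the Lipschitz constant and the size of any combination of the fields with
    coefficients of absolute value at most 1.\<close>
  define Ls where "Ls = (\<Sum>i<r. L i)"
  define K where "K = (\<Sum>i<r. norm (?X i ?x) + L i * \<delta>)"
  have nonneg: "Ls \<ge> 0" "K \<ge> 0"
    unfolding Ls_def K_def using L \<delta>(1) by (auto intro!: sum_nonneg add_nonneg_nonneg)
  \<comment> \<open>\<open>N\<close> has three tasks: \<open>1 < N\<close> forces
    \<open>pk l = q\<close>, \<open>Ls < N\<close> makes the Lipschitz constant smaller than 1, and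
    \<open>2 * K / \<delta> < N\<close> keeps the speed at most \<open>\<delta> / 2\<close>.\<close>
  obtain N :: nat where N: "Ls + 2 * K / \<delta> + 1 < real N" using reals_Archimedean2 by blast
  have "2 * K / \<delta> \<ge> 0" using nonneg \<delta>(1) by simp
  then have N1: "1 < real N" "Ls < real N" "2 * K / \<delta> < real N"
    using N nonneg by linarith+
  have "N > 0" using N1 by simp
  obtain q pk where q: "0 < q" and pk: "\<And>i. i < r \<Longrightarrow> \<bar>of_int q * \<theta> i - of_int (pk i)\<bar> < 1 / real N"
    using Dirichlet_approx_simult[OF \<open>N > 0\<close>, of r \<theta>] by metis
  \<comment> \<open>The integer vector minus \<open>q\<close> times the relation
    \<open>\<theta>\<close>. On the fiber the subtraction leaves the field unchanged, while the
    coefficients become at most \<open>1 / N\<close>.\<close>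
  define \<mu> where "\<mu> i = of_int (pk i) - of_int q * \<theta> i" for i
  have \<mu>: "\<bar>\<mu> i\<bar> \<le> 1 / real N" if "i < r" for i using pk[OF that] by (simp add: \<mu>_def)
  have "\<bar>real_of_int q - of_int (pk l)\<bar> < 1 / real N" using pk[OF l(1)] by (simp add: \<theta>l)
  also have "1 / real N < 1" using N1(1) by simp
  finally have "real_of_int \<bar>q - pk l\<bar> < 1" by simp
  then have pkl: "pk l = q" by linarith
  let ?Y = "\<lambda>m. \<Sum>i<r. of_int (pk i) *\<^sub>R lattice_field i m"
  have push: "tangent_map A A (\<Phi> i t) m (lattice_field j m) = lattice_field j (\<Phi> i t m)"
    if ij: "i < r" "j < r" "m \<in> ?U" for i j t m
  proof (rule flow_preserves_commuting_field[OF mA \<Phi>[OF ij(1)] U(1) lattice_field_smooth[OF ij(1)] lattice_field_smooth[OF ij(2)] _ ij(3)])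
    fix D c x assume c: "(D, c) \<in> A" and x: "x \<in> c ` (?U \<inter> D)"
    have "poisson_bracket A P (\<lambda>q. p i (\<phi> q)) (\<lambda>q. p j (\<phi> q)) q = 0" if "q \<in> ?U" for q
      using lifted_bracket_zero[OF ij(1) _ p_differentiable[OF ij(2)]] that by simp
    from commuting_hamiltonians_in_chart[OF mA pP U(1) lifted_p_smooth[OF ij(1)] lifted_p_smooth[OF ij(2)] this c x]
    show "frechet_derivative (field_in_chart A D c (lattice_field j)) (at x) (field_in_chart A D c (lattice_field i) x)
      = frechet_derivative (field_in_chart A D c (lattice_field i)) (at x) (field_in_chart A D c (lattice_field j) x)"
      by (simp add: lattice_field_def[abs_def])
  qed
  have per: "\<Phi> i 1 m0 = m0" if "i < r" for i by (rule lattice_field_flow_periodic[OF that \<Phi>[OF that] m0])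
  have "\<exists>\<sigma>. integral_curve A ?U ?Y \<sigma> \<and> \<sigma> 0 = m0 \<and> \<sigma> 1 = m0"
    by (rule integer_combination_periodic[OF mA U lattice_field_smooth \<Phi> per push])
  then obtain \<sigma> where \<sigma>: "integral_curve A ?U ?Y \<sigma>" "\<sigma> 0 = m0" "\<sigma> 1 = m0" by blast
  have Yvert: "?Y m \<in> vertical A A' \<phi> m" if "m \<in> ?U" for m
    using that lattice_field_vertical by (intro subspace_sum[OF subspace_vertical[OF nci]] subspace_scale[OF subspace_vertical[OF nci]]) simp
  \<comment> \<open>The relation is known only on the fiber of \<open>m0\<close>, so the closed
    orbit must be located there before its velocity can be rewritten with the small
    coefficients.\<close>
  have fib: "\<phi> (\<sigma> t) = \<phi> m0" for t
    using vertical_curve_in_fiber[OF mA mA' nci_smooth[OF nci] \<sigma>(1) Yvert, of t] \<sigma>(2) by simp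
  have Y\<mu>: "?Y m = (\<Sum>i<r. \<mu> i *\<^sub>R lattice_field i m)" if "\<phi> m = \<phi> m0" for m
  proof -
    have "(\<Sum>i<r. \<mu> i *\<^sub>R lattice_field i m) = ?Y m - of_int q *\<^sub>R (\<Sum>i<r. \<theta> i *\<^sub>R lattice_field i m)"
      by (simp add: \<mu>_def scaleR_diff_left sum_subtractf scaleR_sum_right)
    then show ?thesis using lattice_field_relation_on_fiber[OF m0 that \<theta>0] by simp
  qed
  have dY: "differential A ?c (\<sigma> t) (?Y (\<sigma> t)) = (\<Sum>i<r. \<mu> i *\<^sub>R ?X i (?c (\<sigma> t)))" if "\<sigma> t \<in> ?D" for t
    unfolding Y\<mu>[OF fib] using that
    by (simp add: field_in_chart_at[OF mA ch(1)] blinfun.sum_right blinfun.scaleR_right)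
  \<comment> \<open>The Lipschitz estimates hold in a ball of one chart. With speed at most
    \<open>\<delta> / 2\<close> the orbit stays in it during the unit time after which it closes
    up.\<close>
  have stay: "\<sigma> t \<in> ?D \<inter> ?c -` ball ?x \<delta>" if t: "t \<in> {0..1}" for t
  proof -
    have "\<sigma> t \<in> ?D \<inter> ?c -` ball (?c (\<sigma> 0)) (2 * (\<delta> / 2))"
    proof (rule integral_curve_stays_in_ball[OF mA \<sigma>(1) ch(1) _ _ _ _ t])
      show "\<sigma> 0 \<in> ?D" "\<delta> / 2 > 0" using \<sigma>(2) ch \<delta> by simp_all
      show "ball (?c (\<sigma> 0)) (2 * (\<delta> / 2)) \<subseteq> ?c ` ?D"
      proof
        fix x assume "x \<in> ball (?c (\<sigma> 0)) (2 * (\<delta> / 2))"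
        then have "x \<in> ball ?x \<delta>" using \<sigma>(2) by simp
        then have "x \<in> ?S" using d(2)[OF l(1)] in_d[OF _ l(1)] by blast
        then show "x \<in> ?c ` ?D" by auto
      qed
      fix s assume s: "\<sigma> s \<in> ?D" "?c (\<sigma> s) \<in> ball (?c (\<sigma> 0)) (2 * (\<delta> / 2))"
      then have inb: "?c (\<sigma> s) \<in> ball ?x \<delta>" using \<sigma>(2) by simp
      have "norm (differential A ?c (\<sigma> s) (?Y (\<sigma> s))) \<le> (\<Sum>i<r. 1 / real N * (norm (?X i ?x) + L i * \<delta>))"
        unfolding dY[OF s(1)]
      proof (rule sum_norm_le)
        fix i assume "i \<in> {..<r}"
        then have i: "i < r" by simp
        have "norm (?X i (?c (\<sigma> s))) \<le> norm (?X i ?x) + norm (?X i (?c (\<sigma> s)) - ?X i ?x)"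
          using norm_triangle_ineq[of "?X i ?x" "?X i (?c (\<sigma> s)) - ?X i ?x"] by simp
        also have "norm (?X i (?c (\<sigma> s)) - ?X i ?x) \<le> L i * norm (?c (\<sigma> s) - ?x)"
          by (rule lip[OF i in_d[OF inb i]]) (use d(1)[OF i] in simp)
        also have "\<dots> \<le> L i * \<delta>"
          using inb by (intro mult_left_mono L[OF i]) (simp add: dist_norm norm_minus_commute)
        finally have "norm (?X i (?c (\<sigma> s))) \<le> norm (?X i ?x) + L i * \<delta>" by simp
        then show "norm (\<mu> i *\<^sub>R ?X i (?c (\<sigma> s))) \<le> 1 / real N * (norm (?X i ?x) + L i * \<delta>)"
          unfolding norm_scaleR by (intro mult_mono \<mu>[OF i]) auto
      qed
      also have "\<dots> = K / real N" by (simp add: K_def sum_divide_distrib)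
      also have "\<dots> \<le> \<delta> / 2" using N1 \<delta>(1) by (simp add: field_simps)
      finally show "norm (differential A ?c (\<sigma> s) (?Y (\<sigma> s))) \<le> \<delta> / 2" .
    qed
    then show ?thesis using \<sigma>(2) by simp
  qed
  define \<gamma> where "\<gamma> t = ?c (\<sigma> t)" for t
  define y where "y t = (\<Sum>i<r. \<mu> i *\<^sub>R ?X i (\<gamma> t))" for t
  have in\<delta>: "\<gamma> t \<in> ball ?x \<delta>" if "t \<in> {0..1}" for t using stay[OF that] by (simp add: \<gamma>_def)
  have \<gamma>': "(\<gamma> has_vector_derivative y t) (at t)" if "t \<in> {0..1}" for t
  proof -
    have tD: "\<sigma> t \<in> ?D" using stay[OF that] by simp
    from integral_curve_along[OF mA \<sigma>(1) chart_map_differentiable[OF mA ch(1) tD]]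
    show ?thesis unfolding dY[OF tD] by (simp add: \<gamma>_def[abs_def] y_def)
  qed
  have lipy: "norm (y s - y t) \<le> (Ls / real N) * norm (\<gamma> s - \<gamma> t)" if st: "s \<in> {0..1}" "t \<in> {0..1}" for s t
  proof -
    have "y s - y t = (\<Sum>i<r. \<mu> i *\<^sub>R (?X i (\<gamma> s) - ?X i (\<gamma> t)))"
      by (simp add: y_def sum_subtractf scaleR_diff_right)
    also have "norm \<dots> \<le> (\<Sum>i<r. 1 / real N * (L i * norm (\<gamma> s - \<gamma> t)))"
    proof (rule sum_norm_le)
      fix i assume "i \<in> {..<r}"
      then have i: "i < r" by simp
      show "norm (\<mu> i *\<^sub>R (?X i (\<gamma> s) - ?X i (\<gamma> t))) \<le> 1 / real N * (L i * norm (\<gamma> s - \<gamma> t))"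
        unfolding norm_scaleR
        by (intro mult_mono \<mu>[OF i] lip[OF i] in_d[OF in\<delta>] st i) auto
    qed
    also have "\<dots> = (Ls / real N) * norm (\<gamma> s - \<gamma> t)"
      by (simp add: Ls_def sum_divide_distrib sum_distrib_right)
    finally show ?thesis .
  qed
  have cont\<gamma>: "continuous_on {0..1} \<gamma>"
    by (intro continuous_at_imp_continuous_on ballI has_vector_derivative_continuous[OF \<gamma>'])
  have "continuous_on {0..1} y"
    unfolding y_def
  proof (intro continuous_on_sum continuous_on_scaleR continuous_on_const)
    fix i assume "i \<in> {..<r}"
    then have i: "i < r" by simp
    show "continuous_on {0..1} (\<lambda>t. ?X i (\<gamma> t))"
      by (rule continuous_on_compose2[OF smooth_on_continuous[OF sX[OF i]] cont\<gamma>])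
         (use in_d[OF in\<delta> i] d(2)[OF i] in blast)
  qed
  moreover have "Ls / real N \<ge> 0" "Ls / real N < 1" using nonneg N1 by auto
  moreover have "\<gamma> 0 = \<gamma> 1" by (simp add: \<gamma>_def \<sigma>)
  ultimately have "y 0 = 0" using periodic_orbit_constant[OF \<gamma>' lipy] by blast
  then have "differential A ?c m0 (?Y m0) = 0"
    using dY[of 0] ch by (simp add: y_def \<gamma>_def \<sigma>)
  then have "?Y m0 = 0" by (simp add: differential_coord[OF mA])
  \<comment> \<open>The vanishing of \<open>?Y\<close> at \<open>m0\<close> is an integer relation,
    so \<open>pk l\<close> would be 0, whereas it equals the positive integer
    \<open>q\<close>.\<close>
  from integer_relation_trivial[OF m0 this l(1)] pkl q show False by simp
qed

end

end

end

section \<open>The transverse foliation\<close>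

text \<open>The frame dual to the differentials of the \<open>h k\<close>. In a chart it solves,
  point by point, an invertible linear system with smooth coefficients, so its smoothness needs no
  new chart made of the functions \<open>h k\<close>.\<close>

lemma coordinate_vector_fields:
  fixes A :: "('n::{t2_space, second_countable_topology}, 'f::euclidean_space) atlas"
    and h :: "nat \<Rightarrow> 'n \<Rightarrow> real"
  assumes mfd: "smooth_manifold A" and "open W"
    and h: "\<And>k. k < DIM('f) \<Longrightarrow> smooth_fun_on A W (h k)"
    and inj: "\<And>q v. q \<in> W \<Longrightarrow> (\<And>k. k < DIM('f) \<Longrightarrow> differential A (h k) q v = 0) \<Longrightarrow> v = 0"
  obtains Y where "\<And>j. j < DIM('f) \<Longrightarrow> smooth_vector_field A W (Y j)"
    "\<And>j k q. j < DIM('f) \<Longrightarrow> k < DIM('f) \<Longrightarrow> q \<in> W \<Longrightarrow>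
      differential A (h k) q (Y j q) = (if k = j then 1 else 0)"
proof -
  let ?n = "DIM('f)"
  obtain bs where bs: "bij_betw bs {0..<?n} (Basis :: 'f set)"
    using ex_bij_betw_nat_finite[OF finite_Basis] by blast
  have ortho: "bs k \<bullet> bs j = (if k = j then 1 else 0)" if "k < ?n" "j < ?n" for k j
  proof -
    have "bs k \<in> Basis" "bs j \<in> Basis" using bs that by (auto simp: bij_betw_def)
    moreover have "bs k = bs j \<longleftrightarrow> k = j"
      using bs that by (auto simp: bij_betw_def dest: inj_onD)
    ultimately show ?thesis by (simp add: inner_Basis)
  qed
  have inner: "(\<Sum>k<?n. a k *\<^sub>R bs k) \<bullet> bs j = a j" if "j < ?n" for a j
  proof -
    have "(\<Sum>k<?n. a k *\<^sub>R bs k) \<bullet> bs j = (\<Sum>k<?n. if k = j then a k else 0)"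
      unfolding inner_sum_left by (rule sum.cong) (use ortho that in auto)
    then show ?thesis using that by simp
  qed
  \<comment> \<open>All differentials packed into one endomorphism of the model space, for which the
    injectivity hypothesis implies bijectivity.\<close>
  define L where "L q v = (\<Sum>k<?n. differential A (h k) q v *\<^sub>R bs k)" for q v
  have Llin: "linear (L q)" for q
    by (rule linearI) (simp_all add: L_def blinfun.add_right blinfun.scaleR_right scaleR_add_left
        sum.distrib scaleR_sum_right)
  have Lzero: "v = 0" if "q \<in> W" "L q v = 0" for q v
  proof (rule inj[OF that(1)])
    show "differential A (h k) q v = 0" if "k < ?n" for k
      using inner[OF that, of "\<lambda>k. differential A (h k) q v"] \<open>L q v = 0\<close> by (simp add: L_def)
  qed
  have Linj: "inj (L q)" if "q \<in> W" for q
    using Lzero[OF that] linear_injective_0[OF Llin] by blast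
  have Lsurj: "surj (L q)" if "q \<in> W" for q
    by (rule linear_injective_imp_surjective[OF Llin Linj[OF that] refl])
  define Y where "Y j q = inv (L q) (bs j)" for j q
  have LY: "L q (Y j q) = bs j" if "q \<in> W" for j q
    unfolding Y_def by (rule surj_f_inv_f[OF Lsurj[OF that]])
  show thesis
  proof (rule that[of Y])
    fix j k q assume jk: "j < ?n" "k < ?n" and q: "q \<in> W"
    show "differential A (h k) q (Y j q) = (if k = j then 1 else 0)"
      using inner[OF jk(2), of "\<lambda>k. differential A (h k) q (Y j q)"] LY[OF q, of j] ortho[OF jk]
      by (auto simp: L_def)
  next
    fix j assume "j < ?n"
    show "smooth_vector_field A W (Y j)"
    proof (rule smooth_vector_fieldI[OF mfd \<open>open W\<close>])
      fix D c assume c: "(D, c) \<in> A"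
      let ?S = "c ` (W \<inter> D)"
      let ?L = "\<lambda>x v. \<Sum>k<?n. frechet_derivative (\<lambda>x. h k (inv_into D c x)) (at x) v *\<^sub>R bs k"
      have S: "open ?S" by (rule open_chart_image[OF mfd c \<open>open W\<close>])
      have hs: "smooth_on (\<lambda>x. h k (inv_into D c x)) ?S" if "k < ?n" for k
        by (rule smooth_fun_on_chart[OF mfd h[OF that] c])
      have L_eq: "?L (c q) (differential A c q v) = L q v" if q: "q \<in> W" "q \<in> D" for q v
        unfolding L_def
        by (rule sum.cong) (use differential_eq_chart[OF mfd smooth_fun_on_differentiable_mfd[OF mfd h \<open>open W\<close> q(1)] c q(2)] in auto)
      show "smooth_on (field_in_chart A D c (Y j)) ?S"
      proof (rule smooth_on_linear_solve[OF S, where L = ?L and b = "\<lambda>x. bs j"])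
        fix x assume x: "x \<in> ?S"
        then obtain q where q: "q \<in> W" "q \<in> D" "x = c q" by auto
        show lin: "linear (?L x)"
        proof (rule linear_compose_sum, rule ballI)
          fix k assume "k \<in> {..<?n}"
          then have "(\<lambda>x. h k (inv_into D c x)) differentiable at x"
            by (intro smooth_on_differentiable[OF S hs x]) simp
          note lin = linear_frechet_derivative[OF this]
          show "linear (\<lambda>v. frechet_derivative (\<lambda>x. h k (inv_into D c x)) (at x) v *\<^sub>R bs k)"
            by (rule linearI) (simp_all add: linear_add[OF lin] linear_scale[OF lin] scaleR_add_left)
        qed
        show "inj (?L x)"
          unfolding linear_injective_0[OF lin]
        proof (intro allI impI)
          fix v assume v: "?L x v = 0"
          obtain v0 where v0: "v = differential A c q v0"
            using differential_chart_surj[OF mfd c q(2)] by (auto elim: surjE)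
          have "L q v0 = 0" using v by (simp add: v0 q(3) L_eq[OF q(1,2)])
          then have "v0 = 0" by (rule Lzero[OF q(1)])
          then show "v = 0" by (simp add: v0 blinfun.zero_right)
        qed
        show "?L x (field_in_chart A D c (Y j) x) = bs j"
          unfolding q(3) field_in_chart_at[OF mfd c q(2)] L_eq[OF q(1,2)] by (rule LY[OF q(1)])
      next
        show "smooth_on (\<lambda>x. ?L x v) ?S" for v
          by (intro smooth_on_sum[OF S] smooth_on_bilinear[OF bounded_bilinear_scaleR S] smooth_on_const[OF S]
              smooth_on_frechet_derivative[OF S hs]) simp
      qed (rule smooth_on_const[OF S])
    qed
  qed
qed

lemma foliation_chart:
  fixes A :: "('m::topological_space, 'e::euclidean_space) atlas"
  assumes "foliation A k U F" "m \<in> U"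
  obtains W f where "open W" "m \<in> W" "W \<subseteq> U"
    "\<forall>i<DIM('e) - k. smooth_fun_on A W (f i :: 'm \<Rightarrow> real)"
    "\<forall>q\<in>W. F q = {v. \<forall>i<DIM('e) - k. differential A (f i) q v = 0} \<and> dim (F q) = k"
proof -
  have "\<forall>m\<in>U. \<exists>W (f :: nat \<Rightarrow> 'm \<Rightarrow> real).
        open W \<and> m \<in> W \<and> W \<subseteq> U \<and> (\<forall>i<DIM('e) - k. smooth_fun_on A W (f i)) \<and>
        (\<forall>q\<in>W. F q = {v. \<forall>i<DIM('e) - k. differential A (f i) q v = 0} \<and> dim (F q) = k)"
    using assms(1) unfolding foliation_def by (elim conjE)
  from bspec[OF this assms(2)] show thesis by (elim exE conjE) (rule that)
qed

lemma foliation_subspace: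
  fixes A :: "('m::topological_space, 'e::euclidean_space) atlas"
  assumes "foliation A k U F" "m \<in> U"
  shows "subspace (F m)" "dim (F m) = k"
proof -
  obtain W f where "m \<in> W" and *: "\<forall>q\<in>W. F q = {v. \<forall>i<DIM('e) - k. differential A (f i) q v = (0::real)} \<and> dim (F q) = k"
    by (rule foliation_chart[OF assms])
  then have F: "F m = {v. \<forall>i<DIM('e) - k. differential A (f i) m v = 0}" "dim (F m) = k" by auto
  show "dim (F m) = k" by (rule F)
  show "subspace (F m)"
    unfolding F subspace_def by (simp add: blinfun.add_right blinfun.scaleR_right blinfun.zero_right)
qed

section \<open>Action variables, an angle foliation and its transverse foliation\<close>

context
  fixes A :: "('m::{t2_space, second_countable_topology}, 'e::euclidean_space) atlas"
    and P :: "('m, 'e) bivector"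
    and A' :: "('n::{t2_space, second_countable_topology}, 'f::euclidean_space) atlas"
    and P' :: "('n, 'f) bivector"
    and \<phi> :: "'m \<Rightarrow> 'n" and r :: nat and V :: "'n set" and G :: "'m \<Rightarrow> 'e set" and T :: "'n \<Rightarrow> 'f set"
    and W p
  assumes nci: "nci_system A P A' P' \<phi> r"
    and angle: "angle_foliation A P A' P' \<phi> r V G"
    and transverse: "transverse_foliation A P A' \<phi> r V G T"
    and W: "open W" "W \<subseteq> V" and av: "action_variables A P A' P' \<phi> r W p"
begin

abbreviation Xp where "Xp \<equiv> lattice_field A P \<phi> p"

text \<open>Invariance of \<open>G\<close> under an action field includes the existence of its
  complete flow. Applied to the lattice section of \<open>p i\<close>, it supplies the flow on which
  the periodicity argument rests.\<close>

lemma invariant_flow: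
  assumes "i < r"
  obtains \<Phi> where "is_flow A (\<phi> -` W) (Xp i) \<Phi>"
    "\<And>t m. m \<in> \<phi> -` W \<Longrightarrow> tangent_map A A (\<Phi> t) m ` G m = G (\<Phi> t m)"
proof -
  let ?e = "\<lambda>b. action_class A P A' P' \<phi> b (differential A' (p i) b)"
  have "\<forall>U e. open U \<and> U \<subseteq> V \<and> lattice_section A P A' P' \<phi> U e \<longrightarrow>
      flow_invariant A (\<phi> -` U) (action_field A P A' \<phi> e) G"
    using angle unfolding angle_foliation_def by (elim conjE)
  from this[rule_format, of W ?e] W action_variables_section[OF nci av assms]
  have "flow_invariant A (\<phi> -` W) (action_field A P A' \<phi> ?e) G" by simp
  then obtain \<Phi> where fl: "is_flow A (\<phi> -` W) (action_field A P A' \<phi> ?e) \<Phi>"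
    and inv: "\<forall>t. \<forall>m\<in>\<phi> -` W. tangent_map A A (\<Phi> t) m ` G m = G (\<Phi> t m)"
    unfolding flow_invariant_def by (elim exE conjE)
  have "is_flow A (\<phi> -` W) (Xp i) \<Phi>"
    by (rule is_flow_cong[OF fl]) (use action_field_eq_lattice_field[OF nci W(1) av assms] in simp)
  with inv that show thesis by blast
qed

lemma Xp_independent: "\<phi> m \<in> W \<Longrightarrow> lin_indep r (\<lambda>i. Xp i m)"
proof (rule lattice_field_independent[OF nci W(1) av])
  fix i assume "i < r"
  then obtain \<Phi> where "is_flow A (\<phi> -` W) (Xp i) \<Phi>" by (rule invariant_flow)
  then show "\<exists>\<Phi>. is_flow A (\<phi> -` W) (Xp i) \<Phi>" by blast
qed

text \<open>These are \<open>r\<close> independent vectors in the vertical space, which has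
  dimension \<open>r\<close>.\<close>

lemma vertical_eq_span:
  assumes "\<phi> m \<in> W"
  shows "vertical A A' \<phi> m = span ((\<lambda>i. Xp i m) ` {..<r})"
proof (rule sym, rule subspace_dim_equal[OF subspace_span subspace_vertical[OF nci]])
  show "span ((\<lambda>i. Xp i m) ` {..<r}) \<subseteq> vertical A A' \<phi> m"
  proof (rule span_minimal[OF image_subsetI subspace_vertical[OF nci]])
    show "Xp i m \<in> vertical A A' \<phi> m" if "i \<in> {..<r}" for i
      by (rule lattice_field_vertical[OF nci W(1) av _ assms]) (use that in simp)
  qed
  have "card ((\<lambda>i. Xp i m) ` {..<r}) = r"
    using card_image[OF lin_indep_independent(1)[OF Xp_independent[OF assms]]] by simp
  then show "dim (span ((\<lambda>i. Xp i m) ` {..<r})) \<ge> dim (vertical A A' \<phi> m)"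
    using dim_span_eq_card_independent[OF lin_indep_independent(2)[OF Xp_independent[OF assms]]]
    by (simp add: dim_vertical[OF nci])
qed

lemma G_complementary: "\<phi> m \<in> V \<Longrightarrow> complementary (G m) (vertical A A' \<phi> m)"
proof -
  assume "\<phi> m \<in> V"
  moreover have "\<forall>m\<in>\<phi> -` V. complementary (G m) (vertical A A' \<phi> m)"
    using angle unfolding angle_foliation_def by (elim conjE)
  ultimately show "complementary (G m) (vertical A A' \<phi> m)" by simp
qed

lemma T_eq: "\<phi> m \<in> V \<Longrightarrow> T (\<phi> m) = tangent_map A A' \<phi> m ` (sharp P m ` annihilator (G m))"
  using transverse unfolding transverse_foliation_def by simp

text \<open>\<open>G m\<close> and the vertical space together span the tangent space; the covector
  vanishes on the first by hypothesis and on the second because the \<open>Xp i\<close> span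
  it.\<close>

lemma annihilator_zero:
  assumes m: "\<phi> m \<in> W" and \<xi>: "\<xi> \<in> annihilator (G m)" and X0: "\<And>i. i < r \<Longrightarrow> blinfun_apply \<xi> (Xp i m) = 0"
  shows "\<xi> = 0"
proof (rule blinfun_eqI)
  fix z
  have "m \<in> \<phi> -` V" using m W by auto
  then have "z \<in> {x + y | x y. x \<in> G m \<and> y \<in> vertical A A' \<phi> m}"
    using G_complementary[of m] by (simp add: complementary_def)
  then obtain x y where xy: "z = x + y" "x \<in> G m" "y \<in> vertical A A' \<phi> m" by auto
  obtain a where "y = (\<Sum>i<r. a i *\<^sub>R Xp i m)"
    using xy(3) unfolding vertical_eq_span[OF m] by (rule span_image_lessThan)
  then have "blinfun_apply \<xi> y = 0" by (simp add: blinfun.sum_right blinfun.scaleR_right X0)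
  moreover have "blinfun_apply \<xi> x = 0" using \<xi> xy(2) by (simp add: annihilator_def)
  ultimately show "blinfun_apply \<xi> z = blinfun_apply 0 z" by (simp add: xy(1) blinfun.add_right)
qed

text \<open>A vector of \<open>T\<close> is the projection of \<open>sharp\<close> of a covector
  \<open>\<xi>\<close> annihilating \<open>G\<close>. By antisymmetry its pairing with the
  differential of \<open>p i\<close> is minus the value of \<open>\<xi>\<close> on
  \<open>Xp i\<close>, so if all pairings vanish then \<open>\<xi> = 0\<close>.\<close>

lemma transverse_vector_zero:
  assumes q: "q \<in> W" and v: "v \<in> T q" and p0: "\<And>i. i < r \<Longrightarrow> differential A' (p i) q v = 0"
  shows "v = 0"
proof -
  obtain m where m: "\<phi> m = q" using nci_surj[OF nci] by (metis surjE)
  have "\<phi> m \<in> V" using m q W by auto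
  from T_eq[OF this] v m obtain \<xi> where \<xi>: "\<xi> \<in> annihilator (G m)" "v = tangent_map A A' \<phi> m (sharp P m \<xi>)"
    by auto
  have "\<xi> = 0"
  proof (rule annihilator_zero[OF _ \<xi>(1)])
    show "\<phi> m \<in> W" using m q by simp
    fix i assume i: "i < r"
    have "blinfun_apply \<xi> (Xp i m) = P m (pullback A A' \<phi> m (differential A' (p i) q)) \<xi>"
      using lattice_field_eq_pullback[OF nci W(1) av i, of m] m q by (simp add: sharp_apply[OF nci_mfd[OF nci] nci_poisson[OF nci]])
    also have "\<dots> = - blinfun_apply (pullback A A' \<phi> m (differential A' (p i) q)) (sharp P m \<xi>)"
      unfolding sharp_apply[OF nci_mfd[OF nci] nci_poisson[OF nci]]
      by (rule bivector_antisym[OF nci_mfd[OF nci] nci_poisson[OF nci]])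
    also have "\<dots> = 0" using p0[OF i] by (simp add: pullback_def \<xi>(2))
    finally show "blinfun_apply \<xi> (Xp i m) = 0" .
  qed
  then show ?thesis
    using \<xi>(2) by (simp add: linear_0[OF sharp_linear[OF nci_mfd[OF nci] nci_poisson[OF nci]]] blinfun.zero_right)
qed

section \<open>A frame of the transverse foliation dual to the action variables\<close>

context
  fixes W0 Y
  assumes W0: "open W0" "W0 \<subseteq> W"
    and Y: "\<And>i. i < r \<Longrightarrow> smooth_vector_field A' W0 (Y i)"
    and Yp: "\<And>i j q. i < r \<Longrightarrow> j < r \<Longrightarrow> q \<in> W0 \<Longrightarrow> differential A' (p j) q (Y i q) = (if j = i then 1 else 0)"
    and YT: "\<And>q. q \<in> W0 \<Longrightarrow> subspace (T q)" "\<And>i q. i < r \<Longrightarrow> q \<in> W0 \<Longrightarrow> Y i q \<in> T q"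
begin

text \<open>Both sides lie in \<open>T q\<close> and have the same pairings with the action
  variables, and these pairings separate the vectors of \<open>T q\<close>.\<close>

lemma transverse_expansion:
  assumes q: "q \<in> W0" and v: "v \<in> T q"
  shows "v = (\<Sum>i<r. differential A' (p i) q v *\<^sub>R Y i q)"
proof -
  let ?w = "\<Sum>i<r. differential A' (p i) q v *\<^sub>R Y i q"
  have "v - ?w = 0"
  proof (rule transverse_vector_zero)
    show "q \<in> W" using q W0 by auto
    show "v - ?w \<in> T q"
      by (intro subspace_diff[OF YT(1)[OF q]] v subspace_sum[OF YT(1)[OF q]] subspace_scale[OF YT(1)[OF q]] YT(2) q) simp
    fix j assume j: "j < r"
    have "(\<Sum>i<r. differential A' (p i) q v * differential A' (p j) q (Y i q))
        = (\<Sum>i<r. if i = j then differential A' (p i) q v else 0)"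
      by (rule sum.cong) (use Yp[OF _ j q] in auto)
    then show "differential A' (p j) q (v - ?w) = 0"
      using j by (simp add: blinfun.diff_right blinfun.sum_right blinfun.scaleR_right)
  qed
  then show ?thesis by simp
qed

lemma span_Y: "q \<in> W0 \<Longrightarrow> span ((\<lambda>i. Y i q) ` {..<r}) = T q"
proof (rule subset_antisym)
  assume q: "q \<in> W0"
  show "span ((\<lambda>i. Y i q) ` {..<r}) \<subseteq> T q"
  proof (rule span_minimal[OF image_subsetI YT(1)[OF q]])
    show "Y i q \<in> T q" if "i \<in> {..<r}" for i by (rule YT(2)) (use that q in simp_all)
  qed
  show "T q \<subseteq> span ((\<lambda>i. Y i q) ` {..<r})"
  proof
    fix v assume "v \<in> T q"
    show "v \<in> span ((\<lambda>i. Y i q) ` {..<r})"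
      by (subst transverse_expansion[OF q \<open>v \<in> T q\<close>])
         (rule span_sum, rule span_scale, rule span_base, rule imageI)
  qed
qed

text \<open>In the formula for the bracket, both functions that get differentiated are constant: a
  field tangent to \<open>F\<close> sends \<open>p j\<close> to 0, and \<open>Y i\<close> sends it
  to 0 or 1.\<close>

lemma Y_preserves_foliation:
  assumes F: "\<And>q. q \<in> W0 \<Longrightarrow> F q = {v. \<forall>j<r. differential A' (p j) q v = 0}" and i: "i < r"
  shows "preserves_foliation A' W0 (Y i) F"
  unfolding preserves_foliation_def
proof (intro allI impI ballI, elim conjE)
  fix U Z q assume U: "open U" "U \<subseteq> W0" and Z: "smooth_vector_field A' U Z" and ZF: "\<forall>q\<in>U. Z q \<in> F q" and q: "q \<in> U"
  note mA' = nci_mfd'[OF nci]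
  have "differential A' (p j) q (lie_bracket A' (Y i) Z q) = 0" if j: "j < r" for j
  proof -
    have pj: "smooth_fun_on A' U (p j)"
      by (rule smooth_fun_on_subset[OF mA' action_variables_smooth[OF nci av j]]) (use U W0 in auto)
    have 1: "differential A' (\<lambda>q. differential A' (p j) q (Z q)) q = 0"
      by (rule differential_eq_0[OF mA' U(1) q, of _ 0]) (use ZF F U j in auto)
    have 2: "differential A' (\<lambda>q. differential A' (p j) q (Y i q)) q = 0"
      by (rule differential_eq_0[OF mA' U(1) q]) (use Yp[OF i j] U in auto)
    show ?thesis
      unfolding lie_bracket_apply[OF mA' U(1) q pj smooth_vector_field_subset[OF mA' Y[OF i] U(2)] Z] 1 2 by simp
  qed
  then show "lie_bracket A' (Y i) Z q \<in> F q" using F U q by auto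
qed

text \<open>Projecting \<open>\<Pi>\<^sup>\<sharp>\<xi>\<close> to \<open>B\<close> for a conormal covector \<open>\<xi>\<close> of \<open>G\<close> gives a vector of \<open>T\<close>, which is
  determined by its pairings with the action variables.\<close>

lemma conormal_expansion:
  assumes m: "\<phi> m \<in> W0" and \<xi>: "\<xi> \<in> annihilator (G m)" and u: "differentiable_mfd A' u (\<phi> m)"
  shows "differential A (\<lambda>x. u (\<phi> x)) m (sharp P m \<xi>)
    = (\<Sum>i<r. differential A (\<lambda>x. p i (\<phi> x)) m (sharp P m \<xi>) * differential A' u (\<phi> m) (Y i (\<phi> m)))"
proof -
  let ?v = "tangent_map A A' \<phi> m (sharp P m \<xi>)"
  have mW: "\<phi> m \<in> W" and mV: "\<phi> m \<in> V" using m W0 W by auto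
  have "?v \<in> T (\<phi> m)" using T_eq[OF mV] \<xi> by auto
  have "differential A (\<lambda>x. u (\<phi> x)) m (sharp P m \<xi>) = differential A' u (\<phi> m) ?v"
    by (simp add: differential_lift[OF nci u] pullback_def)
  also have "\<dots> = (\<Sum>i<r. differential A' (p i) (\<phi> m) ?v * differential A' u (\<phi> m) (Y i (\<phi> m)))"
    by (subst transverse_expansion[OF m \<open>?v \<in> T (\<phi> m)\<close>]) (simp add: blinfun.sum_right blinfun.scaleR_right)
  also have "\<dots> = (\<Sum>i<r. differential A (\<lambda>x. p i (\<phi> x)) m (sharp P m \<xi>) * differential A' u (\<phi> m) (Y i (\<phi> m)))"
    by (rule sum.cong) (simp_all add: differential_lift[OF nci p_differentiable[OF nci W(1) av _ mW]] pullback_def)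
  finally show ?thesis .
qed

text \<open>The identity on the base is tested by brackets upstairs with functions
  \<open>g j\<close> that define \<open>G\<close>. A bracket of a function constant along
  \<open>G\<close> with a lifted function expands in the derivatives along the frame
  \<open>Y\<close>; inserting this in the Jacobi identity leaves the defects of all
  \<open>Y l\<close> with coefficients \<open>C j l\<close>.\<close>

lemma Y_poisson:
  assumes i: "i < r"
  shows "poisson_vector_field A' P' W0 (Y i)"
  unfolding poisson_vector_field_def
proof (intro conjI allI impI ballI Y[OF i], elim conjE)
  fix U u v q assume U: "open U" "U \<subseteq> W0" and u: "smooth_fun_on A' U (u :: 'n \<Rightarrow> real)"
    and v: "smooth_fun_on A' U (v :: 'n \<Rightarrow> real)" and q: "q \<in> U"
  note mA = nci_mfd[OF nci] and mA' = nci_mfd'[OF nci] and pP = nci_poisson[OF nci] and pP' = nci_poisson'[OF nci]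
  obtain m where m: "\<phi> m = q" using nci_surj[OF nci] by (metis surjE)
  let ?b = "poisson_bracket A P" and ?b' = "poisson_bracket A' P'"
  let ?p = "\<lambda>i x. p i (\<phi> x)"
  have fol: "foliation A (DIM('e) - r) (\<phi> -` V) G" using angle unfolding angle_foliation_def by blast
  have rle: "r \<le> DIM('e)" using nci_foliation[OF nci] unfolding foliation_def by blast
  \<comment> \<open>\<open>G\<close> has codimension \<open>r\<close>, so there are as many
    functions \<open>g j\<close> as action variables.\<close>
  then have rr: "DIM('e) - (DIM('e) - r) = r" by simp
  have "m \<in> \<phi> -` V" using m q U W0 W by auto
  obtain O1 g where O1: "open O1" "m \<in> O1" and gs: "\<forall>j<DIM('e) - (DIM('e) - r). smooth_fun_on A O1 (g j :: 'm \<Rightarrow> real)"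
    and Gg: "\<forall>x\<in>O1. G x = {v. \<forall>j<DIM('e) - (DIM('e) - r). differential A (g j) x v = 0} \<and> dim (G x) = DIM('e) - r"
    by (rule foliation_chart[OF fol \<open>m \<in> \<phi> -` V\<close>])
  define S where "S = O1 \<inter> \<phi> -` U"
  have S: "open S" "m \<in> S" "S \<subseteq> O1" "S \<subseteq> \<phi> -` U" "S \<subseteq> \<phi> -` W"
    using O1 open_lift[OF nci U(1)] m q U W0 by (auto simp: S_def)
  have SW: "\<phi> x \<in> U" "\<phi> x \<in> W0" "\<phi> x \<in> W" if "x \<in> S" for x using that S U W0 by auto
  have G: "G x = {v. \<forall>j<r. differential A (g j) x v = 0}" if "x \<in> S" for x
  proof -
    have "x \<in> O1" using that S(3) by auto
    from bspec[OF Gg this] show ?thesis unfolding rr by (rule conjunct1)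
  qed
  have gS: "smooth_fun_on A S (g j)" if "j < r" for j
    by (rule smooth_fun_on_subset[OF mA _ S(3)]) (use gs that in \<open>simp add: rr\<close>)
  have pS: "smooth_fun_on A S (?p l)" if "l < r" for l
    by (rule smooth_fun_on_subset[OF mA lifted_p_smooth[OF nci W(1) av that] S(5)])
  have liftS: "smooth_fun_on A S (\<lambda>x. w (\<phi> x))" if "smooth_fun_on A' U w" for w :: "'n \<Rightarrow> real"
    by (rule smooth_fun_on_subset[OF mA smooth_lift[OF nci U(1) that] S(4)])
  have dS: "differentiable_mfd A k x" if "smooth_fun_on A S k" "x \<in> S" for k :: "'m \<Rightarrow> real" and x
    by (rule smooth_fun_on_differentiable_mfd[OF mA that(1) S(1) that(2)])
  have dU: "differentiable_mfd A' w (\<phi> x)" if "smooth_fun_on A' U w" "x \<in> S" for w :: "'n \<Rightarrow> real" and x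
    by (rule smooth_fun_on_differentiable_mfd[OF mA' that(1) U(1) SW(1)[OF that(2)]])
  have YU: "smooth_fun_on A' U (\<lambda>q. differential A' w q (Y l q))" if "smooth_fun_on A' U w" "l < r"
    for w :: "'n \<Rightarrow> real" and l
    by (rule smooth_fun_on_field[OF mA' Y[OF that(2)] that(1) U])
  \<comment> \<open>Formulated for any \<open>k\<close> whose differential annihilates
    \<open>G\<close>, because it is applied to the \<open>g j\<close> and a second time to the
    brackets \<open>C j l\<close>.\<close>
  have conormal: "?b k (\<lambda>x. w (\<phi> x)) x = (\<Sum>l<r. ?b k (?p l) x * differential A' w (\<phi> x) (Y l (\<phi> x)))"
    if "x \<in> S" "differential A k x \<in> annihilator (G x)" "smooth_fun_on A' U w" for k w x
    unfolding poisson_bracket_sharp[OF mA pP]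
    by (rule conormal_expansion[OF SW(2)[OF that(1)] that(2) dU[OF that(3,1)]])
  have gann: "differential A (g j) x \<in> annihilator (G x)" if "j < r" "x \<in> S" for j x
    using G[OF that(2)] that(1) by (simp add: annihilator_def)
  define C where "C j l = ?b (g j) (?p l)" for j l
  have CS: "smooth_fun_on A S (C j l)" if "j < r" "l < r" for j l
    unfolding C_def by (rule smooth_poisson_bracket[OF mA pP S(1) gS[OF that(1)] pS[OF that(2)]])
  have C_eq: "C j l x = - differential A (g j) x (Xp l x)" for j l x
    unfolding C_def poisson_bracket_antisym[OF mA pP, of "g j"]
    by (simp add: poisson_bracket_sharp[OF mA pP] lattice_field_def[OF nci W(1) av])
  have Cann: "differential A (C j l) x \<in> annihilator (G x)" if jl: "j < r" "l < r" and x: "x \<in> S" for j l x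
  proof -
    obtain \<Phi> where \<Phi>: "is_flow A (\<phi> -` W) (Xp l) \<Phi>"
      "\<And>t m. m \<in> \<phi> -` W \<Longrightarrow> tangent_map A A (\<Phi> t) m ` G m = G (\<Phi> t m)"
      by (rule invariant_flow[OF jl(2)]) (rule that)
    have "differential A (\<lambda>q. differential A (g j) q (Xp l q)) x w = 0" if "w \<in> G x" for w
      by (rule flow_invariant_first_integral[OF mA \<Phi>(1) open_lift[OF nci W(1)] lattice_field_smooth[OF nci W(1) av jl(2)]
            \<Phi>(2) gS[OF jl(1)] S(1) S(5) _ x that])
         (use gann jl in \<open>auto simp: annihilator_def\<close>)
    moreover have "differential A (C j l) x = - differential A (\<lambda>q. differential A (g j) q (Xp l q)) x"
    proof -
      have "(\<lambda>q. differential A (g j) q (Xp l q)) = (\<lambda>q. (- 1) *\<^sub>R C j l q)" by (simp add: C_eq)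
      then show ?thesis using differential_scaleR[OF mA dS[OF CS[OF jl] x], of "- 1"] by simp
    qed
    ultimately show ?thesis by (simp add: annihilator_def blinfun.minus_left)
  qed
  \<comment> \<open>The lifted action variables Poisson commute, so by the Jacobi identity the
    brackets with two of them can be taken in either order.\<close>
  have sym: "?b (C j i) (?p l) m = ?b (C j l) (?p i) m" if jil: "j < r" "i < r" "l < r" for j i l
  proof -
    have "?b (?p i) (?p l) x = 0" if "x \<in> S" for x
      by (rule lifted_bracket_zero[OF nci W(1) av jil(2) SW(3)[OF that] p_differentiable[OF nci W(1) av jil(3) SW(3)[OF that]]])
    then have "?b (g j) (?b (?p i) (?p l)) m = 0"
      by (rule poisson_bracket_zero_right[OF mA pP S(1,2)])
    with poisson_bracket_derivation[OF mA pP S(1,2) gS[OF jil(1)] pS[OF jil(2)] pS[OF jil(3)]]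
    show ?thesis
      using poisson_bracket_antisym[OF mA pP, of "?p i" "C j l" m] by (simp add: C_def)
  qed
  let ?Y = "\<lambda>w l. \<lambda>q. differential A' w q (Y l q)"
  \<comment> \<open>The function \<open>k\<close> is arbitrary: it becomes the lift of
    \<open>v\<close> in one term of the Jacobi identity and the lift of \<open>u\<close> in
    another.\<close>
  have product: "?b k (?b (g j) (\<lambda>x. w (\<phi> x))) m
      = (\<Sum>l<r. C j l m * ?b k (\<lambda>x. ?Y w l (\<phi> x)) m + ?Y w l q * ?b k (C j l) m)"
    if j: "j < r" and w: "smooth_fun_on A' U w" for k j w
  proof -
    have "?b k (?b (g j) (\<lambda>x. w (\<phi> x))) m = ?b k (\<lambda>x. \<Sum>l<r. C j l x * ?Y w l (\<phi> x)) m"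
      by (rule poisson_bracket_cong[OF mA pP S(1,2)])
         (use conormal[OF _ gann[OF j] w] in \<open>auto simp: C_def\<close>)
    also have "\<dots> = (\<Sum>l<r. ?b k (\<lambda>x. C j l x * ?Y w l (\<phi> x)) m)"
    proof (rule poisson_bracket_sum_right[OF mA pP])
      fix l assume "l \<in> {..<r}"
      then show "differentiable_mfd A (\<lambda>x. C j l x * ?Y w l (\<phi> x)) m"
        by (intro dS[OF smooth_fun_on_bilinear[OF mA bounded_bilinear_mult S(1)]] CS j liftS YU w S(2)) simp_all
    qed
    also have "\<dots> = (\<Sum>l<r. C j l m * ?b k (\<lambda>x. ?Y w l (\<phi> x)) m + ?Y w l q * ?b k (C j l) m)"
    proof (rule sum.cong[OF refl])
      fix l assume "l \<in> {..<r}"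
      then have l: "l < r" by simp
      show "?b k (\<lambda>x. C j l x * ?Y w l (\<phi> x)) m
          = C j l m * ?b k (\<lambda>x. ?Y w l (\<phi> x)) m + ?Y w l q * ?b k (C j l) m"
        using poisson_bracket_mult_right[OF mA pP dS[OF CS[OF j l] S(2)] dS[OF liftS[OF YU[OF w l]] S(2)], of k]
        by (simp add: m)
    qed
    finally show ?thesis .
  qed
  \<comment> \<open>The failure of \<open>Y l\<close> to be a derivation of the bracket of
    \<open>u\<close> and \<open>v\<close> at \<open>q\<close>.\<close>
  define E where "E l = ?Y (?b' u v) l q - ?b' (?Y u l) v q - ?b' u (?Y v l) q" for l
  have CE: "(\<Sum>l<r. C j l m * E l) = 0" if j: "j < r" for j
  proof -
    let ?u = "\<lambda>x. u (\<phi> x)" and ?v = "\<lambda>x. v (\<phi> x)"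
    have buv: "smooth_fun_on A' U (?b' u v)" by (rule smooth_poisson_bracket[OF mA' pP' U(1) u v])
    have "?b (g j) (?b ?u ?v) m = ?b (g j) (\<lambda>x. ?b' u v (\<phi> x)) m"
      by (rule poisson_bracket_cong[OF mA pP S(1,2)])
         (auto simp: poisson_bracket_lift[OF nci dU[OF u] dU[OF v]])
    also have "\<dots> = (\<Sum>l<r. C j l m * ?Y (?b' u v) l q)"
      using conormal[OF S(2) gann[OF j S(2)] buv] by (simp add: C_def m)
    finally have 1: "?b (g j) (?b ?u ?v) m = (\<Sum>l<r. C j l m * ?Y (?b' u v) l q)" .
    have expC: "?b (C j l) (\<lambda>x. w (\<phi> x)) m = (\<Sum>k<r. ?b (C j l) (?p k) m * ?Y w k q)"
      if "l < r" "smooth_fun_on A' U w" for l w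
      using conormal[OF S(2) Cann[OF j that(1) S(2)] that(2)] by (simp add: m)
    have lift: "?b (\<lambda>x. w (\<phi> x)) (\<lambda>x. z (\<phi> x)) m = ?b' w z q"
      if "smooth_fun_on A' U w" "smooth_fun_on A' U z" for w z
      using poisson_bracket_lift[OF nci dU[OF that(1) S(2)] dU[OF that(2) S(2)]] by (simp add: m)
    have "?b (?b (g j) ?u) ?v m = - ?b ?v (?b (g j) ?u) m" by (rule poisson_bracket_antisym[OF mA pP])
    also have "\<dots> = (\<Sum>l<r. C j l m * ?b' (?Y u l) v q + ?Y u l q * (\<Sum>k<r. ?b (C j l) (?p k) m * ?Y v k q))"
      unfolding product[OF j u] sum_negf[symmetric]
    proof (rule sum.cong[OF refl])
      fix l assume "l \<in> {..<r}"
      then have l: "l < r" by simp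
      show "- (C j l m * ?b ?v (\<lambda>x. ?Y u l (\<phi> x)) m + ?Y u l q * ?b ?v (C j l) m)
          = C j l m * ?b' (?Y u l) v q + ?Y u l q * (\<Sum>k<r. ?b (C j l) (?p k) m * ?Y v k q)"
        unfolding lift[OF v YU[OF u l]] expC[OF l v, symmetric]
        using poisson_bracket_antisym[OF mA pP, of ?v "C j l" m] poisson_bracket_antisym[OF mA' pP', of v "?Y u l" q]
        by simp
    qed
    finally have 2: "?b (?b (g j) ?u) ?v m
      = (\<Sum>l<r. C j l m * ?b' (?Y u l) v q + ?Y u l q * (\<Sum>k<r. ?b (C j l) (?p k) m * ?Y v k q))" .
    have "?b ?u (?b (g j) ?v) m
        = (\<Sum>l<r. C j l m * ?b' u (?Y v l) q - ?Y v l q * (\<Sum>k<r. ?b (C j l) (?p k) m * ?Y u k q))"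
      unfolding product[OF j v]
    proof (rule sum.cong[OF refl])
      fix l assume "l \<in> {..<r}"
      then have l: "l < r" by simp
      show "C j l m * ?b ?u (\<lambda>x. ?Y v l (\<phi> x)) m + ?Y v l q * ?b ?u (C j l) m
          = C j l m * ?b' u (?Y v l) q - ?Y v l q * (\<Sum>k<r. ?b (C j l) (?p k) m * ?Y u k q)"
        unfolding lift[OF u YU[OF v l]] expC[OF l u, symmetric]
        using poisson_bracket_antisym[OF mA pP, of ?u "C j l" m] by simp
    qed
    note 3 = this
    \<comment> \<open>The double sum is a bilinear form in the frame derivatives of \<open>u\<close>
      and \<open>v\<close> with a symmetric matrix. Exchanging \<open>u\<close> and \<open>v\<close>
      does not change it, so the two occurrences with opposite signs cancel.\<close>
    have swap: "(\<Sum>l<r. ?Y u l q * (\<Sum>k<r. ?b (C j l) (?p k) m * ?Y v k q))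
        = (\<Sum>l<r. ?Y v l q * (\<Sum>k<r. ?b (C j l) (?p k) m * ?Y u k q))"
      unfolding sum_distrib_left
      by (subst sum.swap, rule sum.cong[OF refl], rule sum.cong[OF refl]) (use sym[OF j] in simp)
    have "(\<Sum>l<r. C j l m * ?Y (?b' u v) l q)
        = (\<Sum>l<r. C j l m * ?b' (?Y u l) v q) + (\<Sum>l<r. C j l m * ?b' u (?Y v l) q)"
      using poisson_bracket_derivation[OF mA pP S(1,2) gS[OF j] liftS[OF u] liftS[OF v]] swap
      unfolding 1 2 3 by (simp add: sum.distrib sum_subtractf)
    then show ?thesis by (simp add: E_def right_diff_distrib sum_subtractf)
  qed
  \<comment> \<open>Up to sign \<open>C j l\<close> is the derivative of \<open>g j\<close> along
    \<open>Xp l\<close>. Hence the relations for all \<open>j\<close> say that this vertical vector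
    is tangent to \<open>G\<close>, which meets the vertical space only in 0.\<close>
  let ?z = "\<Sum>l<r. E l *\<^sub>R Xp l m"
  have mW: "\<phi> m \<in> W" by (rule SW(3)[OF S(2)])
  have "differential A (g j) m ?z = 0" if "j < r" for j
    using CE[OF that] by (simp add: C_eq blinfun.sum_right blinfun.scaleR_right sum_negf mult.commute)
  then have "?z \<in> G m" by (simp add: G[OF S(2)])
  moreover have "?z \<in> vertical A A' \<phi> m"
    unfolding vertical_eq_span[OF mW] by (rule span_sum, rule span_scale, rule span_base, rule imageI)
  ultimately have "?z \<in> G m \<inter> vertical A A' \<phi> m" by (rule IntI)
  also have "G m \<inter> vertical A A' \<phi> m = {0}"
    using G_complementary[of m] mW W by (auto simp: complementary_def)
  finally have "?z = 0" by (rule singletonD)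
  from lin_indepD[OF Xp_independent[OF mW] this i]
  show "?Y (?b' u v) i q = ?b' (?Y u i) v q + ?b' u (?Y v i) q" by (simp add: E_def)
qed

end

end

theorem proposition4p10:
  fixes A :: "('m::{t2_space, second_countable_topology}, 'e::euclidean_space) atlas"
    and P :: "('m, 'e) bivector"
    and A' :: "('n::{t2_space, second_countable_topology}, 'f::euclidean_space) atlas"
    and P' :: "('n, 'f) bivector"
    and \<phi> :: "'m \<Rightarrow> 'n" and r :: nat and V :: "'n set"
    and F :: "'n \<Rightarrow> 'f set" and G :: "'m \<Rightarrow> 'e set" and T :: "'n \<Rightarrow> 'f set"
  assumes "nci_system A P A' P' \<phi> r"
    and "compact_fibers \<phi>"
    and "open V"
    and "action_foliation A P A' P' \<phi> r V F"
    and "angle_foliation A P A' P' \<phi> r V G"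
    and "transverse_foliation A P A' \<phi> r V G T"
  shows "(\<forall>b\<in>V. complementary (T b) (F b)) \<and>
         (\<forall>b\<in>V. \<exists>W (Y :: nat \<Rightarrow> 'n \<Rightarrow> 'f). open W \<and> b \<in> W \<and> W \<subseteq> V \<and>
           (\<forall>i<r. poisson_vector_field A' P' W (Y i) \<and> preserves_foliation A' W (Y i) F) \<and>
           (\<forall>q\<in>W. span ((\<lambda>i. Y i q) ` {..<r}) = T q))"
proof -
  note nci = assms(1) and angle = assms(5) and transverse = assms(6)
  note mA' = nci_mfd'[OF nci]
  let ?n = "DIM('f)"
  have fT: "foliation A' r V T" using transverse unfolding transverse_foliation_def by blast
  have fF: "foliation A' (?n - r) V F" using assms(4) unfolding action_foliation_def by blast
  have rn: "r \<le> ?n" using fT unfolding foliation_def by blast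
  have actions: "\<exists>W p. open W \<and> b \<in> W \<and> W \<subseteq> V \<and> action_variables A P A' P' \<phi> r W p \<and>
      (\<forall>q\<in>W. F q = {v. \<forall>i<r. differential A' (p i) q v = 0})" if "b \<in> V" for b
    using assms(4) that unfolding action_foliation_def by blast
  note dims = foliation_subspace[OF fT] foliation_subspace[OF fF]
  have "complementary (T b) (F b)" if b: "b \<in> V" for b
  proof -
    obtain W p where W: "open W" "b \<in> W" "W \<subseteq> V" and av: "action_variables A P A' P' \<phi> r W p"
      and Fp: "\<forall>q\<in>W. F q = {v. \<forall>i<r. differential A' (p i) q v = 0}" using actions[OF b] by blast
    have Fb: "F b = {v. \<forall>i<r. differential A' (p i) b v = 0}" by (rule bspec[OF Fp W(2)])
    have "v = 0" if "v \<in> T b" "v \<in> F b" for v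
      by (rule transverse_vector_zero[OF nci angle transverse W(1,3) av W(2) that(1)]) (use that(2) Fb in auto)
    then have int: "T b \<inter> F b = {0}" using subspace_0[OF dims(3)[OF b]] subspace_0[OF dims(1)[OF b]] by blast
    let ?S = "{x + y | x y. x \<in> T b \<and> y \<in> F b}"
    \<comment> \<open>The dimensions are \<open>r\<close> and \<open>?n - r\<close>, so with trivial
      intersection the sum is the whole space.\<close>
    have "dim ?S = ?n"
      using dim_sums_Int[OF dims(1)[OF b] dims(3)[OF b]] dims(2,4)[OF b] rn by (simp add: int)
    then have "span ?S = UNIV" by (simp add: dim_eq_full)
    moreover have "span ?S = ?S"
      unfolding span_eq_iff by (rule subspace_sums[OF dims(1)[OF b] dims(3)[OF b]])
    ultimately show ?thesis using int unfolding complementary_def by (intro conjI) simp_all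
  qed
  moreover have "\<exists>W (Y :: nat \<Rightarrow> 'n \<Rightarrow> 'f). open W \<and> b \<in> W \<and> W \<subseteq> V \<and>
           (\<forall>i<r. poisson_vector_field A' P' W (Y i) \<and> preserves_foliation A' W (Y i) F) \<and>
           (\<forall>q\<in>W. span ((\<lambda>i. Y i q) ` {..<r}) = T q)" if b: "b \<in> V" for b
  proof -
    obtain W p where W: "open W" "b \<in> W" "W \<subseteq> V" and av: "action_variables A P A' P' \<phi> r W p"
      and Fp: "\<forall>q\<in>W. F q = {v. \<forall>i<r. differential A' (p i) q v = 0}" using actions[OF b] by blast
    obtain W1 h where W1: "open W1" "b \<in> W1" "W1 \<subseteq> V" and h: "\<forall>k<?n - r. smooth_fun_on A' W1 (h k :: 'n \<Rightarrow> real)"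
      and Th: "\<forall>q\<in>W1. T q = {v. \<forall>k<?n - r. differential A' (h k) q v = 0} \<and> dim (T q) = r"
      by (rule foliation_chart[OF fT b])
    define W0 where "W0 = W \<inter> W1"
    have W0: "open W0" "W0 \<subseteq> W" "W0 \<subseteq> W1" "b \<in> W0" "W0 \<subseteq> V" using W W1 by (auto simp: W0_def)
    have T0: "T q = {v. \<forall>k<?n - r. differential A' (h k) q v = 0}" if "q \<in> W0" for q using Th that W0 by blast
    \<comment> \<open>The action variables come first, followed by the functions defining
      \<open>T\<close> with index shifted by \<open>r\<close>. A vector killed by the latter lies in
      \<open>T\<close>, and there only 0 is killed by the action variables.\<close>
    define hp where "hp k = (if k < r then p k else h (k - r))" for k
    have hps: "smooth_fun_on A' W0 (hp k)" if "k < ?n" for k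
    proof (cases "k < r")
      case True
      then show ?thesis
        unfolding hp_def using smooth_fun_on_subset[OF mA' action_variables_smooth[OF nci av True] W0(2)] by simp
    next
      case False
      then have "k - r < ?n - r" using that by simp
      with h have "smooth_fun_on A' W1 (h (k - r))" by (elim allE impE)
      then show ?thesis
        unfolding hp_def using False smooth_fun_on_subset[OF mA' _ W0(3)] by simp
    qed
    have inj: "v = 0" if q: "q \<in> W0" and v: "\<And>k. k < ?n \<Longrightarrow> differential A' (hp k) q v = 0" for q v
    proof (rule transverse_vector_zero[OF nci angle transverse W(1,3) av])
      show "q \<in> W" using q W0 by auto
      show "v \<in> T q" unfolding T0[OF q]
      proof (intro CollectI allI impI)
        fix k assume "k < ?n - r"
        then show "differential A' (h k) q v = 0" using v[of "k + r"] by (simp add: hp_def)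
      qed
      show "differential A' (p i) q v = 0" if "i < r" for i using v[of i] that rn by (simp add: hp_def)
    qed
    obtain Y where Ys: "\<And>j. j < ?n \<Longrightarrow> smooth_vector_field A' W0 (Y j)"
      and Yhp: "\<And>j k q. j < ?n \<Longrightarrow> k < ?n \<Longrightarrow> q \<in> W0 \<Longrightarrow>
        differential A' (hp k) q (Y j q) = (if k = j then 1 else 0)"
    proof (rule coordinate_vector_fields[OF mA' W0(1), of hp])
      show "smooth_fun_on A' W0 (hp k)" if "k < ?n" for k by (rule hps[OF that])
      show "v = 0" if "q \<in> W0" "\<And>k. k < ?n \<Longrightarrow> differential A' (hp k) q v = 0" for q v
        by (rule inj[OF that])
    qed (rule that)
    \<comment> \<open>The first \<open>r\<close> fields of the dual frame are the required ones:
      they kill the functions defining \<open>T\<close>, so they are tangent to it, and they are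
      dual to the action variables.\<close>
    have Y: "smooth_vector_field A' W0 (Y i)" if "i < r" for i using Ys that rn by simp
    have Yp: "differential A' (p j) q (Y i q) = (if j = i then 1 else 0)" if "i < r" "j < r" "q \<in> W0" for i j q
      using Yhp[of i j q] that rn by (simp add: hp_def)
    have YT: "Y i q \<in> T q" if "i < r" "q \<in> W0" for i q
      unfolding T0[OF that(2)]
    proof (intro CollectI allI impI)
      fix k assume "k < ?n - r"
      then show "differential A' (h k) q (Y i q) = 0" using Yhp[of i "k + r" q] that rn by (simp add: hp_def)
    qed
    have sT: "subspace (T q)" if "q \<in> W0" for q by (rule dims(1)) (use that W0 in auto)
    have F0: "F q = {v. \<forall>j<r. differential A' (p j) q v = 0}" if "q \<in> W0" for q using Fp that W0 by blast
    note ctx = nci angle transverse W(1,3) av W0(1,2) Y Yp sT YT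
    show ?thesis
    proof (intro exI[of _ W0] exI[of _ Y] conjI allI impI ballI W0)
      show "poisson_vector_field A' P' W0 (Y i)" if "i < r" for i by (rule Y_poisson[OF ctx that])
      show "preserves_foliation A' W0 (Y i) F" if "i < r" for i by (rule Y_preserves_foliation[OF ctx F0 that])
      show "span ((\<lambda>i. Y i q) ` {..<r}) = T q" if "q \<in> W0" for q by (rule span_Y[OF ctx that])
    qed
  qed
  ultimately show ?thesis by blast
qed

end
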